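(* For every integer $g\ge 0$, there exists a monotone Lagrangian embedding $S^1\times\Sigma_g\to\mathbf{C}^3$, where $\Sigma_g$ is the closed orientable surface of genus $g$.
   Context: $\mathbf{C}^n$ carries its standard symplectic form. A Lagrangian $L\to\mathbf{C}^n$ is called monotone if there exists $K>0$ such that every disc $D$ in $\mathbf{C}^n$ with boundary on $L$ has symplectic area equal to $K\mu(D)$, where $\mu(D)$ is the Maslov index of $D$. *)

theory Defs
  imports
    "HOL-Analysis.Analysis"
    "HOL-Complex_Analysis.Winding_Numbers"
    "HOL-Homology.Homology"
begin

section \<open>Smooth maps and submanifolds of Euclidean spaces\<close>

text \<open>The predicates \<open>Ck_on\<close> and \<open>smooth_on\<close> (class $C^k$, $C^\infty$) are meant for open sets only:
  derivatives are taken in a full neighbourhood of each point.\<close>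

primrec Ck_on ::
  "nat \<Rightarrow> ('a::euclidean_space \<Rightarrow> 'b::euclidean_space) \<Rightarrow> 'a set \<Rightarrow> bool" where
  "Ck_on 0 f U \<longleftrightarrow> continuous_on U f"
| "Ck_on (Suc k) f U \<longleftrightarrow> (\<forall>x\<in>U. f differentiable (at x)) \<and>
     (\<forall>v. Ck_on k (\<lambda>x. frechet_derivative f (at x) v) U)"

definition smooth_on :: "'a::euclidean_space set \<Rightarrow> ('a \<Rightarrow> 'b::euclidean_space) \<Rightarrow> bool" where
  "smooth_on U f \<longleftrightarrow> (\<forall>k. Ck_on k f U)"

text \<open>A map on an arbitrary subset is smooth if near each point it extends to a smooth map on an
  open set of the ambient space; submanifolds are subsets locally diffeomorphic, in this sense, to
  open subsets of the model space \<open>'m\<close>.\<close>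

definition smooth_map_on :: "'a::euclidean_space set \<Rightarrow> ('a \<Rightarrow> 'b::euclidean_space) \<Rightarrow> bool" where
  "smooth_map_on X f \<longleftrightarrow>
     (\<forall>x\<in>X. \<exists>U g. open U \<and> x \<in> U \<and> smooth_on U g \<and> (\<forall>y \<in> X \<inter> U. f y = g y))"

definition diffeomorphic_sets :: "'a::euclidean_space set \<Rightarrow> 'b::euclidean_space set \<Rightarrow> bool" where
  "diffeomorphic_sets X Y \<longleftrightarrow>
     (\<exists>f g. homeomorphism X Y f g \<and> smooth_map_on X f \<and> smooth_map_on Y g)"

definition smooth_submanifold :: "'m::euclidean_space itself \<Rightarrow> 'a::euclidean_space set \<Rightarrow> bool" where
  "smooth_submanifold (_ :: 'm itself) M \<longleftrightarrow>
     (\<forall>p\<in>M. \<exists>W. openin (top_of_set M) W \<and> p \<in> W \<and>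
        (\<exists>V :: 'm set. open V \<and> diffeomorphic_sets V W))"

definition smooth_curve_in :: "'a::euclidean_space set \<Rightarrow> (real \<Rightarrow> 'a) \<Rightarrow> bool" where
  "smooth_curve_in M \<gamma> \<longleftrightarrow> (\<exists>e>0. smooth_on {-e<..<e} \<gamma> \<and> \<gamma> ` {-e<..<e} \<subseteq> M)"

definition tangent_space :: "'a::euclidean_space set \<Rightarrow> 'a \<Rightarrow> 'a set" where
  "tangent_space M p = {vector_derivative \<gamma> (at 0) | \<gamma>. smooth_curve_in M \<gamma> \<and> \<gamma> 0 = p}"

text \<open>The differential of \<open>f\<close> at \<open>p\<close> sends \<open>\<gamma>'(0)\<close> to \<open>(f \<circ> \<gamma>)'(0)\<close> for curves
  \<open>\<gamma>\<close> in \<open>M\<close> through \<open>p\<close>; an immersion is a smooth map whose differentials have trivial kernel.\<close>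

definition smooth_immersion :: "'a::euclidean_space set \<Rightarrow> ('a \<Rightarrow> 'b::euclidean_space) \<Rightarrow> bool" where
  "smooth_immersion M f \<longleftrightarrow> smooth_map_on M f \<and>
     (\<forall>\<gamma>. smooth_curve_in M \<gamma> \<and> vector_derivative \<gamma> (at 0) \<noteq> 0 \<longrightarrow>
          vector_derivative (f \<circ> \<gamma>) (at 0) \<noteq> 0)"

definition smooth_embedding :: "'a::euclidean_space set \<Rightarrow> ('a \<Rightarrow> 'b::euclidean_space) \<Rightarrow> bool" where
  "smooth_embedding M f \<longleftrightarrow> smooth_immersion M f \<and> (\<exists>g. homeomorphism M (f ` M) f g)"


section \<open>Closed orientable surfaces\<close>

text \<open>Orientability is existence of a nowhere vanishing smooth 2-form. The form is given by
  alternating forms on the ambient space; every 2-form on a submanifold arises by restriction of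
  such a family.\<close>

definition orientable_surface :: "'a::euclidean_space set \<Rightarrow> bool" where
  "orientable_surface S \<longleftrightarrow> smooth_submanifold TYPE(real^2) S \<and>
     (\<exists>\<omega> :: 'a \<Rightarrow> 'a \<Rightarrow> 'a \<Rightarrow> real.
        (\<forall>p\<in>S. bilinear (\<omega> p) \<and> (\<forall>v. \<omega> p v v = 0)) \<and>
        (\<forall>u v. smooth_map_on S (\<lambda>p. \<omega> p u v)) \<and>
        (\<forall>p\<in>S. \<exists>u \<in> tangent_space S p. \<exists>v \<in> tangent_space S p. \<omega> p u v \<noteq> 0))"

text \<open>The genus of a closed connected orientable surface is half the rank of its first integral
  homology group, which is free abelian.\<close>

definition closed_orientable_surface_of_genus :: "nat \<Rightarrow> 'a::euclidean_space set \<Rightarrow> bool" where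
  "closed_orientable_surface_of_genus g S \<longleftrightarrow>
     orientable_surface S \<and> compact S \<and> connected S \<and> S \<noteq> {} \<and>
     homology_group 1 (top_of_set S) \<cong> free_Abelian_group {..<2 * g}"


section \<open>Lagrangians in complex space\<close>

text \<open>The form $\sum_j dx_j \wedge dy_j$ with $z_j = x_j + i y_j$.\<close>

definition std_symplectic :: "complex^'n \<Rightarrow> complex^'n \<Rightarrow> real" where
  "std_symplectic u v = (\<Sum>j\<in>UNIV. Re (u $ j) * Im (v $ j) - Im (u $ j) * Re (v $ j))"

definition lagrangian_submanifold :: "(complex^'n) set \<Rightarrow> bool" where
  "lagrangian_submanifold L \<longleftrightarrow> smooth_submanifold TYPE(real^'n) L \<and>
     (\<forall>p\<in>L. \<forall>u \<in> tangent_space L p. \<forall>v \<in> tangent_space L p. std_symplectic u v = 0)"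

definition lagrangian_embedding :: "'a::euclidean_space set \<Rightarrow> ('a \<Rightarrow> complex^'n) \<Rightarrow> bool" where
  "lagrangian_embedding M f \<longleftrightarrow> smooth_embedding M f \<and> lagrangian_submanifold (f ` M)"

definition disc_with_boundary_on :: "(complex^'n) set \<Rightarrow> (complex \<Rightarrow> complex^'n) \<Rightarrow> bool" where
  "disc_with_boundary_on L u \<longleftrightarrow> smooth_map_on (cball 0 1) u \<and> u ` sphere 0 1 \<subseteq> L"

text \<open>The integral of the pulled-back form over the unit disc, in the coordinates
  $z = x + i y$ of the disc.\<close>

definition symplectic_area :: "(complex \<Rightarrow> complex^'n) \<Rightarrow> real" where
  "symplectic_area u = integral (ball 0 1)
     (\<lambda>z. std_symplectic (frechet_derivative u (at z) 1) (frechet_derivative u (at z) \<i>))"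

text \<open>For a Lagrangian subspace \<open>\<Lambda>\<close>, the value at \<open>\<Lambda>\<close> of the map
  $\det^2 : U(n)/O(n) \to S^1$. A real orthonormal basis of \<open>\<Lambda>\<close> is a unitary basis of the
  complex space, and the squared determinant does not depend on its choice.\<close>

definition det_squared :: "(complex^'n) set \<Rightarrow> complex" where
  "det_squared \<Lambda> = (THE d. \<exists>b :: 'n \<Rightarrow> complex^'n.
     (\<forall>i j. inner (b i) (b j) = (if i = j then 1 else 0)) \<and> span (range b) = \<Lambda> \<and>
     d = (det (\<chi> i j. b j $ i))\<^sup>2)"

text \<open>The Maslov index of a disc is the degree of $\det^2$ along the loop of Lagrangian tangent
  spaces over its boundary.\<close>

definition maslov_index :: "(complex^'n) set \<Rightarrow> (complex \<Rightarrow> complex^'n) \<Rightarrow> int" where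
  "maslov_index L u = (THE m. of_int m =
     winding_number (\<lambda>t. det_squared (tangent_space L (u (exp (2 * of_real pi * \<i> * of_real t))))) 0)"

definition monotone_lagrangian :: "(complex^'n) set \<Rightarrow> bool" where
  "monotone_lagrangian L \<longleftrightarrow> lagrangian_submanifold L \<and>
     (\<exists>K>0. \<forall>u. disc_with_boundary_on L u \<longrightarrow>
        symplectic_area u = K * of_int (maslov_index L u))"

definition monotone_lagrangian_embedding ::
  "'a::euclidean_space set \<Rightarrow> ('a \<Rightarrow> complex^'n) \<Rightarrow> bool" where
  "monotone_lagrangian_embedding M f \<longleftrightarrow> lagrangian_embedding M f \<and> monotone_lagrangian (f ` M)"

end

theory Submission
  imports
    Defs
    "HOL-Complex_Analysis.Riemann_Mapping"
begin

text \<open>Take a polynomial \<open>\<psi>\<close> on the plane that is positive exactly inside a disc with \<open>g\<close> round holes and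
  has regular zero level. The surface \<open>w\<^sup>2 = \<psi> (x, y)\<close> is the double of this planar domain, hence has
  genus \<open>g\<close>. The generating family \<open>k (w\<^sup>3 / 3 - w \<psi> (x, y))\<close> in the
  fibre variable \<open>w\<close> defines a Lagrangian immersion of it, which is suspended over a circle of radius \<open>\<epsilon>\<close>:
  \<open>f (e, x, y, w) = (2/3 k w\<^sup>3 + \<i> + \<epsilon> e, x - \<i> \<tau> k w \<psi>\<^sub>x, y - \<i> \<tau> k w \<psi>\<^sub>y)\<close> with \<open>\<tau> = 1 + \<epsilon> Im e\<close>.
  The points \<open>\<plusminus>w\<close> over a critical point of \<open>\<psi>\<close> are the only candidates for double points, and their
  first coordinates differ by \<open>4/3 k w\<^sup>3\<close>, which exceeds the diameter \<open>2 \<epsilon>\<close> of the circle if \<open>\<epsilon>\<close> is small.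
  On the image the primitive \<open>- \<Sum> Im z\<^sub>j dRe z\<^sub>j\<close> of the symplectic form restricts to
  \<open>- \<epsilon> \<tau> dRe e\<close>, so the area of a disc is \<open>\<pi> \<epsilon>\<^sup>2\<close> times the winding number of \<open>e\<close> along its boundary. The
  squared determinant is \<open>(\<i> e P)\<^sup>2\<close> up to a positive factor, where \<open>P\<close> avoids a half-line for small \<open>k\<close>,
  so the Maslov index is twice that winding number.\<close>


section \<open>Smooth maps\<close>

text \<open>A closed exact Lagrangian immersion into two complex dimensions must have double points,
  so they have to be removed rather than avoided. Exactness helps: at the two preimages of a double
  point the generating family takes different values, and the third coordinate records this value.
  The circle blurs it by at most its diameter, hence the comparison with the gap. For the Maslov
  index the loops inside the surface must contribute nothing. For small \<open>k\<close> the
  immersion is nearly flat away from the fold \<open>w = 0\<close>, so the real part of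
  \<open>P\<close> has the sign of \<open>w\<close>. At the fold \<open>P\<close> equals
  \<open>- \<i> * \<tau> * k\<close> times the squared gradient of \<psi>. Thus \<open>P\<close>
  crosses the imaginary axis always on the negative side and cannot wind, although its phase turns
  from one sheet to the other. The order of choice matters. The constant \<open>k\<close> depends
  only on bounds for the first and second derivatives of \<psi> on the compact surface, uniformly
  for \<epsilon> up to \<open>1/2\<close>, while the gap shrinks with \<open>k\<close>; so
  \<open>k\<close> is fixed first and \<epsilon> afterwards. The bound \<open>1/2\<close> keeps
  \<tau> between \<open>1/2\<close> and \<open>3/2\<close>.\<close>

lemma Ck_on_cong:
  assumes "open U" "\<And>x. x \<in> U \<Longrightarrow> f x = g x" "Ck_on k f U"
  shows "Ck_on k g U"
  using assms(2,3)
proof (induction k arbitrary: f g)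
  case 0
  then show ?case by (simp cong: continuous_on_cong)
next
  case (Suc k)
  have D: "(g has_derivative frechet_derivative f (at x)) (at x)" if "x \<in> U" for x
  proof (rule has_derivative_transform_within_open[OF _ \<open>open U\<close> that])
    show "(f has_derivative frechet_derivative f (at x)) (at x)"
      using Suc.prems(2) that by (simp add: frechet_derivative_works)
  qed (rule Suc.prems(1))
  then have fg: "frechet_derivative f (at x) = frechet_derivative g (at x)" if "x \<in> U" for x
    using frechet_derivative_at[OF D[OF that]] by simp
  have "Ck_on k (\<lambda>x. frechet_derivative g (at x) v) U" for v
    by (rule Suc.IH[of "\<lambda>x. frechet_derivative f (at x) v"]) (use fg Suc.prems(2) in simp_all)
  moreover have "g differentiable (at x)" if "x \<in> U" for x
    using D[OF that] by (auto simp: differentiable_def)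
  ultimately show ?case by simp
qed

lemma Ck_on_subset: "Ck_on k f U \<Longrightarrow> V \<subseteq> U \<Longrightarrow> Ck_on k f V"
  by (induction k arbitrary: f) (auto intro: continuous_on_subset)

text \<open>\<open>frechet_derivative\<close> is a description and awkward to compute with.
  Uniqueness of derivatives on an open set lets every later induction step replace it by an explicit
  formula \<open>f'\<close>.\<close>

lemma Ck_on_SucI:
  assumes "open U" "\<And>x. x \<in> U \<Longrightarrow> (f has_derivative f' x) (at x)"
    "\<And>v. Ck_on k (\<lambda>x. f' x v) U"
  shows "Ck_on (Suc k) f U"
proof -
  have "frechet_derivative f (at x) = f' x" if "x \<in> U" for x
    using frechet_derivative_at[OF assms(2)[OF that]] by simp
  then have "Ck_on k (\<lambda>x. frechet_derivative f (at x) v) U" for v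
    using Ck_on_cong[OF \<open>open U\<close> _ assms(3)[of v], of "\<lambda>x. frechet_derivative f (at x) v"] by simp
  moreover have "f differentiable (at x)" if "x \<in> U" for x
    using assms(2)[OF that] by (auto simp: differentiable_def)
  ultimately show ?thesis by simp
qed

lemma Ck_on_SucD: "Ck_on (Suc k) f U \<Longrightarrow> Ck_on k f U"
proof (induction k arbitrary: f)
  case 0
  then show ?case
    by (simp add: continuous_at_imp_continuous_on differentiable_imp_continuous_within)
next
  case (Suc k)
  then show ?case by simp
qed

lemma Ck_on_has_derivative:
  "Ck_on (Suc k) f U \<Longrightarrow> x \<in> U \<Longrightarrow> (f has_derivative frechet_derivative f (at x)) (at x)"
  by (simp add: frechet_derivative_works)

lemma Ck_on_const: "open U \<Longrightarrow> Ck_on k (\<lambda>x. c) U"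
proof (induction k arbitrary: c)
  case (Suc k)
  show ?case by (rule Ck_on_SucI[OF \<open>open U\<close> has_derivative_const Suc.IH[OF \<open>open U\<close>]])
qed simp

lemma Ck_on_bounded_linear:
  assumes "open U" "bounded_linear f" shows "Ck_on k f U"
proof (cases k)
  case 0
  then show ?thesis using assms linear_continuous_on by auto
next
  case (Suc k)
  show ?thesis
    unfolding Suc
    by (rule Ck_on_SucI[OF assms(1) bounded_linear_imp_has_derivative[OF assms(2)] Ck_on_const[OF assms(1)]])
qed

lemma Ck_on_bounded_linear_comp:
  assumes L: "bounded_linear L" and U: "open U" and "Ck_on k f U"
  shows "Ck_on k (\<lambda>x. L (f x)) U"
  using assms(3)
proof (induction k arbitrary: f)
  case 0
  then show ?case using L by (auto intro: bounded_linear.continuous_on)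
next
  case (Suc k)
  show ?case
  proof (rule Ck_on_SucI[OF U])
    show "((\<lambda>x. L (f x)) has_derivative (\<lambda>v. L (frechet_derivative f (at x) v))) (at x)" if "x \<in> U" for x
      using bounded_linear.has_derivative[OF L Ck_on_has_derivative[OF Suc.prems that]] .
  qed (use Suc in auto)
qed

lemma Ck_on_add:
  assumes U: "open U" and "Ck_on k f U" "Ck_on k g U"
  shows "Ck_on k (\<lambda>x. f x + g x) U"
  using assms(2,3)
proof (induction k arbitrary: f g)
  case 0
  then show ?case by (auto intro: continuous_intros)
next
  case (Suc k)
  show ?case
  proof (rule Ck_on_SucI[OF U])
    show "((\<lambda>x. f x + g x) has_derivative
        (\<lambda>v. frechet_derivative f (at x) v + frechet_derivative g (at x) v)) (at x)" if "x \<in> U" for x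
      using has_derivative_add[OF Ck_on_has_derivative[OF Suc.prems(1) that] Ck_on_has_derivative[OF Suc.prems(2) that]] .
  qed (use Suc in auto)
qed

text \<open>By the Leibniz rule the derivative is a sum of two terms of the same bilinear shape,
  each with one undifferentiated factor. \<open>Ck_on_SucD\<close> lowers the order of that factor,
  and the induction has to leave \<open>f\<close> and \<open>g\<close> arbitrary.\<close>

lemma Ck_on_bounded_bilinear:
  assumes P: "bounded_bilinear p" and U: "open U" and "Ck_on k f U" "Ck_on k g U"
  shows "Ck_on k (\<lambda>x. p (f x) (g x)) U"
  using assms(3,4)
proof (induction k arbitrary: f g)
  case 0
  then show ?case using P by (auto intro: bounded_bilinear.continuous_on)
next
  case (Suc k)
  show ?case
  proof (rule Ck_on_SucI[OF U])
    show "((\<lambda>x. p (f x) (g x)) has_derivative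
        (\<lambda>v. p (f x) (frechet_derivative g (at x) v) + p (frechet_derivative f (at x) v) (g x))) (at x)"
      if "x \<in> U" for x
      using bounded_bilinear.FDERIV[OF P Ck_on_has_derivative[OF Suc.prems(1) that] Ck_on_has_derivative[OF Suc.prems(2) that]] .
    show "Ck_on k (\<lambda>x. p (f x) (frechet_derivative g (at x) v) + p (frechet_derivative f (at x) v) (g x)) U" for v
      using Suc.prems Suc.prems[THEN Ck_on_SucD] by (intro Ck_on_add[OF U] Suc.IH) auto
  qed
qed

lemma Ck_on_sum:
  assumes "open U" "\<And>i. i \<in> I \<Longrightarrow> Ck_on k (f i) U"
  shows "Ck_on k (\<lambda>x. \<Sum>i\<in>I. f i x) U"
  using assms(2)
  by (induction I rule: infinite_finite_induct) (auto intro: Ck_on_const Ck_on_add \<open>open U\<close>)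

text \<open>In the chain rule the outer derivative is applied to a direction that varies with the
  point, whereas \<open>Ck_on\<close> controls derivatives in fixed directions only. Expanding the
  direction in \<open>Basis\<close> turns the derivative into a finite sum of products, to which the
  induction hypothesis applies.\<close>

lemma Ck_on_compose:
  assumes U: "open U" and V: "open V" and "Ck_on k f V" "Ck_on k g U" and "g ` U \<subseteq> V"
  shows "Ck_on k (\<lambda>x. f (g x)) U"
  using assms(3-5)
proof (induction k arbitrary: f g)
  case 0
  then show ?case by (metis Ck_on.simps(1) continuous_on_compose2)
next
  case (Suc k)
  note f = Suc.prems(1) and g = Suc.prems(2)
  show ?case
  proof (rule Ck_on_SucI[OF U])
    fix x assume x: "x \<in> U"
    then have gx: "g x \<in> V" using Suc.prems by auto
    let ?g = "frechet_derivative g (at x)" and ?f = "frechet_derivative f (at (g x))"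
    have "((\<lambda>x. f (g x)) has_derivative (\<lambda>v. ?f (?g v))) (at x)"
      using diff_chain_at[OF Ck_on_has_derivative[OF g x] Ck_on_has_derivative[OF f gx]]
      unfolding o_def .
    moreover have "?f w = (\<Sum>b\<in>Basis. (w \<bullet> b) *\<^sub>R ?f b)" for w
    proof -
      have l: "linear ?f"
        using Ck_on_has_derivative[OF f gx] has_derivative_linear by blast
      have "?f w = ?f (\<Sum>b\<in>Basis. (w \<bullet> b) *\<^sub>R b)" by (simp add: euclidean_representation)
      also have "\<dots> = (\<Sum>b\<in>Basis. (w \<bullet> b) *\<^sub>R ?f b)" by (simp add: linear_sum[OF l] linear_scale[OF l])
      finally show ?thesis .
    qed
    ultimately show "((\<lambda>x. f (g x)) has_derivative
        (\<lambda>v. \<Sum>b\<in>Basis. (frechet_derivative g (at x) v \<bullet> b) *\<^sub>R frechet_derivative f (at (g x)) b)) (at x)"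
      by (elim has_derivative_eq_rhs) (rule ext)
  next
    fix v
    have "Ck_on k (\<lambda>x. frechet_derivative f (at (g x)) b) U" for b
      using Suc.prems(1,3) Ck_on_SucD[OF g] by (intro Suc.IH) auto
    moreover have "Ck_on k (\<lambda>x. frechet_derivative g (at x) v \<bullet> b) U" for b
      by (rule Ck_on_bounded_linear_comp[OF bounded_linear_inner_left U]) (use g in auto)
    ultimately show "Ck_on k (\<lambda>x. \<Sum>b\<in>Basis.
        (frechet_derivative g (at x) v \<bullet> b) *\<^sub>R frechet_derivative f (at (g x)) b) U"
      by (intro Ck_on_sum Ck_on_bounded_bilinear[OF bounded_bilinear_scaleR] U)
  qed
qed

text \<open>The derivative is a product built from \<open>inverse\<close> itself, so each order of
  smoothness yields the next. The square root below is bootstrapped in the same way, its derivative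
  being half of its own inverse.\<close>

lemma Ck_on_inverse: "Ck_on k (inverse :: real \<Rightarrow> real) (- {0})"
proof (induction k)
  case 0
  then show ?case by (auto intro!: continuous_intros)
next
  case (Suc k)
  have U: "open (- {0::real})" by auto
  show ?case
  proof (rule Ck_on_SucI[OF U])
    show "Ck_on k (\<lambda>x::real. - (inverse x * v * inverse x)) (- {0})" for v
      using Suc by (intro Ck_on_bounded_linear_comp[OF bounded_linear_minus[OF bounded_linear_ident] U]
          Ck_on_bounded_bilinear[OF bounded_bilinear_mult U] Ck_on_const U)
  qed (auto intro: has_derivative_inverse')
qed

lemma Ck_on_sqrt: "Ck_on k sqrt {0<..}"
proof (induction k)
  case 0
  then show ?case by (auto intro!: continuous_intros)
next
  case (Suc k)
  have U: "open {0::real<..}" by auto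
  show ?case
  proof (rule Ck_on_SucI[OF U])
    show "(sqrt has_derivative (\<lambda>v. v * (inverse (sqrt x) / 2))) (at x)" if "x \<in> {0<..}" for x
      using DERIV_real_sqrt[of x] that
      by (auto simp: has_field_derivative_def fun_eq_iff mult.commute elim!: has_derivative_eq_rhs)
    show "Ck_on k (\<lambda>x. v * (inverse (sqrt x) / 2)) {0<..}" for v
    proof -
      have "Ck_on k (\<lambda>x. inverse (sqrt x)) {0<..}"
        by (rule Ck_on_compose[OF U _ Ck_on_inverse Suc]) auto
      from Ck_on_bounded_linear_comp[OF bounded_linear_mult_right[of "v/2"] U this]
      show ?thesis by simp
    qed
  qed
qed

section \<open>C-infinity maps on open sets\<close>

lemma smooth_onD: "smooth_on U f \<Longrightarrow> x \<in> U \<Longrightarrow> (f has_derivative frechet_derivative f (at x)) (at x)"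
  using Ck_on_has_derivative smooth_on_def by blast

lemma smooth_on_frechet_derivative:
  "smooth_on U f \<Longrightarrow> smooth_on U (\<lambda>x. frechet_derivative f (at x) v)"
  unfolding smooth_on_def using Ck_on.simps(2) by blast

lemma smooth_on_continuous: "smooth_on U f \<Longrightarrow> continuous_on U f"
  unfolding smooth_on_def using Ck_on.simps(1) by blast

lemma smooth_on_subset: "smooth_on U f \<Longrightarrow> V \<subseteq> U \<Longrightarrow> smooth_on V f"
  unfolding smooth_on_def using Ck_on_subset by blast

lemma smooth_on_cong:
  "open U \<Longrightarrow> (\<And>x. x \<in> U \<Longrightarrow> f x = g x) \<Longrightarrow> smooth_on U f \<Longrightarrow> smooth_on U g"
  unfolding smooth_on_def using Ck_on_cong by blast

lemma smooth_on_const: "open U \<Longrightarrow> smooth_on U (\<lambda>x. c)"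
  unfolding smooth_on_def using Ck_on_const by blast

lemma smooth_on_bounded_linear: "bounded_linear f \<Longrightarrow> open U \<Longrightarrow> smooth_on U f"
  unfolding smooth_on_def using Ck_on_bounded_linear by blast

lemma smooth_on_add: "open U \<Longrightarrow> smooth_on U f \<Longrightarrow> smooth_on U g \<Longrightarrow> smooth_on U (\<lambda>x. f x + g x)"
  unfolding smooth_on_def using Ck_on_add by blast

lemma smooth_on_bounded_bilinear:
  "bounded_bilinear p \<Longrightarrow> open U \<Longrightarrow> smooth_on U f \<Longrightarrow> smooth_on U g \<Longrightarrow> smooth_on U (\<lambda>x. p (f x) (g x))"
  unfolding smooth_on_def using Ck_on_bounded_bilinear by blast

lemma smooth_on_compose:
  "open U \<Longrightarrow> open V \<Longrightarrow> smooth_on V f \<Longrightarrow> smooth_on U g \<Longrightarrow> g ` U \<subseteq> V \<Longrightarrow> smooth_on U (\<lambda>x. f (g x))"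
  unfolding smooth_on_def using Ck_on_compose by blast

section \<open>Smooth maps on arbitrary subsets\<close>

lemma smooth_on_imp_smooth_map_on: "open U \<Longrightarrow> smooth_on U f \<Longrightarrow> X \<subseteq> U \<Longrightarrow> smooth_map_on X f"
  unfolding smooth_map_on_def by blast

lemma smooth_map_onE:
  assumes "smooth_map_on X f" "x \<in> X"
  obtains U g where "open U" "x \<in> U" "smooth_on U g" "\<And>y. y \<in> X \<Longrightarrow> y \<in> U \<Longrightarrow> f y = g y"
  using assms unfolding smooth_map_on_def by (metis IntI)

lemma smooth_map_onI:
  assumes "\<And>x. x \<in> X \<Longrightarrow>
    \<exists>U g. open U \<and> x \<in> U \<and> smooth_on U g \<and> (\<forall>y. y \<in> X \<longrightarrow> y \<in> U \<longrightarrow> f y = g y)"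
  shows "smooth_map_on X f"
  unfolding smooth_map_on_def Ball_def Int_iff imp_conjL by (intro allI impI assms)

lemma smooth_map_on_subset:
  assumes "smooth_map_on X f" "Y \<subseteq> X" shows "smooth_map_on Y f"
proof (rule smooth_map_onI)
  fix x assume "x \<in> Y"
  with assms(2) have "x \<in> X" by blast
  then obtain U g where U: "open U" "x \<in> U" "smooth_on U g"
    and eq: "\<And>y. y \<in> X \<Longrightarrow> y \<in> U \<Longrightarrow> f y = g y"
    using smooth_map_onE[OF assms(1)] by metis
  have "\<forall>y. y \<in> Y \<longrightarrow> y \<in> U \<longrightarrow> f y = g y" using eq assms(2) by blast
  with U show "\<exists>U g. open U \<and> x \<in> U \<and> smooth_on U g \<and> (\<forall>y. y \<in> Y \<longrightarrow> y \<in> U \<longrightarrow> f y = g y)"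
    by (intro exI[of _ U] exI[of _ g] conjI)
qed

lemma smooth_map_on_cong:
  assumes "\<And>x. x \<in> X \<Longrightarrow> f x = g x" "smooth_map_on X f" shows "smooth_map_on X g"
proof (rule smooth_map_onI)
  fix x assume "x \<in> X"
  then obtain U h where U: "open U" "x \<in> U" "smooth_on U h"
    and eq: "\<And>y. y \<in> X \<Longrightarrow> y \<in> U \<Longrightarrow> f y = h y"
    using smooth_map_onE[OF assms(2)] by metis
  have "\<forall>y. y \<in> X \<longrightarrow> y \<in> U \<longrightarrow> g y = h y" using eq assms(1) by metis
  with U show "\<exists>U h. open U \<and> x \<in> U \<and> smooth_on U h \<and> (\<forall>y. y \<in> X \<longrightarrow> y \<in> U \<longrightarrow> g y = h y)"
    by (intro exI[of _ U] exI[of _ h] conjI)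
qed

text \<open>\<open>Ck_on\<close> imposes conditions point by point, so it may be checked on small
  neighbourhoods. The induction carries this local form because it is inherited by directional
  derivatives. On an open set the local extensions coincide with the map near each point.\<close>

lemma smooth_map_on_open: 
  assumes "open U" "smooth_map_on U f" shows "smooth_on U f"
proof -
  have "Ck_on k f U" if "\<And>x. x \<in> U \<Longrightarrow> \<exists>V. open V \<and> x \<in> V \<and> V \<subseteq> U \<and> Ck_on k f V" for k f
    using that
  proof (induction k arbitrary: f)
    case 0
    have "continuous (at x) f" if x: "x \<in> U" for x
    proof -
      obtain V where "open V" "x \<in> V" "continuous_on V f" using 0[OF x] by auto
      then show ?thesis using continuous_on_eq_continuous_at by blast
    qed
    then show ?case by (simp add: continuous_at_imp_continuous_on)
  next
    case (Suc k)
    from Suc.prems have "f differentiable at x" if "x \<in> U" for x using Suc.prems[OF that] by auto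
    moreover have "Ck_on k (\<lambda>x. frechet_derivative f (at x) v) U" for v
    proof (rule Suc.IH)
      show "\<exists>V. open V \<and> x \<in> V \<and> V \<subseteq> U \<and> Ck_on k (\<lambda>x. frechet_derivative f (at x) v) V"
        if "x \<in> U" for x using Suc.prems[OF that] by auto
    qed
    ultimately show ?case by simp
  qed
  moreover have "\<exists>V. open V \<and> x \<in> V \<and> V \<subseteq> U \<and> smooth_on V f" if x: "x \<in> U" for x
  proof -
    obtain W g where W: "open W" "x \<in> W" "smooth_on W g"
      and eq: "\<And>y. y \<in> U \<Longrightarrow> y \<in> W \<Longrightarrow> f y = g y"
      using smooth_map_onE[OF assms(2) x] by metis
    have "smooth_on (U \<inter> W) f"
      by (rule smooth_on_cong[OF open_Int[OF assms(1) W(1)] _ smooth_on_subset[OF W(3)]]) (auto simp: eq)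
    then show ?thesis using W x assms(1) by (intro exI[of _ "U \<inter> W"]) auto
  qed
  ultimately show ?thesis unfolding smooth_on_def by metis
qed

lemma smooth_map_on_continuous: assumes "smooth_map_on X f" shows "continuous_on X f"
  unfolding continuous_on_eq_continuous_within
proof
  fix x assume "x \<in> X"
  with assms obtain U g where U: "open U" "x \<in> U" "smooth_on U g"
      "\<And>y. y \<in> X \<Longrightarrow> y \<in> U \<Longrightarrow> f y = g y"
    using smooth_map_onE by metis
  then have "continuous (at x) g"
    using smooth_on_continuous continuous_on_eq_continuous_at by blast
  then have "continuous (at x within X) g" by (rule continuous_at_imp_continuous_at_within)
  moreover have "openin (top_of_set X) (X \<inter> U)" using U by auto
  ultimately show "continuous (at x within X) f"
    using U \<open>x \<in> X\<close> continuous_transform_within_openin[of x X g "X \<inter> U" f] by auto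
qed

lemma smooth_map_on_compose:
  assumes f: "smooth_map_on X f" and g: "smooth_map_on Y g" and im: "f ` X \<subseteq> Y"
  shows "smooth_map_on X (\<lambda>x. g (f x))"
proof (rule smooth_map_onI)
  fix x assume x: "x \<in> X"
  obtain U F where U: "open U" "x \<in> U" "smooth_on U F" "\<And>y. y \<in> X \<Longrightarrow> y \<in> U \<Longrightarrow> f y = F y"
    using smooth_map_onE[OF f x] by metis
  obtain V G where V: "open V" "f x \<in> V" "smooth_on V G" "\<And>y. y \<in> Y \<Longrightarrow> y \<in> V \<Longrightarrow> g y = G y"
    using smooth_map_onE[OF g, of "f x"] x im by blast
  let ?W = "U \<inter> F -` V"
  have W: "open ?W" using continuous_open_preimage[OF smooth_on_continuous[OF U(3)] U(1) V(1)] .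
  have "smooth_on ?W (\<lambda>x. G (F x))"
    by (rule smooth_on_compose[OF W V(1) V(3) smooth_on_subset[OF U(3)]]) auto
  moreover have "x \<in> ?W" using U V x by auto
  moreover have "\<forall>y. y \<in> X \<longrightarrow> y \<in> ?W \<longrightarrow> g (f y) = G (F y)"
    using U(4) V(4) im by (auto simp: image_subset_iff)
  ultimately show "\<exists>U h. open U \<and> x \<in> U \<and> smooth_on U h \<and> (\<forall>y. y \<in> X \<longrightarrow> y \<in> U \<longrightarrow> g (f y) = h y)"
    using W by (intro exI[of _ ?W] exI[of _ "\<lambda>x. G (F x)"] conjI)
qed

lemma smooth_map_on_const: "smooth_map_on X (\<lambda>x. c)"
  using smooth_on_imp_smooth_map_on[OF open_UNIV smooth_on_const[OF open_UNIV]] by auto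

lemma smooth_map_on_bounded_linear: "bounded_linear L \<Longrightarrow> smooth_map_on X L"
  using smooth_on_imp_smooth_map_on[OF open_UNIV smooth_on_bounded_linear[OF _ open_UNIV]] by auto

lemma smooth_map_on_id: "smooth_map_on X (\<lambda>x. x)"
  by (rule smooth_map_on_bounded_linear[OF bounded_linear_ident])

lemma smooth_map_on_bounded_linear_comp:
  "bounded_linear L \<Longrightarrow> smooth_map_on X f \<Longrightarrow> smooth_map_on X (\<lambda>x. L (f x))"
  by (rule smooth_map_on_compose[OF _ smooth_map_on_bounded_linear[of L UNIV]]) auto

lemma smooth_map_on_bounded_bilinear:
  assumes "bounded_bilinear p" "smooth_map_on X f" "smooth_map_on X g"
  shows "smooth_map_on X (\<lambda>x. p (f x) (g x))"
proof (rule smooth_map_onI)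
  fix x assume x: "x \<in> X"
  obtain U F where U: "open U" "x \<in> U" "smooth_on U F" "\<And>y. y \<in> X \<Longrightarrow> y \<in> U \<Longrightarrow> f y = F y"
    using smooth_map_onE[OF assms(2) x] by metis
  obtain V G where V: "open V" "x \<in> V" "smooth_on V G" "\<And>y. y \<in> X \<Longrightarrow> y \<in> V \<Longrightarrow> g y = G y"
    using smooth_map_onE[OF assms(3) x] by metis
  have "smooth_on (U \<inter> V) (\<lambda>x. p (F x) (G x))"
    by (rule smooth_on_bounded_bilinear[OF assms(1) open_Int[OF U(1) V(1)]
          smooth_on_subset[OF U(3)] smooth_on_subset[OF V(3)]]) auto
  then show "\<exists>W h. open W \<and> x \<in> W \<and> smooth_on W h \<and> (\<forall>y. y \<in> X \<longrightarrow> y \<in> W \<longrightarrow> p (f y) (g y) = h y)"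
    using U V by (intro exI[of _ "U \<inter> V"] exI[of _ "\<lambda>x. p (F x) (G x)"]) auto
qed

lemma smooth_map_on_add:
  assumes "smooth_map_on X f" "smooth_map_on X g"
  shows "smooth_map_on X (\<lambda>x. f x + g x)"
proof (rule smooth_map_onI)
  fix x assume x: "x \<in> X"
  obtain U F where U: "open U" "x \<in> U" "smooth_on U F" "\<And>y. y \<in> X \<Longrightarrow> y \<in> U \<Longrightarrow> f y = F y"
    using smooth_map_onE[OF assms(1) x] by metis
  obtain V G where V: "open V" "x \<in> V" "smooth_on V G" "\<And>y. y \<in> X \<Longrightarrow> y \<in> V \<Longrightarrow> g y = G y"
    using smooth_map_onE[OF assms(2) x] by metis
  have "smooth_on (U \<inter> V) (\<lambda>x. F x + G x)"
    by (rule smooth_on_add[OF open_Int[OF U(1) V(1)]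
          smooth_on_subset[OF U(3)] smooth_on_subset[OF V(3)]]) auto
  then show "\<exists>W h. open W \<and> x \<in> W \<and> smooth_on W h \<and> (\<forall>y. y \<in> X \<longrightarrow> y \<in> W \<longrightarrow> f y + g y = h y)"
    using U V by (intro exI[of _ "U \<inter> V"] exI[of _ "\<lambda>x. F x + G x"]) auto
qed

lemma smooth_map_on_minus: "smooth_map_on X f \<Longrightarrow> smooth_map_on X (\<lambda>x. - f x)"
  by (rule smooth_map_on_bounded_linear_comp[OF bounded_linear_minus[OF bounded_linear_ident]])

lemma smooth_map_on_diff:
  "smooth_map_on X f \<Longrightarrow> smooth_map_on X g \<Longrightarrow> smooth_map_on X (\<lambda>x. f x - g x)"
  using smooth_map_on_add[OF _ smooth_map_on_minus, of X f g] by simp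

lemma smooth_map_on_sum:
  "(\<And>i. i \<in> I \<Longrightarrow> smooth_map_on X (f i)) \<Longrightarrow> smooth_map_on X (\<lambda>x. \<Sum>i\<in>I. f i x)"
  by (induction I rule: infinite_finite_induct) (auto intro: smooth_map_on_const smooth_map_on_add)

lemma smooth_map_on_mult:
  fixes f g :: "'a::euclidean_space \<Rightarrow> 'b::{euclidean_space,real_normed_algebra}"
  shows "smooth_map_on X f \<Longrightarrow> smooth_map_on X g \<Longrightarrow> smooth_map_on X (\<lambda>x. f x * g x)"
  by (rule smooth_map_on_bounded_bilinear[OF bounded_bilinear_mult])

lemma smooth_map_on_scaleR:
  "smooth_map_on X f \<Longrightarrow> smooth_map_on X g \<Longrightarrow> smooth_map_on X (\<lambda>x. f x *\<^sub>R g x)"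
  by (rule smooth_map_on_bounded_bilinear[OF bounded_bilinear_scaleR])

lemma smooth_map_on_power:
  fixes f :: "'a::euclidean_space \<Rightarrow> 'b::{euclidean_space,real_normed_field}"
  shows "smooth_map_on X f \<Longrightarrow> smooth_map_on X (\<lambda>x. f x ^ n)"
  by (induction n) (auto intro: smooth_map_on_const smooth_map_on_mult)

lemma smooth_map_on_prod:
  fixes f :: "'i \<Rightarrow> 'a::euclidean_space \<Rightarrow> 'b::{euclidean_space,real_normed_field}"
  shows "(\<And>i. i \<in> I \<Longrightarrow> smooth_map_on X (f i)) \<Longrightarrow> smooth_map_on X (\<lambda>x. \<Prod>i\<in>I. f i x)"
  by (induction I rule: infinite_finite_induct) (auto intro: smooth_map_on_const smooth_map_on_mult)

lemma smooth_map_on_inverse: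
  fixes f :: "'a::euclidean_space \<Rightarrow> real"
  assumes "smooth_map_on X f" "\<And>x. x \<in> X \<Longrightarrow> f x \<noteq> 0"
  shows "smooth_map_on X (\<lambda>x. inverse (f x))"
proof (rule smooth_map_on_compose[OF assms(1)])
  show "smooth_map_on (- {0}) (inverse :: real \<Rightarrow> real)"
    using Ck_on_inverse by (auto intro!: smooth_on_imp_smooth_map_on[of "-{0}"] simp: smooth_on_def)
qed (use assms in auto)

lemma smooth_map_on_divide:
  fixes f :: "'a::euclidean_space \<Rightarrow> real"
  assumes "smooth_map_on X f" "smooth_map_on X g" "\<And>x. x \<in> X \<Longrightarrow> g x \<noteq> 0"
  shows "smooth_map_on X (\<lambda>x. f x / g x)"
  unfolding divide_inverse using assms by (intro smooth_map_on_mult smooth_map_on_inverse)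

lemma smooth_map_on_sqrt:
  assumes "smooth_map_on X f" "\<And>x. x \<in> X \<Longrightarrow> f x > 0"
  shows "smooth_map_on X (\<lambda>x. sqrt (f x))"
proof (rule smooth_map_on_compose[OF assms(1)])
  show "smooth_map_on {0<..} sqrt"
    using Ck_on_sqrt by (auto intro!: smooth_on_imp_smooth_map_on[of "{0<..}"] simp: smooth_on_def)
qed (use assms in auto)

lemma smooth_map_on_Pair:
  assumes "smooth_map_on X f" "smooth_map_on X g"
  shows "smooth_map_on X (\<lambda>x. (f x, g x))"
proof -
  have "bounded_linear (\<lambda>a. (a, 0::'c))" "bounded_linear (\<lambda>b. (0::'b, b))"
    by (auto intro: bounded_linear_Pair bounded_linear_ident bounded_linear_zero)
  from smooth_map_on_add[OF smooth_map_on_bounded_linear_comp[OF this(1) assms(1)]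
      smooth_map_on_bounded_linear_comp[OF this(2) assms(2)]]
  show ?thesis by simp
qed

lemma bounded_linear_axis: "bounded_linear (axis i :: 'b::euclidean_space \<Rightarrow> 'b^'n)"
  unfolding linear_conv_bounded_linear[symmetric]
  by (rule linearI) (auto simp: axis_def vec_eq_iff)

lemma smooth_map_on_vec_lambda:
  assumes "\<And>i. smooth_map_on X (\<lambda>x. f x i)"
  shows "smooth_map_on X (\<lambda>x. (\<chi> i. f x i) :: 'b::euclidean_space ^ 'n)"
proof -
  have "(\<lambda>x. \<chi> i. f x i) = (\<lambda>x. \<Sum>i\<in>UNIV. axis i (f x i))"
    by (auto simp: vec_eq_iff axis_def if_distrib cong: if_cong)
  then show ?thesis
    using assms by (auto intro!: smooth_map_on_sum smooth_map_on_bounded_linear_comp[OF bounded_linear_axis])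
qed

lemma smooth_map_on_Complex:
  "smooth_map_on X f \<Longrightarrow> smooth_map_on X g \<Longrightarrow> smooth_map_on X (\<lambda>x. Complex (f x) (g x))"
  unfolding Complex_eq
  by (intro smooth_map_on_add smooth_map_on_mult smooth_map_on_const
      smooth_map_on_bounded_linear_comp[OF bounded_linear_of_real])

lemmas smooth_map_on_Re = smooth_map_on_bounded_linear_comp[OF bounded_linear_Re]
lemmas smooth_map_on_Im = smooth_map_on_bounded_linear_comp[OF bounded_linear_Im]
lemmas smooth_map_on_of_real = smooth_map_on_bounded_linear_comp[OF bounded_linear_of_real]
lemmas smooth_map_on_cnj = smooth_map_on_bounded_linear_comp[OF bounded_linear_cnj]
lemmas smooth_map_on_fst = smooth_map_on_bounded_linear_comp[OF bounded_linear_fst]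
lemmas smooth_map_on_snd = smooth_map_on_bounded_linear_comp[OF bounded_linear_snd]
lemmas smooth_map_on_nth = smooth_map_on_bounded_linear_comp[OF bounded_linear_vec_nth]

lemmas smooth_intros = smooth_map_on_const smooth_map_on_id smooth_map_on_add smooth_map_on_minus
  smooth_map_on_diff smooth_map_on_sum smooth_map_on_mult smooth_map_on_scaleR smooth_map_on_power
  smooth_map_on_prod smooth_map_on_Pair smooth_map_on_vec_lambda smooth_map_on_Complex
  smooth_map_on_Re smooth_map_on_Im smooth_map_on_of_real smooth_map_on_cnj smooth_map_on_fst
  smooth_map_on_snd smooth_map_on_nth


section \<open>Regular level sets\<close>

text \<open>\<open>J\<close> parametrises the coordinate plane on which a level set becomes a graph,
  and \<open>J'\<close> projects along the remaining axis. The index \<open>i\<close> is arbitrary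
  because it is dictated by the partial derivative that happens not to vanish.\<close>

lemma ex_coordinate_embedding:
  fixes i :: 3
  obtains J :: "real^2 \<Rightarrow> real^3" and J' :: "real^3 \<Rightarrow> real^2" where
    "bounded_linear J" "bounded_linear J'" "\<And>u. J' (J u) = u" "\<And>u. J u $ i = 0"
    "\<And>q. J (J' q) = q - (q $ i) *\<^sub>R axis i 1"
proof -
  note ob = that
  have main: thesis if ij: "i \<noteq> j" "i \<noteq> k" "j \<noteq> k" for j k :: 3
  proof (rule ob)
    let ?J = "\<lambda>u::real^2. axis j (u $ 1) + axis k (u $ 2) :: real^3"
    let ?J' = "\<lambda>q::real^3. axis 1 (q $ j) + axis 2 (q $ k) :: real^2"
    show "bounded_linear ?J" "bounded_linear ?J'"
      by (auto intro!: bounded_linear_add bounded_linear_compose[OF bounded_linear_axis bounded_linear_vec_nth])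
    show "?J' (?J u) = u" for u using ij by (auto simp: vec_eq_iff forall_2 axis_def)
    show "?J u $ i = 0" for u using ij by (auto simp: axis_def)
    have all3: "m = i \<or> m = j \<or> m = k" for m :: 3
      using ij exhaust_3[of i] exhaust_3[of j] exhaust_3[of k] exhaust_3[of m] by metis
    show "?J (?J' q) = q - (q $ i) *\<^sub>R axis i 1" for q
    proof (rule vec_eq_iff[THEN iffD2], rule allI)
      fix m show "?J (?J' q) $ m = (q - (q $ i) *\<^sub>R axis i 1) $ m"
        using all3[of m] ij by (auto simp: axis_def)
    qed
  qed
  have "(1::3) \<noteq> 2" "(1::3) \<noteq> 3" "(2::3) \<noteq> 3" by auto
  then show thesis using main exhaust_3[of i] by metis
qed

text \<open>A bootstrap: the derivative of \<open>H\<close> is a rational expression in the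
  derivatives of \<open>F\<close> evaluated at \<open>H y\<close>. If \<open>H\<close> is of class
  \<open>k\<close>, so is its derivative, and \<open>H\<close> is of class
  \<open>Suc k\<close>.\<close>

lemma smooth_on_inverse_coordinate_replacement:
  fixes F :: "real^'n \<Rightarrow> real" and H :: "real^'n \<Rightarrow> real^'n"
  assumes V: "open V" and F: "smooth_on UNIV F" and contH: "continuous_on V H"
    and nz: "\<And>y. y \<in> V \<Longrightarrow> frechet_derivative F (at (H y)) (axis i 1) \<noteq> 0"
    and der: "\<And>y. y \<in> V \<Longrightarrow> (H has_derivative (\<lambda>v. v + ((v $ i - frechet_derivative F (at (H y)) (v - (v $ i) *\<^sub>R axis i 1))
        / frechet_derivative F (at (H y)) (axis i 1) - v $ i) *\<^sub>R axis i 1)) (at y)"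
  shows "smooth_on V H"
proof -
  have "Ck_on k H V" for k
  proof (induction k)
    case 0
    then show ?case using contH by simp
  next
    case (Suc k)
    have dF: "Ck_on k (\<lambda>y. frechet_derivative F (at (H y)) w) V" for w
      by (rule Ck_on_compose[OF V open_UNIV _ Suc, of "\<lambda>x. frechet_derivative F (at x) w"])
         (use smooth_on_frechet_derivative[OF F, of w] in \<open>auto simp: smooth_on_def\<close>)
    have inv: "Ck_on k (\<lambda>y. inverse (frechet_derivative F (at (H y)) (axis i 1))) V"
      by (rule Ck_on_compose[OF V _ Ck_on_inverse dF]) (use nz in auto)
    show ?case
    proof (rule Ck_on_SucI[OF V der])
      fix v
      have "Ck_on k (\<lambda>y. v $ i + - frechet_derivative F (at (H y)) (v - (v $ i) *\<^sub>R axis i 1)) V"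
        by (rule Ck_on_add[OF V Ck_on_const[OF V] Ck_on_bounded_linear_comp[OF bounded_linear_minus[OF bounded_linear_ident] V dF]])
      from Ck_on_bounded_bilinear[OF bounded_bilinear_mult V this inv]
      have "Ck_on k (\<lambda>y. (v $ i - frechet_derivative F (at (H y)) (v - (v $ i) *\<^sub>R axis i 1))
        / frechet_derivative F (at (H y)) (axis i 1)) V" by (simp add: divide_inverse)
      from Ck_on_add[OF V this Ck_on_const[OF V, of k "- (v $ i)"]]
      have "Ck_on k (\<lambda>y. (v $ i - frechet_derivative F (at (H y)) (v - (v $ i) *\<^sub>R axis i 1))
        / frechet_derivative F (at (H y)) (axis i 1) - v $ i) V" by simp
      from Ck_on_add[OF V Ck_on_const[OF V] Ck_on_bounded_linear_comp[OF bounded_linear_scaleR_left V this]]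
      show "Ck_on k (\<lambda>y. v + ((v $ i - frechet_derivative F (at (H y)) (v - (v $ i) *\<^sub>R axis i 1))
        / frechet_derivative F (at (H y)) (axis i 1) - v $ i) *\<^sub>R axis i 1) V" .
    qed
  qed
  then show ?thesis by (simp add: smooth_on_def)
qed

text \<open>The inverse of the map replacing the \<open>i\<close>-th coordinate by \<open>F\<close> straightens the level set.\<close>

lemma level_set_straightening:
  fixes F :: "real^'n \<Rightarrow> real"
  assumes F: "smooth_on UNIV F" and nz: "frechet_derivative F (at p) (axis i 1) \<noteq> 0"
  obtains U V H where "open U" "p \<in> U" "open V"
    "homeomorphism U V (\<lambda>q. q + (F q - q $ i) *\<^sub>R axis i 1) H" "smooth_on V H"
proof -
  let ?G = "\<lambda>q. q + (F q - q $ i) *\<^sub>R axis i 1"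
  let ?D = "\<lambda>q. frechet_derivative F (at q)"
  have DF: "(F has_derivative ?D q) (at q)" for q using smooth_onD[OF F] by simp
  have linD: "linear (?D q)" for q using DF has_derivative_linear by blast
  \<comment> \<open>The inverse function theorem wants the derivative to depend continuously on the
    point as a bounded operator. In finite dimensions this can be checked on each vector
    separately.\<close>
  define G' where "G' q = Blinfun (\<lambda>v. v + (?D q v - v $ i) *\<^sub>R axis i 1)" for q
  have bl: "bounded_linear (\<lambda>v. v + (?D q v - v $ i) *\<^sub>R axis i 1)" for q
    using linD[of q] by (intro bounded_linear_add bounded_linear_ident
        bounded_linear_compose[OF bounded_linear_scaleR_left] bounded_linear_sub bounded_linear_vec_nth)
      (simp add: linear_conv_bounded_linear)
  have G': "blinfun_apply (G' q) = (\<lambda>v. v + (?D q v - v $ i) *\<^sub>R axis i 1)" for q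
    unfolding G'_def using bounded_linear_Blinfun_apply[OF bl] .
  have der: "(?G has_derivative blinfun_apply (G' q)) (at q)" for q
    unfolding G' by (auto intro!: derivative_eq_intros DF bounded_linear.has_derivative[OF bounded_linear_vec_nth])
  have cont: "continuous_on UNIV G'"
  proof (rule continuous_on_blinfun_componentwise)
    fix b :: "real^'n"
    show "continuous_on UNIV (\<lambda>q. blinfun_apply (G' q) b)"
      unfolding G' using smooth_on_continuous[OF smooth_on_frechet_derivative[OF F, of b]]
      by (intro continuous_intros)
  qed
  \<comment> \<open>The derivative keeps all coordinates except the \<open>i\<close>-th and replaces
    that one by the derivative of \<open>F\<close>. A kernel vector is therefore a multiple of
    \<open>axis i 1\<close> that \<open>?D q\<close> annihilates.\<close>
  have inj: "v = 0" if "v + (?D q v - v $ i) *\<^sub>R axis i 1 = 0" and q: "?D q (axis i 1) \<noteq> 0" for q v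
  proof -
    have "v $ j = 0" if "j \<noteq> i" for j
      using arg_cong[OF \<open>v + _ = 0\<close>, of "\<lambda>w. w $ j"] that by (simp add: axis_def)
    then have v: "v = (v $ i) *\<^sub>R axis i 1" by (auto simp: vec_eq_iff axis_def)
    have "?D q v = 0"
      using arg_cong[OF \<open>v + _ = 0\<close>, of "\<lambda>w. w $ i"] by (simp add: axis_def)
    then have "(v $ i) * ?D q (axis i 1) = 0" by (metis v linear_scale[OF linD] real_scaleR_def)
    with q v show "v = 0" by simp
  qed
  have linG: "linear (blinfun_apply (G' p))"
    by (rule bounded_linear.linear[OF blinfun.bounded_linear_right])
  have "inj (blinfun_apply (G' p))"
  proof (rule linear_injective_0[OF linG, THEN iffD2], intro allI impI)
    fix v assume "blinfun_apply (G' p) v = 0"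
    then show "v = 0" unfolding G' by (rule inj[OF _ nz])
  qed
  then obtain g where g: "linear g" "g \<circ> blinfun_apply (G' p) = id"
    using linear_injective_left_inverse[OF linG] by blast
  have inv: "Blinfun g o\<^sub>L G' p = id_blinfun"
    using g by (intro blinfun_eqI) (simp add: bounded_linear_Blinfun_apply linear_conv_bounded_linear pointfree_idE)
  obtain U V H H' where UV: "open U" "p \<in> U" "open V" "homeomorphism U V ?G H"
      "\<And>y. y \<in> V \<Longrightarrow> (H has_derivative (H' y)) (at y)"
      "\<And>y. y \<in> V \<Longrightarrow> H' y = inv_into UNIV (blinfun_apply (G' (H y)))"
      "\<And>y. y \<in> V \<Longrightarrow> bij (blinfun_apply (G' (H y)))"
  proof (rule inverse_function_theorem[OF open_UNIV der cont UNIV_I inv])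
    fix U V H H'
    assume UV: "open U" "p \<in> U" "open V" "homeomorphism U V ?G H"
      and d: "\<And>y. y \<in> V \<Longrightarrow> (H has_derivative (H' y)) (at y)"
      "\<And>y. y \<in> V \<Longrightarrow> H' y = inv_into UNIV (blinfun_apply (G' (H y)))"
      "\<And>y. y \<in> V \<Longrightarrow> bij (blinfun_apply (G' (H y)))"
    show thesis by (rule that[OF UV d])
  qed
  have "smooth_on V H"
  proof (rule smooth_on_inverse_coordinate_replacement[OF UV(3) F])
    show "continuous_on V H" using UV(4) by (simp add: homeomorphism_def)
    fix y assume y: "y \<in> V"
    show nzy: "?D (H y) (axis i 1) \<noteq> 0"
    proof
      assume 0: "?D (H y) (axis i 1) = 0"
      have "blinfun_apply (G' (H y)) (axis i 1) = blinfun_apply (G' (H y)) 0"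
        using 0 linear_0[OF linD] by (simp add: G')
      then have "axis i 1 = (0::real^'n)" using UV(7)[OF y] by (metis bij_def injD)
      then show False by (simp add: axis_eq_0_iff)
    qed
    \<comment> \<open>The inverse keeps the other coordinates and solves the linear equation
      \<open>?D (H y) w = v $ i\<close> for the \<open>i\<close>-th coordinate of \<open>w\<close>;
      this is the formula required for the bootstrap.\<close>
    have "inv_into UNIV (blinfun_apply (G' (H y))) v = v + ((v $ i - ?D (H y) (v - (v $ i) *\<^sub>R axis i 1))
        / ?D (H y) (axis i 1) - v $ i) *\<^sub>R axis i 1" (is "_ = ?w") for v
    proof -
      have s: "?D (H y) ?w = v $ i"
      proof -
        let ?s = "(v $ i - ?D (H y) (v - (v $ i) *\<^sub>R axis i 1)) / ?D (H y) (axis i 1)"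
        have "?w = (v - (v $ i) *\<^sub>R axis i 1) + ?s *\<^sub>R axis i 1" by (simp add: algebra_simps)
        then have "?D (H y) ?w = ?D (H y) (v - (v $ i) *\<^sub>R axis i 1) + ?s * ?D (H y) (axis i 1)"
          by (metis linear_add[OF linD] linear_scale[OF linD] real_scaleR_def)
        then show ?thesis using nzy by simp
      qed
      have "blinfun_apply (G' (H y)) ?w = v"
        unfolding G' s by (auto simp: vec_eq_iff axis_def)
      then show ?thesis using UV(7)[OF y] by (metis bij_inv_eq_iff)
    qed
    then have eq: "inv_into UNIV (blinfun_apply (G' (H y))) = (\<lambda>v. v + ((v $ i - ?D (H y) (v - (v $ i) *\<^sub>R axis i 1))
        / ?D (H y) (axis i 1) - v $ i) *\<^sub>R axis i 1)" by (intro ext)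
    show "(H has_derivative (\<lambda>v. v + ((v $ i - ?D (H y) (v - (v $ i) *\<^sub>R axis i 1))
        / ?D (H y) (axis i 1) - v $ i) *\<^sub>R axis i 1)) (at y)"
      using UV(5)[OF y] by (simp only: UV(6)[OF y] eq)
  qed
  from that[OF UV(1-4) this] show thesis .
qed

lemma linear_axis_ex:
  fixes D :: "real^'n \<Rightarrow> real"
  assumes "linear D" "D v \<noteq> 0"
  obtains i where "D (axis i 1) \<noteq> 0"
proof -
  have "D v = D (\<Sum>i\<in>UNIV. (v $ i) *\<^sub>R axis i 1)" by (simp add: basis_expansion scalar_mult_eq_scaleR[symmetric])
  also have "\<dots> = (\<Sum>i\<in>UNIV. (v $ i) * D (axis i 1))" by (simp add: linear_sum[OF assms(1)] linear_scale[OF assms(1)])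
  finally have Dv: "D v = (\<Sum>i\<in>UNIV. (v $ i) * D (axis i 1))" .
  show thesis
  proof (rule ccontr)
    assume "\<not> thesis"
    then have "D (axis i 1) = 0" for i using that by blast
    then show False using Dv assms(2) by simp
  qed
qed

text \<open>In the straightened coordinates \<open>F\<close> is the \<open>i\<close>-th coordinate,
  so the level set is the image of the plane parametrised by \<open>J\<close>. The inverse chart is
  the restriction of a linear map, hence smooth at once. The last conclusion says that this linear
  map is injective on the kernel of the derivative; it serves to identify velocities of
  curves.\<close>

lemma level_set_chart:
  fixes F :: "real^3 \<Rightarrow> real"
  assumes F: "smooth_on UNIV F" and p: "F p = 0" and nz: "frechet_derivative F (at p) v0 \<noteq> 0"
  obtains W and V :: "(real^2) set" and \<phi> J' where
    "openin (top_of_set {q. F q = 0}) W" "p \<in> W" "open V" "homeomorphism V W \<phi> J'" "smooth_on V \<phi>"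
    "bounded_linear J'" "\<And>v. frechet_derivative F (at p) v = 0 \<Longrightarrow> J' v = 0 \<Longrightarrow> v = 0"
proof -
  have DF: "(F has_derivative frechet_derivative F (at p)) (at p)" using smooth_onD[OF F] by simp
  have linD: "linear (frechet_derivative F (at p))" using DF has_derivative_linear by blast
  obtain i where i: "frechet_derivative F (at p) (axis i 1) \<noteq> 0" by (rule linear_axis_ex[OF linD nz])
  let ?G = "\<lambda>q. q + (F q - q $ i) *\<^sub>R axis i 1"
  obtain U V H where U: "open U" "p \<in> U" "open V" "homeomorphism U V ?G H" "smooth_on V H"
    by (rule level_set_straightening[OF F i])
  obtain J :: "real^2 \<Rightarrow> real^3" and J' :: "real^3 \<Rightarrow> real^2" where
    J: "bounded_linear J" "bounded_linear J'" "\<And>u. J' (J u) = u" "\<And>u. J u $ i = 0"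
    "\<And>q. J (J' q) = q - (q $ i) *\<^sub>R axis i 1" using ex_coordinate_embedding[of i] by metis
  interpret J: bounded_linear J by fact
  interpret J': bounded_linear J' by fact
  have J'e: "J' (axis i 1) = 0" using J(3)[of "J' (axis i 1)"] J(5)[of "axis i 1"] by (simp add: J'.zero)
  let ?\<Sigma> = "{q. F q = 0}"
  let ?W = "?\<Sigma> \<inter> U" and ?V = "J -` V" and ?\<phi> = "\<lambda>u. H (J u)"
  have oV: "open ?V" using U(3) linear_continuous_on[OF J(1)] by (simp add: open_vimage continuous_on_eq_continuous_at)
  note hom = U(4)[unfolded homeomorphism_def]
  have GH: "?G (H y) = y" "H y \<in> U" if "y \<in> V" for y using hom that by auto
  have HG: "H (?G q) = q" "?G q \<in> V" if "q \<in> U" for q using hom that by auto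
  have 1: "J (J' q) = ?G q" if "F q = 0" for q using that J(5) by simp
  have FH: "F (H y) = y $ i" if "y \<in> V" for y
    using arg_cong[OF GH(1)[OF that], of "\<lambda>w. w $ i"] by (simp add: axis_def)
  have \<phi>W: "?\<phi> u \<in> ?W" if "u \<in> ?V" for u using that GH FH J(4) by auto
  have J'\<phi>: "J' (?\<phi> u) = u" if "u \<in> ?V" for u
  proof -
    have "J u \<in> V" using that by auto
    have "u = J' (?G (H (J u)))" using GH(1)[OF \<open>J u \<in> V\<close>] J(3) by simp
    also have "\<dots> = J' (H (J u))" by (simp add: J'.add J'.scaleR J'e)
    finally show ?thesis by simp
  qed
  have J'W: "J' q \<in> ?V" "?\<phi> (J' q) = q" if "q \<in> ?W" for q using that 1[of q] HG[of q] by auto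
  have h: "homeomorphism ?V ?W ?\<phi> J'"
    unfolding homeomorphism_def
  proof (intro conjI ballI)
    show "?\<phi> ` ?V = ?W" using \<phi>W J'W by force
    show "J' ` ?W = ?V" using \<phi>W J'W J'\<phi> by force
    show "continuous_on ?V ?\<phi>"
      by (rule continuous_on_compose2[of V H]) (use hom linear_continuous_on[OF J(1)] in auto)
    show "continuous_on ?W J'" by (intro linear_continuous_on J)
  qed (use J'\<phi> J'W in auto)
  have sm: "smooth_on ?V ?\<phi>"
    by (rule smooth_on_compose[OF oV U(3) U(5) smooth_on_bounded_linear[OF J(1) oV]]) auto
  show thesis
  proof (rule that[OF _ _ oV h sm J(2)])
    show "openin (top_of_set ?\<Sigma>) ?W" using U(1) by auto
    show "p \<in> ?W" using p U(2) by simp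
    show "v = 0" if "frechet_derivative F (at p) v = 0" "J' v = 0" for v
    proof -
      have v: "v = (v $ i) *\<^sub>R axis i 1" using J(5)[of v] that by (simp add: J.zero)
      then have "(v $ i) * frechet_derivative F (at p) (axis i 1) = 0"
        using that(1) by (metis linear_scale[OF linD] real_scaleR_def)
      then show ?thesis using i v by simp
    qed
  qed
qed

lemma smooth_submanifold_level_set:
  fixes F :: "real^3 \<Rightarrow> real"
  assumes F: "smooth_on UNIV F" and reg: "\<And>q. F q = 0 \<Longrightarrow> \<exists>v. frechet_derivative F (at q) v \<noteq> 0"
  shows "smooth_submanifold TYPE(real^2) {q. F q = 0}"
  unfolding smooth_submanifold_def
proof
  fix p assume "p \<in> {q. F q = 0}"
  then have p: "F p = 0" by simp
  then obtain v where v: "frechet_derivative F (at p) v \<noteq> 0" using reg by blast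
  show "\<exists>W. openin (top_of_set {q. F q = 0}) W \<and> p \<in> W \<and> (\<exists>V::(real^2) set. open V \<and> diffeomorphic_sets V W)"
  proof (rule level_set_chart[OF F p v])
    fix W and V :: "(real^2) set" and \<phi> J'
    assume W: "openin (top_of_set {q. F q = 0}) W" "p \<in> W" "open V" "homeomorphism V W \<phi> J'"
      "smooth_on V \<phi>" "bounded_linear J'"
    have "diffeomorphic_sets V W"
      unfolding diffeomorphic_sets_def
      by (intro exI[of _ \<phi>] exI[of _ J'] conjI W(4) smooth_map_on_bounded_linear[OF W(6)]
          smooth_on_imp_smooth_map_on[OF W(3) W(5) order_refl])
    with W(1-3) show ?thesis by (intro exI[of _ W] exI[of _ V] conjI)
  qed
qed

lemma has_vector_derivative_smooth_curve:
  fixes \<gamma> :: "real \<Rightarrow> 'a::euclidean_space"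
  assumes "smooth_on U \<gamma>" "t \<in> U"
  shows "(\<gamma> has_vector_derivative vector_derivative \<gamma> (at t)) (at t)"
  using smooth_onD[OF assms] differentiableI vector_derivative_works by blast

text \<open>One inclusion differentiates \<open>F\<close> along a curve. For the other, the straight
  line with velocity \<open>J' v\<close> is lifted by the chart: the velocity \<open>w\<close> of
  the lift lies in the kernel and \<open>J' w = J' v\<close>, so \<open>w = v\<close> by injectivity
  of \<open>J'\<close> on the kernel.\<close>

lemma tangent_space_level_set:
  fixes F :: "real^3 \<Rightarrow> real"
  assumes F: "smooth_on UNIV F" and p: "F p = 0" and nz: "frechet_derivative F (at p) v0 \<noteq> 0"
  shows "tangent_space {q. F q = 0} p = {v. frechet_derivative F (at p) v = 0}"
proof (intro equalityI subsetI)
  let ?D = "frechet_derivative F (at p)"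
  have DF: "(F has_derivative ?D) (at p)" using smooth_onD[OF F] by simp
  fix v assume "v \<in> tangent_space {q. F q = 0} p"
  then obtain \<gamma> e where v: "v = vector_derivative \<gamma> (at 0)" and \<gamma>: "\<gamma> 0 = p" "e > 0" "smooth_on {-e<..<e} \<gamma>"
    and im: "\<gamma> ` {-e<..<e} \<subseteq> {q. F q = 0}"
    unfolding tangent_space_def smooth_curve_in_def by blast
  have d: "(\<gamma> has_vector_derivative v) (at 0)"
    unfolding v using \<gamma> by (intro has_vector_derivative_smooth_curve) auto
  have "((F \<circ> \<gamma>) has_vector_derivative ?D v) (at 0)"
    using vector_derivative_diff_chain_within[OF d, of F ?D] DF \<gamma>(1) by (simp add: has_derivative_at_withinI)
  moreover have "((F \<circ> \<gamma>) has_vector_derivative 0) (at 0)"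
    by (rule has_vector_derivative_transform_within_open[OF has_vector_derivative_const[of 0], where S="{-e<..<e}"])
       (use \<gamma> im in \<open>auto simp: image_subset_iff\<close>)
  ultimately have "?D v = 0" by (rule vector_derivative_unique_at)
  then show "v \<in> {v. ?D v = 0}" by simp
next
  let ?D = "frechet_derivative F (at p)"
  have DF: "(F has_derivative ?D) (at p)" using smooth_onD[OF F] by simp
  fix v assume v: "v \<in> {v. ?D v = 0}"
  obtain W and V :: "(real^2) set" and \<phi> J' where
    W: "openin (top_of_set {q. F q = 0}) W" "p \<in> W" "open V" "homeomorphism V W \<phi> J'" "smooth_on V \<phi>"
    "bounded_linear J'" and J'0: "\<And>v. ?D v = 0 \<Longrightarrow> J' v = 0 \<Longrightarrow> v = 0"
  proof (rule level_set_chart[OF F p nz])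
    fix W and V :: "(real^2) set" and \<phi> J'
    assume W: "openin (top_of_set {q. F q = 0}) W" "p \<in> W" "open V" "homeomorphism V W \<phi> J'"
      "smooth_on V \<phi>" "bounded_linear J'" and J'0: "\<And>v. ?D v = 0 \<Longrightarrow> J' v = 0 \<Longrightarrow> v = 0"
    show thesis by (rule that[OF W J'0])
  qed
  interpret J': bounded_linear J' by fact
  have \<phi>: "\<And>u. u \<in> V \<Longrightarrow> \<phi> u \<in> W \<and> J' (\<phi> u) = u" "\<phi> (J' p) = p" "J' p \<in> V"
    using W(2,4) by (auto simp: homeomorphism_def)
  let ?l = "\<lambda>t::real. J' p + t *\<^sub>R J' v"
  have "open (?l -` V)" using W(3) by (intro open_vimage) (auto intro!: continuous_intros)
  moreover have "0 \<in> ?l -` V" using \<phi> by simp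
  ultimately obtain e where e: "e > 0" "{-e<..<e} \<subseteq> ?l -` V"
    by (metis (no_types, lifting) open_contains_ball ball_eq_greaterThanLessThan diff_0 add_0)
  let ?\<gamma> = "\<lambda>t. \<phi> (?l t)"
  have "smooth_on {-e<..<e} ?l"
    by (rule smooth_map_on_open) (auto intro!: smooth_intros)
  then have sm: "smooth_on {-e<..<e} ?\<gamma>"
    by (intro smooth_on_compose[OF _ W(3) W(5)]) (use e in auto)
  have F0: "F (\<phi> u) = 0" if "u \<in> V" for u
    using openin_imp_subset[OF W(1)] \<phi>(1)[OF that] by blast
  have cu: "smooth_curve_in {q. F q = 0} ?\<gamma>"
    unfolding smooth_curve_in_def using sm e F0 by blast
  define w where "w = vector_derivative ?\<gamma> (at 0)"
  have d: "(?\<gamma> has_vector_derivative w) (at 0)"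
    unfolding w_def by (rule has_vector_derivative_smooth_curve[OF sm]) (use e in auto)
  have "((F \<circ> ?\<gamma>) has_vector_derivative ?D w) (at 0)"
    using vector_derivative_diff_chain_within[OF d, of F ?D] DF \<phi>(2) by (simp add: has_derivative_at_withinI)
  moreover have "((F \<circ> ?\<gamma>) has_vector_derivative 0) (at 0)"
    by (rule has_vector_derivative_transform_within_open[OF has_vector_derivative_const[of 0], where S="{-e<..<e}"])
       (use e F0 in auto)
  ultimately have Dw: "?D w = 0" by (rule vector_derivative_unique_at)
  have "((\<lambda>t. J' (?\<gamma> t)) has_vector_derivative J' w) (at 0)"
    using J'.has_vector_derivative[OF d] .
  moreover have "((\<lambda>t. J' (?\<gamma> t)) has_vector_derivative J' v) (at 0)"
  proof (rule has_vector_derivative_transform_within_open[where S="{-e<..<e}" and f="?l"])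
    show "(?l has_vector_derivative J' v) (at 0)" by (auto intro!: derivative_eq_intros)
  qed (use e \<phi>(1) in auto)
  ultimately have "J' w = J' v" by (rule vector_derivative_unique_at)
  then have "J' (w - v) = 0" by (simp add: J'.diff)
  moreover have "?D (w - v) = 0" using Dw v linear_diff[OF has_derivative_linear[OF DF]] by simp
  ultimately have "w - v = 0" using J'0 by blast
  then have "v = vector_derivative ?\<gamma> (at 0)" by (simp add: w_def)
  then show "v \<in> tangent_space {q. F q = 0} p"
    unfolding tangent_space_def using cu \<phi>(2) by (auto intro!: exI[of _ ?\<gamma>])
qed

text \<open>The 2-form is the volume form contracted with the gradient \<open>n\<close>, that is the
  triple product of \<open>n\<close>, \<open>u\<close> and \<open>v\<close>. It is nonzero on
  \<open>u\<close> and \<open>cross3 (n p) u\<close> for any nonzero tangent vector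
  \<open>u\<close>, where it is a squared norm.\<close>

lemma orientable_surface_level_set:
  fixes F :: "real^3 \<Rightarrow> real"
  assumes F: "smooth_on UNIV F" and reg: "\<And>q. F q = 0 \<Longrightarrow> \<exists>v. frechet_derivative F (at q) v \<noteq> 0"
  shows "orientable_surface {q. F q = 0}"
proof -
  define n where "n = (\<lambda>q. (\<chi> i. frechet_derivative F (at q) (axis i 1)) :: real^3)"
  let ?\<omega> = "\<lambda>q u v. cross3 (n q) u \<bullet> v"
  have linD: "linear (frechet_derivative F (at q))" for q
    using smooth_onD[OF F] has_derivative_linear by blast
  have Dn: "frechet_derivative F (at q) v = n q \<bullet> v" for q v
  proof -
    have "frechet_derivative F (at q) v = frechet_derivative F (at q) (\<Sum>i\<in>UNIV. (v $ i) *\<^sub>R axis i 1)"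
      by (simp add: basis_expansion scalar_mult_eq_scaleR[symmetric])
    also have "\<dots> = n q \<bullet> v"
      by (simp add: linear_sum[OF linD] linear_scale[OF linD] inner_vec_def mult.commute n_def)
    finally show ?thesis .
  qed
  have "bilinear (?\<omega> q)" for q
    unfolding bilinear_def by (auto intro!: linearI simp: cross_add_right cross_mult_right inner_left_distrib inner_right_distrib)
  moreover have "?\<omega> q v v = 0" for q v by (simp add: dot_cross_self)
  moreover have "smooth_map_on S (\<lambda>q. ?\<omega> q u v)" for S u v
  proof -
    have sm: "smooth_map_on S (\<lambda>q. frechet_derivative F (at q) (axis i 1))" for i
      by (rule smooth_on_imp_smooth_map_on[OF open_UNIV smooth_on_frechet_derivative[OF F]]) auto
    have bl: "bounded_linear (\<lambda>w. cross3 w u \<bullet> v)"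
      unfolding linear_conv_bounded_linear[symmetric]
      by (auto intro!: linearI simp: cross_add_left cross_mult_left inner_left_distrib)
    show ?thesis unfolding n_def by (rule smooth_map_on_bounded_linear_comp[OF bl smooth_map_on_vec_lambda[OF sm]])
  qed
  moreover have "\<exists>u \<in> tangent_space {q. F q = 0} p. \<exists>v \<in> tangent_space {q. F q = 0} p. ?\<omega> p u v \<noteq> 0" if p: "F p = 0" for p
  proof -
    obtain v0 where v0: "frechet_derivative F (at p) v0 \<noteq> 0" using reg[OF p] by auto
    have T: "tangent_space {q. F q = 0} p = {v. n p \<bullet> v = 0}"
      using tangent_space_level_set[OF F p v0] by (simp add: Dn)
    obtain u where u: "u \<noteq> 0" "orthogonal (n p) u"
      using orthogonal_to_vector_exists[of "n p"] by auto
    have n0: "n p \<noteq> 0" using v0 by (auto simp: Dn)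
    let ?v = "cross3 (n p) u"
    have "?v \<noteq> 0"
    proof
      assume "?v = 0"
      then have "(norm (n p))\<^sup>2 * (norm u)\<^sup>2 = 0"
        using norm_cross_dot[of "n p" u] u(2) by (simp add: orthogonal_def power_mult_distrib)
      then show False using n0 u(1) by simp
    qed
    moreover have "u \<in> tangent_space {q. F q = 0} p" "?v \<in> tangent_space {q. F q = 0} p"
      unfolding T using u by (auto simp: orthogonal_def dot_cross_self)
    ultimately show ?thesis by (metis inner_eq_zero_iff)
  qed
  ultimately show ?thesis
    unfolding orientable_surface_def using smooth_submanifold_level_set[OF F reg]
    by (intro conjI exI[of _ ?\<omega>]) auto
qed


section \<open>Homology of planar domains\<close>

lemma iso_image_carrier: "f \<in> iso G H \<Longrightarrow> f ` carrier G = carrier H"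
  by (simp add: iso_def bij_betw_def)

lemma iso_inj_on: "f \<in> iso G H \<Longrightarrow> inj_on f (carrier G)"
  by (simp add: iso_def bij_betw_def)

text \<open>Reduced homology is the kernel of the map to a one-point space. In degree 0 both groups
  are infinite cyclic, generated by the class of a point simplex, and the map sends generator to
  generator, so it is injective.\<close>

lemma trivial_reduced_homology_group_0_path_connected:
  assumes X: "path_connected_space X" and a: "a \<in> topspace X"
  shows "trivial_group (reduced_homology_group 0 X)"
proof -
  let ?Y = "discrete_topology {()}"
  let ?h = "hom_induced 0 X {} ?Y {} (\<lambda>x. ())"
  define f where "f = restrict (\<lambda>x::nat \<Rightarrow> real. a) (standard_simplex 0)"
  have f: "singular_simplex 0 X f"
    by (simp add: singular_simplex_def a f_def)
  define q where "q = homologous_rel_set 0 X {} (frag_of f)"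
  define f' where "f' = simplex_map 0 (\<lambda>x. ()) f"
  have cm: "continuous_map X ?Y (\<lambda>x. ())" by simp
  have f': "singular_simplex 0 ?Y f'"
    unfolding f'_def by (rule singular_simplex_simplex_map[OF f cm])
  define q' where "q' = homologous_rel_set 0 ?Y {} (frag_of f')"
  have Y: "path_connected_space ?Y"
    by (auto simp: path_connected_space_def pathin_def intro!: exI[of _ "\<lambda>x. ()"])
  have iX: "pow (homology_group 0 X) q \<in> iso integer_group (homology_group 0 X)"
    using iso_integer_zeroth_homology_group[OF X f] by (simp add: q_def)
  have iY: "pow (homology_group 0 ?Y) q' \<in> iso integer_group (homology_group 0 ?Y)"
    using iso_integer_zeroth_homology_group[OF Y f'] by (simp add: q'_def)
  have src: "singular_relcycle 0 X {} (frag_of f)"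
    by (simp add: chain_boundary_def f singular_chain_of singular_cycle)
  have "?h q = q'"
    using hom_induced_chain_map[OF cm _ src, of "{}"] by (simp add: q_def q'_def f'_def)
  interpret h: group_hom "homology_group 0 X" "homology_group 0 ?Y" ?h
    by (simp add: group_hom_def group_hom_axioms_def hom_induced_empty_hom)
  have qc: "q \<in> carrier (homology_group 0 X)"
    unfolding q_def using src carrier_relative_homology_group[of 0 X "{}"] by auto
  have "x = \<one>\<^bsub>homology_group 0 X\<^esub>" if x: "x \<in> carrier (homology_group 0 X)" and hx: "?h x = \<one>\<^bsub>homology_group 0 ?Y\<^esub>" for x
  proof -
    have im: "range (\<lambda>n::int. q [^]\<^bsub>homology_group 0 X\<^esub> n) = carrier (homology_group 0 X)"
      using iso_image_carrier[OF iX] by simp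
    obtain n where n: "x = q [^]\<^bsub>homology_group 0 X\<^esub> (n::int)"
      using x[folded im] by blast
    have "?h (q [^]\<^bsub>homology_group 0 X\<^esub> n) = q' [^]\<^bsub>homology_group 0 ?Y\<^esub> n"
      using h.hom_int_pow[OF qc, of n] by (simp only: \<open>?h q = q'\<close>)
    with hx n have "q' [^]\<^bsub>homology_group 0 ?Y\<^esub> n = \<one>\<^bsub>homology_group 0 ?Y\<^esub>" by simp
    then have "q' [^]\<^bsub>homology_group 0 ?Y\<^esub> n = q' [^]\<^bsub>homology_group 0 ?Y\<^esub> (0::int)"
      by simp
    then have "n = 0"
      using inj_onD[OF iso_inj_on[OF iY], of n 0] by simp
    then show ?thesis using n by simp
  qed
  then show ?thesis
    unfolding trivial_group_def
    by (auto simp: carrier_reduced_homology_group kernel_def one_reduced_homology_group hom_induced_carrier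
        intro: h.hom_one)
qed

lemma trivial_homology_group_contractible:
  "contractible_space X \<Longrightarrow> p \<noteq> 0 \<Longrightarrow> trivial_group (homology_group p X)"
  using trivial_reduced_homology_group_contractible_space un_reduced_homology_group by metis

lemma trivial_homology_group_convex:
  fixes S :: "'a::real_normed_vector set"
  shows "convex S \<Longrightarrow> p \<noteq> 0 \<Longrightarrow> trivial_group (homology_group p (top_of_set S))"
  by (rule trivial_homology_group_contractible)
     (auto simp: contractible_space_top_of_set convex_imp_contractible)

lemma homology_group_disjoint_Union_gen:
  fixes V :: "'i \<Rightarrow> 'a::topological_space set"
  assumes ope: "\<And>i. i \<in> I \<Longrightarrow> openin (top_of_set (\<Union>i\<in>I. V i)) (V i)"
    and disj: "\<And>i j. i \<in> I \<Longrightarrow> j \<in> I \<Longrightarrow> i \<noteq> j \<Longrightarrow> V i \<inter> V j = {}"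
  shows "sum_group (V ` I) (\<lambda>S. homology_group p (top_of_set S)) \<cong> homology_group p (top_of_set (\<Union>i\<in>I. V i))"
proof -
  let ?A = "\<Union>i\<in>I. V i"
  have sub: "subtopology (top_of_set ?A) v = top_of_set v" if "v \<in> V ` I" for v
  proof -
    have "v \<subseteq> ?A" using that by auto
    then show ?thesis by (simp add: subtopology_subtopology Int_absorb1)
  qed
  have "sum_group (V ` I) (\<lambda>S. homology_group p (subtopology (top_of_set ?A) S)) \<cong> homology_group p (top_of_set ?A)"
    by (rule is_isoI[OF homology_additivity_axiom])
       (use assms in \<open>auto simp: pairwise_def disjnt_def\<close>)
  moreover have "sum_group (V ` I) (\<lambda>S. homology_group p (subtopology (top_of_set ?A) S))
      \<cong> sum_group (V ` I) (\<lambda>S. homology_group p (top_of_set S))"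
    by (rule iso_sum_groupI) (auto simp: sub)
  ultimately show ?thesis
    by (meson group.iso_sym iso_trans group_relative_homology_group sum_group)
qed

text \<open>Additivity indexes the sum by the set of pieces. Disjoint nonempty pieces are distinct,
  so this set has as many elements as \<open>I\<close>, and a free abelian group is determined by
  the size of its basis.\<close>

lemma homology_group_disjoint_Union_integer:
  fixes V :: "'i \<Rightarrow> 'a::topological_space set"
  assumes ope: "\<And>i. i \<in> I \<Longrightarrow> openin (top_of_set (\<Union>i\<in>I. V i)) (V i)"
    and disj: "\<And>i j. i \<in> I \<Longrightarrow> j \<in> I \<Longrightarrow> i \<noteq> j \<Longrightarrow> V i \<inter> V j = {}"
    and ne: "\<And>i. i \<in> I \<Longrightarrow> V i \<noteq> {}"
    and Z: "\<And>i. i \<in> I \<Longrightarrow> homology_group p (top_of_set (V i)) \<cong> integer_group"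
  shows "homology_group p (top_of_set (\<Union>i\<in>I. V i)) \<cong> free_Abelian_group I"
proof -
  have "inj_on V I" using disj ne unfolding inj_on_def by fastforce
  then have "V ` I \<approx> I" by (meson eqpoll_sym inj_on_image_eqpoll_self)
  then have 1: "free_Abelian_group (V ` I) \<cong> free_Abelian_group I"
    by (simp add: isomorphic_free_Abelian_groups)
  have 2: "sum_group (V ` I) (\<lambda>S. homology_group p (top_of_set S)) \<cong> sum_group (V ` I) (\<lambda>S. integer_group)"
    by (rule iso_sum_groupI) (auto simp: Z)
  have 3: "homology_group p (top_of_set (\<Union>i\<in>I. V i)) \<cong> sum_group (V ` I) (\<lambda>S. homology_group p (top_of_set S))"
    by (rule group.iso_sym[OF _ homology_group_disjoint_Union_gen[OF ope disj]]) auto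
  show ?thesis
    using iso_trans[OF 3 iso_trans[OF 2 iso_trans[OF isomorphic_sum_integer_group 1]]] .
qed

lemma trivial_homology_group_disjoint_Union:
  fixes V :: "'i \<Rightarrow> 'a::topological_space set"
  assumes ope: "\<And>i. i \<in> I \<Longrightarrow> openin (top_of_set (\<Union>i\<in>I. V i)) (V i)"
    and disj: "\<And>i j. i \<in> I \<Longrightarrow> j \<in> I \<Longrightarrow> i \<noteq> j \<Longrightarrow> V i \<inter> V j = {}"
    and T: "\<And>i. i \<in> I \<Longrightarrow> trivial_group (homology_group p (top_of_set (V i)))"
  shows "trivial_group (homology_group p (top_of_set (\<Union>i\<in>I. V i)))"
proof -
  have "trivial_group (sum_group (V ` I) (\<lambda>S. homology_group p (top_of_set S)))"
  proof -
    have "x = \<one>\<^bsub>sum_group (V ` I) (\<lambda>S. homology_group p (top_of_set S))\<^esub>"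
      if "x \<in> carrier (sum_group (V ` I) (\<lambda>S. homology_group p (top_of_set S)))" for x
      using that T by (auto simp: carrier_sum_group trivial_group_def PiE_def extensional_def Pi_def restrict_def fun_eq_iff)
    moreover have g: "group (sum_group (V ` I) (\<lambda>S. homology_group p (top_of_set S)))"
      by (rule sum_group) simp
    ultimately show ?thesis
      unfolding trivial_group_def using monoid.one_closed[OF group.is_monoid[OF g]] by blast
  qed
  then show ?thesis
    using homology_group_disjoint_Union_gen[OF ope disj, of p] group_relative_homology_group
    by (meson isomorphic_group_triviality sum_group)
qed

text \<open>Radial projection to the circle of radius \<open>r0\<close> is a homotopy equivalence.
  Each point of the connecting segment is a positive multiple of \<open>z - c\<close> and its norm
  interpolates linearly, so convexity of \<open>J\<close> keeps it in the band. A general convex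
  \<open>J\<close> covers both the half-open and the open collars.\<close>

lemma homology_group_circle_band:
  fixes c :: complex and J :: "real set"
  assumes J: "convex J" "r0 \<in> J" "J \<subseteq> {0<..}"
  shows "homology_group 1 (top_of_set {z. norm (z - c) \<in> J}) \<cong> integer_group"
proof -
  let ?S = "{z. norm (z - c) \<in> J}"
  let ?f = "\<lambda>z n. if n = 0 then Re ((z - c) / norm (z - c)) else if n = (1::nat) then Im ((z - c) / norm (z - c)) else 0"
  let ?g = "\<lambda>x::nat\<Rightarrow>real. c + of_real r0 * Complex (x 0) (x 1)"
  have r0: "r0 > 0" using J by auto
  have nz: "z \<noteq> c" if "z \<in> ?S" for z using that J by force
  have cf: "continuous_map (top_of_set ?S) (nsphere 1) ?f"
  proof -
    have "continuous_map (top_of_set ?S) (powertop_real UNIV) ?f"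
      unfolding continuous_map_componentwise_UNIV continuous_map_iff_continuous
    proof
      fix k
      have 1: "continuous_on ?S (\<lambda>z. (z - c) / norm (z - c))"
        using nz by (intro continuous_intros) auto
      show "continuous_on ?S (\<lambda>z. ?f z k)"
        by (cases "k = 0"; cases "k = 1") (use continuous_on_Re[OF 1] continuous_on_Im[OF 1] in auto)
    qed
    moreover have "?f z \<in> {x. (\<Sum>i\<le>1. (x i)\<^sup>2) = 1 \<and> (\<forall>i>1. x i = 0)}" if "z \<in> ?S" for z
    proof -
      have "norm ((z - c) / norm (z - c)) = 1" using nz[OF that] by (simp add: norm_divide)
      then have "(Re ((z - c) / norm (z - c)))\<^sup>2 + (Im ((z - c) / norm (z - c)))\<^sup>2 = 1"
        by (metis cmod_power2 one_power2)
      then show ?thesis by simp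
    qed
    ultimately show ?thesis
      unfolding nsphere continuous_map_in_subtopology by (intro conjI Pi_I) simp_all
  qed
  have nsph: "(x 0)\<^sup>2 + (x 1)\<^sup>2 = 1" "\<And>i. i > 1 \<Longrightarrow> x i = 0" if "x \<in> topspace (nsphere 1)" for x
    using that by (auto simp: nsphere)
  have ng: "norm (?g x - c) = r0" if "x \<in> topspace (nsphere 1)" for x
  proof -
    have "norm (Complex (x 0) (x 1)) = 1" using nsph(1)[OF that] by (simp add: cmod_def)
    then show ?thesis using r0 by (simp only: add_diff_cancel_left' norm_mult norm_of_real)
  qed
  have cp: "continuous_map (nsphere 1) euclideanreal (\<lambda>x. x k)" for k
    by (rule continuous_map_nsphere_projection)
  have cg: "continuous_map (nsphere 1) (top_of_set ?S) ?g"
  proof (rule continuous_map_into_subtopology)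
    have h: "continuous_map (nsphere 1) euclidean (\<lambda>x. (x 0, x (1::nat)))"
      using continuous_map_pairedI[OF cp cp, of 0 1]
      by (simp add: euclidean_product_topology[symmetric])
    have c2: "continuous_map euclidean euclidean (\<lambda>p::real\<times>real. c + of_real r0 * Complex (fst p) (snd p))"
      by (auto simp: Complex_eq intro!: continuous_intros)
    show "continuous_map (nsphere 1) euclidean ?g"
      using continuous_map_compose[OF h c2] by (simp add: o_def)
  qed (use ng J in auto)
  have fg: "?f (?g x) = x" if x: "x \<in> topspace (nsphere 1)" for x
  proof
    fix n
    have "(?g x - c) / norm (?g x - c) = Complex (x 0) (x 1)"
      unfolding ng[OF x] using r0 by simp
    then show "?f (?g x) n = x n"
      using nsph(2)[OF x, of n] by auto
  qed
  have "homotopic_with_canon (\<lambda>z. True) ?S ?S (\<lambda>z. ?g (?f z)) id"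
  proof (rule homotopic_with_linear)
    have "?g (?f z) = c + of_real r0 * ((z - c) / norm (z - c))" for z
      by (simp add: complex_eq_iff)
    then show "continuous_on ?S (\<lambda>z. ?g (?f z))"
      using nz by (auto intro!: continuous_intros)
    fix z assume z: "z \<in> ?S"
    show "closed_segment (?g (?f z)) (id z) \<subseteq> ?S"
    proof
      fix w assume "w \<in> closed_segment (?g (?f z)) (id z)"
      then obtain t where t: "0 \<le> t" "t \<le> 1" and w: "w = (1 - t) *\<^sub>R ?g (?f z) + t *\<^sub>R z"
        by (auto simp: closed_segment_def)
      have nz': "norm (z - c) > 0" using nz[OF z] by simp
      have "w - c = of_real (((1 - t) * r0 + t * norm (z - c)) / norm (z - c)) * (z - c)"
        unfolding w using nz' by (simp add: complex_eq_iff field_simps)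
      then have "norm (w - c) = \<bar>((1 - t) * r0 + t * norm (z - c)) / norm (z - c)\<bar> * norm (z - c)"
        by (simp only: norm_mult norm_of_real)
      then have "norm (w - c) = (1 - t) * r0 + t * norm (z - c)"
        using nz' t r0 by (simp add: abs_mult)
      also have "\<dots> \<in> J"
        using convexD[OF J(1) J(2), of "norm (z - c)" "1 - t" t] z t by simp
      finally show "w \<in> ?S" by simp
    qed
  qed (auto intro: continuous_intros)
  then have "homotopic_with (\<lambda>x. True) (top_of_set ?S) (top_of_set ?S) (?g \<circ> ?f) id"
    by (simp add: o_def)
  moreover have "homotopic_with (\<lambda>x. True) (nsphere 1) (nsphere 1) (?f \<circ> ?g) id"
  proof (rule homotopic_with_equal)
    show "continuous_map (nsphere 1) (nsphere 1) (?f \<circ> ?g)"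
      by (rule continuous_map_compose[OF cg cf])
    show "(?f \<circ> ?g) x = id x" if "x \<in> topspace (nsphere 1)" for x
      unfolding o_def id_def by (rule fg[OF that])
  qed simp_all
  ultimately have "top_of_set ?S homotopy_equivalent_space nsphere 1"
    unfolding homotopy_equivalent_space_def using cf cg by blast
  then have "homology_group 1 (top_of_set ?S) \<cong> homology_group 1 (nsphere 1)"
    by (rule homotopy_equivalent_space_imp_isomorphic_homology_groups)
  also have "homology_group 1 (nsphere 1) \<cong> integer_group"
    using reduced_homology_group_nsphere(1)[of 1] un_reduced_homology_group[of 1 "nsphere 1"] by simp
  finally show ?thesis .
qed

text \<open>Since \<open>B\<close> and \<open>U\<close> have no first and second homology, the
  boundary map identifies \<open>H\<^sub>1\<close> of the complement of \<open>E\<close> with a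
  relative \<open>H\<^sub>2\<close>, in \<open>B\<close> as well as in \<open>U\<close>. Excision
  compares the two relative groups, and naturality of the boundary map transfers the isomorphism.
  The set \<open>E\<close> may be open; the closed set \<open>E'\<close> between \<open>E\<close>
  and \<open>U\<close> provides the room that excision asks for.\<close>

lemma iso_hom_induced_excision_H1:
  fixes B U E E' :: "'a::real_normed_vector set"
  assumes U: "open U" "U \<subseteq> B" and E: "closed E'" "E \<subseteq> E'" "E' \<subseteq> U"
    and B: "trivial_group (homology_group 1 (top_of_set B))" "trivial_group (homology_group 2 (top_of_set B))"
    and U': "trivial_group (homology_group 1 (top_of_set U))" "trivial_group (homology_group 2 (top_of_set U))"
  shows "hom_induced 1 (top_of_set (U - E)) {} (top_of_set (B - E)) {} id
     \<in> iso (homology_group 1 (top_of_set (U - E))) (homology_group 1 (top_of_set (B - E)))"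
proof -
  let ?X = "top_of_set B" and ?Y = "top_of_set U"
  have bd: "hom_boundary 2 (top_of_set S) (S - E)
     \<in> iso (relative_homology_group 2 (top_of_set S) (S - E)) (homology_group 1 (top_of_set (S - E)))"
    if "trivial_group (homology_group 1 (top_of_set S))" "trivial_group (homology_group 2 (top_of_set S))"
    for S
  proof -
    have s: "subtopology (top_of_set S) (S - E) = top_of_set (S - E)"
      by (simp add: subtopology_subtopology) (metis Diff_subset inf.absorb2)
    have "exact_seq ([homology_group 1 (top_of_set S), homology_group 1 (top_of_set (S - E)),
        relative_homology_group 2 (top_of_set S) (S - E), homology_group 2 (top_of_set S)],
        [hom_induced 1 (top_of_set (S - E)) {} (top_of_set S) {} id, hom_boundary 2 (top_of_set S) (S - E),
         hom_induced 2 (top_of_set S) {} (top_of_set S) (S - E) id])"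
      using homology_exactness_axiom_1[of 2 "top_of_set S" "S - E"]
        homology_exactness_axiom_2[of 2 "top_of_set S" "S - E"] by (simp add: s)
    then show ?thesis using that very_short_exact_sequence by blast
  qed
  have exc: "hom_induced 2 ?Y (U - E) ?X (B - E) id
      \<in> iso (relative_homology_group 2 ?Y (U - E)) (relative_homology_group 2 ?X (B - E))"
  proof -
    \<comment> \<open>The excised part is \<open>B - U\<close>, closed in \<open>B\<close> and
      contained in the open set \<open>B - E'\<close>, hence in the interior of
      \<open>B - E\<close>.\<close>
    have "closedin ?X (B - U)" unfolding Diff_eq using U(1) by (intro closedin_closed_Int) auto
    then have 1: "?X closure_of (B - U) = B - U" by (simp add: closure_of_closedin)
    have "openin ?X (B - E')"
      using E by (metis Diff_eq open_Compl openin_open)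
    then have "B - U \<subseteq> ?X interior_of (B - E)"
      using E by (intro interior_of_maximal[THEN order_trans[rotated]]) auto
    with 1 have "?X closure_of (B - U) \<subseteq> ?X interior_of (B - E)" by simp
    from homology_excision_axiom[OF this, of B 2]
    have "hom_induced 2 (subtopology ?X (B - (B - U))) (B - E - (B - U)) (subtopology ?X B) (B - E) id
      \<in> iso (relative_homology_group 2 (subtopology ?X (B - (B - U))) (B - E - (B - U)))
          (relative_homology_group 2 (subtopology ?X B) (B - E))" by simp
    moreover have "B - (B - U) = U" "B - E - (B - U) = U - E" "B \<inter> U = U" using U by auto
    ultimately show ?thesis by (simp add: subtopology_subtopology)
  qed
  have sY: "subtopology ?Y (U - E) = top_of_set (U - E)" 
    by (simp add: subtopology_subtopology) (metis Diff_subset inf.absorb2)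
  have sX: "subtopology ?X (B - E) = top_of_set (B - E)" 
    by (simp add: subtopology_subtopology) (metis Diff_subset inf.absorb2)
  have nat: "hom_boundary 2 ?X (B - E) \<circ> hom_induced 2 ?Y (U - E) ?X (B - E) id
       = hom_induced 1 (top_of_set (U - E)) {} (top_of_set (B - E)) {} id \<circ> hom_boundary 2 ?Y (U - E)"
  proof -
    have "continuous_map ?Y ?X id" "id \<in> U - E \<rightarrow> B - E" using U by auto
    from naturality_hom_induced[OF this, of 2] show ?thesis by (simp add: sX sY)
  qed
  let ?h = "hom_induced 1 (top_of_set (U - E)) {} (top_of_set (B - E)) {} id"
  let ?bY = "hom_boundary 2 ?Y (U - E)"
  have "hom_boundary 2 ?X (B - E) \<circ> hom_induced 2 ?Y (U - E) ?X (B - E) id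
    \<in> iso (relative_homology_group 2 ?Y (U - E)) (homology_group 1 (top_of_set (B - E)))"
    using iso_set_trans[OF exc bd[OF B]] by (simp add: compose_def o_def) 
  then have hb: "?h \<circ> ?bY \<in> iso (relative_homology_group 2 ?Y (U - E)) (homology_group 1 (top_of_set (B - E)))"
    by (simp add: nat)
  note bY = bd[OF U']
  have "bij_betw ?h (carrier (homology_group 1 (top_of_set (U - E)))) (carrier (homology_group 1 (top_of_set (B - E))))"
  proof -
    have 1: "bij_betw ?bY (carrier (relative_homology_group 2 ?Y (U - E))) (carrier (homology_group 1 (top_of_set (U - E))))"
      using bY by (simp only: iso_def mem_Collect_eq)
    have 2: "bij_betw (?h \<circ> ?bY) (carrier (relative_homology_group 2 ?Y (U - E))) (carrier (homology_group 1 (top_of_set (B - E))))"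
      using hb by (simp only: iso_def mem_Collect_eq)
    show ?thesis using bij_betw_comp_iff[OF 1, of ?h] 2 by simp
  qed
  then show ?thesis by (simp add: iso_def hom_induced_empty_hom)
qed

section \<open>Connectedness of regions with holes\<close>

text \<open>In a separation of \<open>V - E\<close> the connected collar lies on one side. Adding
  the whole ball to that side and removing the closed core \<open>cball c s\<close> from the other
  would separate \<open>V\<close>. The strict inequality \<open>s < r\<close> gives a closed core
  inside the open ball, so both new sets are open.\<close>

lemma connected_Diff_ball_subset:
  fixes V :: "'a::metric_space set"
  assumes V: "connected V" "ball c r \<subseteq> V" and E: "E \<subseteq> cball c s" "s < r" "0 < r"
    and N: "connected (ball c r - E)"
  shows "connected (V - E)"
proof (rule ccontr)
  assume "\<not> connected (V - E)"
  then obtain A B where AB: "open A" "open B" "V - E \<subseteq> A \<union> B" "A \<inter> B \<inter> (V - E) = {}"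
    "A \<inter> (V - E) \<noteq> {}" "B \<inter> (V - E) \<noteq> {}"
    unfolding connected_def by blast
  let ?N = "ball c r - E"
  have sub: "cball c s \<subseteq> ball c r" using E by auto
  have main: False if AB: "open A" "open B" "V - E \<subseteq> A \<union> B" "A \<inter> B \<inter> (V - E) = {}"
    "A \<inter> (V - E) \<noteq> {}" "B \<inter> (V - E) \<noteq> {}" and NB: "?N \<inter> B = {}" for A B
  proof -
    let ?A = "(A - cball c s) \<union> ball c r" and ?B = "B - cball c s"
    have "open ?A" "open ?B" using AB by auto
    moreover have "V \<subseteq> ?A \<union> ?B" using AB(3) sub E by auto
    moreover have "?A \<inter> ?B \<inter> V = {}"
    proof (rule ccontr)
      assume "?A \<inter> ?B \<inter> V \<noteq> {}"
      then obtain x where x: "x \<in> ?A" "x \<in> B" "x \<notin> cball c s" "x \<in> V" by blast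
      then have "x \<notin> E" using E by blast
      with x AB(4) NB show False by blast
    qed
    moreover have "?A \<inter> V \<noteq> {}" using V(2) \<open>0 < r\<close> by (metis Int_iff UnI2 centre_in_ball empty_iff subsetD)
    moreover have "?B \<inter> V \<noteq> {}" using AB(6) NB sub by blast
    ultimately show False using V(1) unfolding connected_def by blast
  qed
  have "?N \<inter> B = {} \<or> ?N \<inter> A = {}"
  proof (rule ccontr)
    assume "\<not> ?thesis"
    moreover have "?N \<subseteq> A \<union> B" "A \<inter> B \<inter> ?N = {}" using AB V(2) by blast+
    ultimately show False using N AB(1,2) unfolding connected_def by blast
  qed
  then show False
    using main[OF AB] main[of B A] AB by blast
qed

lemma connected_Diff_UN_ball_subset:
  fixes V :: "'a::metric_space set"
  assumes "finite I" "connected V" "\<And>i. i \<in> I \<Longrightarrow> ball (c i) r \<subseteq> V" "\<And>i. i \<in> I \<Longrightarrow> E i \<subseteq> cball (c i) s"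
    and "s < r" "0 < r" "\<And>i. i \<in> I \<Longrightarrow> connected (ball (c i) r - E i)"
    and "\<And>i j. i \<in> I \<Longrightarrow> j \<in> I \<Longrightarrow> i \<noteq> j \<Longrightarrow> ball (c i) r \<inter> ball (c j) r = {}"
  shows "connected (V - (\<Union>i\<in>I. E i))"
  using assms(1,3,4,7,8)
proof (induction I)
  case empty
  then show ?case using assms(2) by simp
next
  case (insert j I)
  have "ball (c j) r \<subseteq> V - (\<Union>i\<in>I. E i)"
  proof -
    have "E i \<inter> ball (c j) r = {}" if "i \<in> I" for i
    proof -
      have "E i \<subseteq> ball (c i) r" using insert.prems(2)[of i] that \<open>s < r\<close> by fastforce
      moreover have "i \<noteq> j" using that insert.hyps by auto
      ultimately show ?thesis using insert.prems(4)[of i j] that by blast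
    qed
    then show ?thesis using insert.prems(1)[of j] by blast
  qed
  moreover have "connected (V - (\<Union>i\<in>I. E i))"
    using insert.prems by (intro insert.IH) auto
  moreover have "E j \<subseteq> cball (c j) s" "connected (ball (c j) r - E j)"
    using insert.prems by auto
  ultimately have "connected (V - (\<Union>i\<in>I. E i) - E j)"
    using connected_Diff_ball_subset assms(5,6) by metis
  moreover have "V - (\<Union>i\<in>I. E i) - E j = V - (\<Union>i\<in>insert j I. E i)" by auto
  ultimately show ?case by simp
qed

lemma path_connected_space_top_of_set: "path_connected_space (top_of_set S) \<longleftrightarrow> path_connected S"
  using path_connectedin_euclidean[of S] by (simp add: path_connectedin_def)

lemma path_connected_norm_band:
  fixes c :: complex
  assumes "convex J" "J \<subseteq> {0..}"
  shows "path_connected {z. norm (z - c) \<in> J}"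
proof (rule path_connected_2DIM_I)
  have "{r. 0 \<le> r \<and> r \<in> J} = J" using assms by auto
  then show "path_connected {r. 0 \<le> r \<and> r \<in> J}" using assms(1) convex_imp_path_connected by simp
qed simp

section \<open>The planar domain and its collars\<close>

definition hole_center :: "nat \<Rightarrow> complex" where
  "hole_center i = of_real (4 * real i)"

text \<open>Unit holes with centres at distance 4 have disjoint collars of radius
  \<open>3/2\<close>. The last centre is \<open>4 * real g - 4\<close>, so these collars stay inside
  radius \<open>4 * real g + 3\<close>, and the outer radius is one unit larger to leave a disjoint
  collar at the rim. For \<open>g = 0\<close> the domain is a disc of radius 4.\<close>

definition planar_closed :: "nat \<Rightarrow> complex set" where
  "planar_closed g = cball 0 (4 * real g + 4) - (\<Union>i<g. ball (hole_center i) 1)"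

definition planar_open :: "nat \<Rightarrow> complex set" where
  "planar_open g = ball 0 (4 * real g + 4) - (\<Union>i<g. cball (hole_center i) 1)"

definition hole_collar :: "nat \<Rightarrow> complex set" where
  "hole_collar g = (\<Union>i<g. {z. norm (z - hole_center i) \<in> {1<..<3/2}})"

text \<open>The form \<open>z - 0\<close> makes the rim an instance of the lemmas about bands
  \<open>norm (z - c) \<in> J\<close>.\<close>

definition rim_collar :: "nat \<Rightarrow> complex set" where
  "rim_collar g = {z. norm (z - 0) \<in> {4 * real g + 3<..<4 * real g + 4}}"

lemma hole_ball_subset: "i < g \<Longrightarrow> ball (hole_center i) (3/2) \<subseteq> ball 0 (4 * real g + 3)"
proof
  fix z assume i: "i < g" and z: "z \<in> ball (hole_center i) (3/2)"
  have "norm z \<le> norm (hole_center i) + norm (z - hole_center i)"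
    by (metis add_diff_cancel_left' diff_add_cancel norm_triangle_ineq)
  moreover have "norm (hole_center i) = 4 * real i" by (simp add: hole_center_def del: of_real_mult)
  moreover have "norm (z - hole_center i) < 3/2" using z by (simp add: dist_norm norm_minus_commute)
  moreover have "real i + 1 \<le> real g" using i by linarith
  ultimately show "z \<in> ball 0 (4 * real g + 3)" by simp
qed

lemma hole_balls_disjoint:
  assumes "i \<noteq> j" shows "ball (hole_center i) (3/2) \<inter> ball (hole_center j) (3/2) = {}"
proof -
  have "dist (hole_center i) (hole_center j) = \<bar>4 * real i - 4 * real j\<bar>"
    unfolding hole_center_def dist_norm of_real_diff[symmetric] norm_of_real ..
  also have "\<dots> \<ge> 4" using assms by linarith
  finally show ?thesis by (intro disjoint_ballI) simp
qed

lemma hole_band_disjoint: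
  assumes "i \<noteq> j" "norm (z - hole_center i) < 3/2" "norm (z - hole_center j) < 3/2"
  shows False
  using hole_balls_disjoint[OF assms(1)] assms(2,3) by (auto simp: dist_norm norm_minus_commute)

lemma openin_hole_band:
  assumes "i < g" "J \<subseteq> {..<3/2}"
  shows "openin (top_of_set (\<Union>i<g. {z. norm (z - hole_center i) \<in> J})) {z. norm (z - hole_center i) \<in> J}"
proof -
  have "{z. norm (z - hole_center i) \<in> J} = (\<Union>i<g. {z. norm (z - hole_center i) \<in> J}) \<inter> ball (hole_center i) (3/2)"
  proof (intro equalityI subsetI)
    fix z assume z: "z \<in> (\<Union>i<g. {z. norm (z - hole_center i) \<in> J}) \<inter> ball (hole_center i) (3/2)"
    then obtain j where j: "j < g" "norm (z - hole_center j) \<in> J" by auto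
    have "norm (z - hole_center i) < 3/2" using z by (auto simp: dist_norm norm_minus_commute)
    with hole_band_disjoint[of i j z] j assms(2) have "i = j" by fastforce
    with j show "z \<in> {z. norm (z - hole_center i) \<in> J}" by simp
  qed (use assms in \<open>auto simp: dist_norm norm_minus_commute\<close>)
  then show ?thesis by (metis open_ball openin_open)
qed

lemma homology_group_1_hole_bands:
  assumes J: "convex J" "r0 \<in> J" "J \<subseteq> {0<..<3/2}"
  shows "homology_group 1 (top_of_set (\<Union>i<g. {z. norm (z - hole_center i) \<in> J})) \<cong> free_Abelian_group {..<g}"
proof (rule homology_group_disjoint_Union_integer)
  fix i assume "i \<in> {..<g}"
  show "homology_group 1 (top_of_set {z. norm (z - hole_center i) \<in> J}) \<cong> integer_group"
    using J by (intro homology_group_circle_band[of J r0]) auto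
  have "hole_center i + of_real r0 \<in> {z. norm (z - hole_center i) \<in> J}" using J by auto
  then show "{z. norm (z - hole_center i) \<in> J} \<noteq> {}" by blast
qed (use J openin_hole_band[of _ g J] hole_band_disjoint in fastforce)+

lemma homology_group_0_hole_collar:
  "homology_group 0 (top_of_set (hole_collar g)) \<cong> free_Abelian_group {..<g}"
  unfolding hole_collar_def
proof (rule homology_group_disjoint_Union_integer)
  fix i assume i: "i \<in> {..<g}"
  let ?V = "{z. norm (z - hole_center i) \<in> {1<..<3/2}}"
  have "hole_center i + of_real (5/4) \<in> ?V" by simp
  then show ne: "?V \<noteq> {}" by blast
  have "path_connected ?V" by (rule path_connected_norm_band) auto
  then show "homology_group 0 (top_of_set ?V) \<cong> integer_group"
    using ne by (intro isomorphic_integer_zeroth_homology_group) (auto simp: path_connected_space_top_of_set)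
  show "openin (top_of_set (\<Union>i<g. {z. norm (z - hole_center i) \<in> {1<..<3/2}})) ?V"
    by (rule openin_hole_band) (use i in auto)
qed (use hole_band_disjoint in fastforce)

lemma trivial_homology_group_hole_balls:
  assumes "p \<noteq> 0"
  shows "trivial_group (homology_group p (top_of_set (\<Union>i<g. ball (hole_center i) (3/2))))"
proof (rule trivial_homology_group_disjoint_Union)
  fix i assume "i \<in> {..<g}"
  then show "openin (top_of_set (\<Union>i<g. ball (hole_center i) (3/2))) (ball (hole_center i) (3/2))"
    by (intro open_subset) auto
  show "trivial_group (homology_group p (top_of_set (ball (hole_center i) (3/2))))"
    by (rule trivial_homology_group_convex[OF convex_ball assms])
qed (rule hole_balls_disjoint)

text \<open>Both the closed and the open domain are a convex disc minus holes, so one excision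
  serves for both. The convex disc has no homology of its own, and all of \<open>H\<^sub>1\<close>
  comes from the bands around the holes; the outer boundary adds no generator.\<close>

lemma iso_hom_induced_hole_bands:
  assumes B: "convex B" "ball 0 (4 * real g + 3) \<subseteq> B" and E: "E \<subseteq> (\<Union>i<g. cball (hole_center i) 1)"
  shows "hom_induced 1 (top_of_set ((\<Union>i<g. ball (hole_center i) (3/2)) - E)) {} (top_of_set (B - E)) {} id
     \<in> iso (homology_group 1 (top_of_set ((\<Union>i<g. ball (hole_center i) (3/2)) - E))) (homology_group 1 (top_of_set (B - E)))"
proof (rule iso_hom_induced_excision_H1[OF _ _ _ E])
  show "(\<Union>i<g. ball (hole_center i) (3/2)) \<subseteq> B" using hole_ball_subset B(2) by blast
  show "(\<Union>i<g. cball (hole_center i) 1) \<subseteq> (\<Union>i<g. ball (hole_center i) (3/2))" by auto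
qed (auto intro!: trivial_homology_group_hole_balls trivial_homology_group_convex[OF B(1)] closed_UN)

lemma hole_balls_Diff:
  "(\<Union>i<g. ball (hole_center i) (3/2)) - (\<Union>i<g. ball (hole_center i) 1) = (\<Union>i<g. {z. norm (z - hole_center i) \<in> {1..<3/2}})"
  "(\<Union>i<g. ball (hole_center i) (3/2)) - (\<Union>i<g. cball (hole_center i) 1) = hole_collar g"
proof -
  have *: "norm (z - hole_center j) \<ge> 3/2" if "norm (z - hole_center i) < 3/2" "i \<noteq> j" for i j z
    using hole_band_disjoint[OF that(2), of z] that by fastforce
  have b: "(z \<in> ball (hole_center i) r) = (norm (z - hole_center i) < r)"
    "(z \<in> cball (hole_center i) r) = (norm (z - hole_center i) \<le> r)" for z i r
    by (auto simp: dist_norm norm_minus_commute)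
  show "(\<Union>i<g. ball (hole_center i) (3/2)) - (\<Union>i<g. ball (hole_center i) 1) = (\<Union>i<g. {z. norm (z - hole_center i) \<in> {1..<3/2}})"
  proof (intro equalityI subsetI)
    fix z assume "z \<in> (\<Union>i<g. {z. norm (z - hole_center i) \<in> {1..<3/2}})"
    then obtain i where i: "i < g" "1 \<le> norm (z - hole_center i)" "norm (z - hole_center i) < 3/2" by auto
    then have "norm (z - hole_center j) \<ge> 1" for j using *[of z i j] by (cases "i = j") auto
    with i show "z \<in> (\<Union>i<g. ball (hole_center i) (3/2)) - (\<Union>i<g. ball (hole_center i) 1)"
      unfolding Diff_iff UN_iff b by (metis lessThan_iff not_less)
  qed (unfold b Diff_iff UN_iff, force simp: not_less b)
  show "(\<Union>i<g. ball (hole_center i) (3/2)) - (\<Union>i<g. cball (hole_center i) 1) = hole_collar g"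
    unfolding hole_collar_def
  proof (intro equalityI subsetI)
    fix z assume "z \<in> (\<Union>i<g. {z. norm (z - hole_center i) \<in> {1<..<3/2}})"
    then obtain i where i: "i < g" "1 < norm (z - hole_center i)" "norm (z - hole_center i) < 3/2" by auto
    then have "norm (z - hole_center j) > 1" for j using *[of z i j] by (cases "i = j") auto
    with i show "z \<in> (\<Union>i<g. ball (hole_center i) (3/2)) - (\<Union>i<g. cball (hole_center i) 1)"
      unfolding Diff_iff UN_iff b by (metis lessThan_iff not_le)
  qed (unfold b Diff_iff UN_iff, force simp: not_le b)
qed

lemma homology_group_1_planar_closed:
  "homology_group 1 (top_of_set (planar_closed g)) \<cong> free_Abelian_group {..<g}"
proof -
  have "homology_group 1 (top_of_set (\<Union>i<g. {z. norm (z - hole_center i) \<in> {1..<3/2}})) \<cong> homology_group 1 (top_of_set (planar_closed g))"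
  proof (rule is_isoI)
    have "ball (0::complex) (4 * real g + 3) \<subseteq> cball 0 (4 * real g + 4)"
      "(\<Union>i<g. ball (hole_center i) 1) \<subseteq> (\<Union>i<g. cball (hole_center i) 1)" by force+
    from iso_hom_induced_hole_bands[OF convex_cball this, unfolded hole_balls_Diff, folded planar_closed_def]
    show "hom_induced 1 (top_of_set (\<Union>i<g. {z. norm (z - hole_center i) \<in> {1..<3/2}})) {} (top_of_set (planar_closed g)) {} id
      \<in> iso (homology_group 1 (top_of_set (\<Union>i<g. {z. norm (z - hole_center i) \<in> {1..<3/2}}))) (homology_group 1 (top_of_set (planar_closed g)))" .
  qed
  moreover have "homology_group 1 (top_of_set (\<Union>i<g. {z. norm (z - hole_center i) \<in> {1..<3/2}})) \<cong> free_Abelian_group {..<g}"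
    by (rule homology_group_1_hole_bands[of _ 1]) auto
  ultimately show ?thesis by (meson group.iso_sym group_relative_homology_group iso_trans)
qed

lemma hole_center_band_connected:
  "connected (ball (hole_center i) (3/2) - ball (hole_center i) 1)"
  "connected (ball (hole_center i) (3/2) - cball (hole_center i) 1)"
proof -
  have e: "ball (hole_center i) (3/2) - ball (hole_center i) 1 = {z. norm (z - hole_center i) \<in> {1..<3/2}}"
    "ball (hole_center i) (3/2) - cball (hole_center i) 1 = {z. norm (z - hole_center i) \<in> {1<..<3/2}}"
    by (auto simp: dist_norm norm_minus_commute)
  show "connected (ball (hole_center i) (3/2) - ball (hole_center i) 1)"
    unfolding e by (rule path_connected_imp_connected[OF path_connected_norm_band]) auto
  show "connected (ball (hole_center i) (3/2) - cball (hole_center i) 1)"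
    unfolding e by (rule path_connected_imp_connected[OF path_connected_norm_band]) auto
qed

lemma connected_planar_closed: "connected (planar_closed g)"
  unfolding planar_closed_def
proof (rule connected_Diff_UN_ball_subset[where c=hole_center and r="3/2" and s=1])
  show "ball (hole_center i) (3/2) \<subseteq> cball 0 (4 * real g + 4)" if "i \<in> {..<g}" for i
    using hole_ball_subset[of i g] that by force
qed (use hole_balls_disjoint hole_center_band_connected in auto)

lemma path_connected_planar_open: "path_connected (planar_open g)"
proof -
  have "connected (planar_open g)"
    unfolding planar_open_def
  proof (rule connected_Diff_UN_ball_subset[where c=hole_center and r="3/2" and s=1])
    show "ball (hole_center i) (3/2) \<subseteq> ball 0 (4 * real g + 4)" if "i \<in> {..<g}" for i
      using hole_ball_subset[of i g] that by force
  qed (use hole_balls_disjoint hole_center_band_connected in auto)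
  moreover have "open (planar_open g)" unfolding planar_open_def by (intro open_Diff closed_UN) auto
  ultimately show ?thesis by (simp add: connected_open_path_connected)
qed

lemma rim_collar_subset: "rim_collar g \<subseteq> planar_open g"
proof
  fix z assume z: "z \<in> rim_collar g"
  have "z \<notin> cball (hole_center i) 1" if "i < g" for i
  proof
    assume "z \<in> cball (hole_center i) 1"
    then have "z \<in> ball (hole_center i) (3/2)" by simp
    then have "z \<in> ball 0 (4 * real g + 3)" using hole_ball_subset[OF that] by blast
    with z show False by (simp add: rim_collar_def)
  qed
  with z show "z \<in> planar_open g" by (auto simp: rim_collar_def planar_open_def)
qed

lemma hole_collar_subset: "hole_collar g \<subseteq> planar_open g"
proof
  fix z assume z: "z \<in> hole_collar g"
  then obtain i where "i < g" "z \<in> ball (hole_center i) (3/2)" and n: "z \<notin> (\<Union>i<g. cball (hole_center i) 1)"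
    unfolding hole_balls_Diff(2)[symmetric] by blast
  then have "z \<in> ball 0 (4 * real g + 3)" using hole_ball_subset by blast
  with n show "z \<in> planar_open g" unfolding planar_open_def by simp
qed

lemma hole_rim_disjoint: "hole_collar g \<inter> rim_collar g = {}"
proof -
  have "norm z < 4 * real g + 3" if z: "z \<in> hole_collar g" for z
  proof -
    obtain i where "i < g" "z \<in> ball (hole_center i) (3/2)"
      using z unfolding hole_balls_Diff(2)[symmetric] by blast
    then have "z \<in> ball 0 (4 * real g + 3)" using hole_ball_subset by blast
    then show ?thesis by simp
  qed
  then show ?thesis by (force simp: rim_collar_def)
qed

text \<open>As \<open>H\<^sub>1\<close> of the collars maps onto \<open>H\<^sub>1\<close> of the domain, the relative group is the kernel of
  \<open>H\<^sub>0\<close> of the collars \<open>\<rightarrow>\<close> \<open>H\<^sub>0\<close> of the domain, and the rim collar identifies this kernel with \<open>H\<^sub>0\<close> of the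
  hole collars.\<close>

lemma relative_homology_group_planar_open:
  "relative_homology_group 1 (top_of_set (planar_open g)) (hole_collar g \<union> rim_collar g) \<cong> free_Abelian_group {..<g}"
proof -
  let ?Y = "top_of_set (planar_open g)" and ?O = "hole_collar g \<union> rim_collar g"
  let ?W = "top_of_set ?O" and ?A = "hole_collar g" and ?R = "rim_collar g"
  have W: "subtopology ?Y ?O = ?W"
    using rim_collar_subset hole_collar_subset by (simp add: subtopology_subtopology Int_absorb1)
  have "of_real (4 * real g + 7/2) \<in> ?R" by (simp add: rim_collar_def del: of_real_add of_real_mult)
  then have Rne: "?R \<noteq> {}" by blast
  have redY: "trivial_group (reduced_homology_group 0 ?Y)"
    using path_connected_planar_open Rne rim_collar_subset[of g]
    by (intro trivial_reduced_homology_group_0_path_connected[of _ "of_real (4 * real g + 7/2)"])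
       (use \<open>_ \<in> ?R\<close> in \<open>auto simp: path_connected_space_top_of_set\<close>)
  have onto: "hom_induced 1 ?W {} ?Y {} id ` carrier (homology_group 1 ?W) = carrier (homology_group 1 ?Y)"
  proof
    show "hom_induced 1 ?W {} ?Y {} id ` carrier (homology_group 1 ?W) \<subseteq> carrier (homology_group 1 ?Y)"
      by (auto simp: hom_induced_carrier)
    \<comment> \<open>The hole collars alone already give an isomorphism on
      \<open>H\<^sub>1\<close>. Their inclusion factors through the union with the rim collar, which
      is therefore onto as well.\<close>
    have "hom_induced 1 (top_of_set ?A) {} ?Y {} id \<in> iso (homology_group 1 (top_of_set ?A)) (homology_group 1 ?Y)"
    proof -
      have "ball (0::complex) (4 * real g + 3) \<subseteq> ball 0 (4 * real g + 4)" by force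
      from iso_hom_induced_hole_bands[OF convex_ball this order_refl, unfolded hole_balls_Diff, folded planar_open_def]
      show ?thesis .
    qed
    from iso_image_carrier[OF this]
    have im: "carrier (homology_group 1 ?Y) = hom_induced 1 (top_of_set ?A) {} ?Y {} id ` carrier (homology_group 1 (top_of_set ?A))"
      by simp
    have "hom_induced 1 (top_of_set ?A) {} ?Y {} (id \<circ> id) = hom_induced 1 ?W {} ?Y {} id \<circ> hom_induced 1 (top_of_set ?A) {} ?W {} id"
      by (rule hom_induced_compose_empty) (use rim_collar_subset[of g] hole_collar_subset[of g] in auto)
    then show "carrier (homology_group 1 ?Y) \<subseteq> hom_induced 1 ?W {} ?Y {} id ` carrier (homology_group 1 ?W)"
      unfolding im by (auto simp: hom_induced_carrier)
  qed
  have triv: "hom_induced 1 ?Y {} ?Y ?O id x = \<one>\<^bsub>relative_homology_group 1 ?Y ?O\<^esub>" if "x \<in> carrier (homology_group 1 ?Y)" for x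
    using homology_exactness_axiom_3[of 1 ?Y ?O] that onto by (auto simp: W kernel_def)
  have k: "kernel (relative_homology_group 1 ?Y ?O) (homology_group 0 ?W) (hom_boundary 1 ?Y ?O) = {\<one>\<^bsub>relative_homology_group 1 ?Y ?O\<^esub>}"
  proof -
    have "kernel (relative_homology_group 1 ?Y ?O) (homology_group 0 ?W) (hom_boundary 1 ?Y ?O)
       = hom_induced 1 ?Y {} ?Y ?O id ` carrier (homology_group 1 ?Y)"
      using homology_exactness_axiom_1[of 1 ?Y ?O] by (simp add: W)
    moreover have "carrier (homology_group 1 ?Y) \<noteq> {}"
      by (metis empty_iff group.is_monoid group_relative_homology_group monoid.one_closed)
    ultimately show ?thesis using triv by (auto simp: image_iff) 
  qed
  interpret bd: group_hom "relative_homology_group 1 ?Y ?O" "homology_group 0 ?W" "hom_boundary 1 ?Y ?O"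
    using hom_boundary_hom[of 1 ?Y ?O] by (simp add: W group_hom_def group_hom_axioms_def)
  have "inj_on (hom_boundary 1 ?Y ?O) (carrier (relative_homology_group 1 ?Y ?O))"
    using bd.inj_iff_trivial_ker k by blast
  \<comment> \<open>By exactness the image of the boundary is the kernel of the map to the reduced
    \<open>H\<^sub>0\<close> of the domain. The domain is path connected, so that group is trivial
    and the image is everything.\<close>
  moreover have "hom_boundary 1 ?Y ?O ` carrier (relative_homology_group 1 ?Y ?O) = carrier (reduced_homology_group 0 ?W)"
  proof -
    have e: "kernel (reduced_homology_group 0 ?W) (reduced_homology_group 0 ?Y) (hom_induced 0 ?W {} ?Y {} id)
       = hom_boundary 1 ?Y ?O ` carrier (relative_homology_group 1 ?Y ?O)"
      using homology_exactness_reduced_2[of 1 ?Y ?O] by (simp add: W)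
    have "hom_induced 0 ?W {} ?Y {} id x = \<one>\<^bsub>reduced_homology_group 0 ?Y\<^esub>" if "x \<in> carrier (reduced_homology_group 0 ?W)" for x
      using hom_induced_reduced[OF that, of ?Y id] redY by (simp add: trivial_group_def)
    then show ?thesis unfolding e[symmetric] by (auto simp: kernel_def)
  qed
  moreover have "hom_boundary 1 ?Y ?O \<in> hom (relative_homology_group 1 ?Y ?O) (reduced_homology_group 0 ?W)"
    using hom_boundary_reduced_hom[of 1 ?Y ?O] by (simp add: W)
  ultimately have 1: "relative_homology_group 1 ?Y ?O \<cong> reduced_homology_group 0 ?W"
    by (intro is_isoI[of "hom_boundary 1 ?Y ?O"]) (simp add: iso_def bij_betw_def)
  have sR: "subtopology ?W ?R = top_of_set ?R" and sA: "subtopology ?W ?A = top_of_set ?A"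
    by (simp_all add: subtopology_subtopology Int_absorb1)
  have redR: "trivial_group (reduced_homology_group 0 (top_of_set ?R))"
  proof -
    have "path_connected ?R" unfolding rim_collar_def by (rule path_connected_norm_band) auto
    then show ?thesis
      using Rne trivial_reduced_homology_group_0_path_connected[of "top_of_set ?R"]
      by (auto simp: path_connected_space_top_of_set)
  qed
  \<comment> \<open>The rim collar is nonempty and path connected, so its reduced
    \<open>H\<^sub>0\<close> vanishes and passing to the pair loses nothing.\<close>
  have "hom_induced 0 ?W {} ?W ?R id \<in> iso (reduced_homology_group 0 ?W) (relative_homology_group 0 ?W ?R)"
  proof (rule very_short_exact_sequence)
    show "exact_seq ([reduced_homology_group (-1) (top_of_set ?R), relative_homology_group 0 ?W ?R, reduced_homology_group 0 ?W, reduced_homology_group 0 (top_of_set ?R)],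
       [hom_boundary 0 ?W ?R, hom_induced 0 ?W {} ?W ?R id, hom_induced 0 (top_of_set ?R) {} ?W {} id])"
      using homology_exactness_reduced_1[of ?W ?R 0] Rne homology_exactness_reduced_3[of 0 ?W ?R] by (simp add: sR)
  qed (use redR trivial_reduced_homology_group[of "-1"] in auto)
  then have 2: "reduced_homology_group 0 ?W \<cong> relative_homology_group 0 ?W ?R" by (rule is_isoI)
  have opR: "openin ?W ?R" and opA: "openin ?W ?A"
  proof -
    have "open ?R" "open ?A" unfolding rim_collar_def hole_collar_def
      by (auto intro!: open_UN open_Collect_conj open_Collect_less continuous_intros)
    then show "openin ?W ?R" "openin ?W ?A" by (auto intro: open_subset)
  qed
  have OR: "?O - ?R = ?A" using hole_rim_disjoint[of g] by blast
  \<comment> \<open>The rim collar is open and closed in the union of the collars, so it may be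
    excised from itself. What is left is the absolute homology of the hole collars.\<close>
  have "?W closure_of ?R \<subseteq> ?W interior_of ?R"
  proof -
    have "closedin ?W ?R" using opA hole_rim_disjoint[of g] by (auto simp: closedin_def Un_Diff OR)
      (metis Diff_triv Un_Diff_cancel2 Un_Diff OR sup_commute)
    then show ?thesis using opR by (simp add: closure_of_closedin interior_of_openin)
  qed
  from homology_excision_axiom[OF this, of ?O 0, THEN is_isoI]
  have "homology_group 0 (top_of_set ?A) \<cong> relative_homology_group 0 ?W ?R"
    by (simp add: OR sA subtopology_subtopology)
  then show ?thesis
    using 1 2 homology_group_0_hole_collar
    by (meson group.iso_sym group_relative_homology_group iso_trans)
qed

text \<open>Addition of finitely supported functions is the isomorphism. It is injective because a
  function supported in both \<open>A\<close> and \<open>B\<close> vanishes; that every element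
  splits is checked on generators and differences.\<close>

lemma DirProd_free_Abelian_group:
  assumes "A \<inter> B = {}"
  shows "free_Abelian_group A \<times>\<times> free_Abelian_group B \<cong> free_Abelian_group (A \<union> B)"
proof -
  let ?f = "\<lambda>(x, y). x + y"
  have "?f \<in> hom (free_Abelian_group A \<times>\<times> free_Abelian_group B) (free_Abelian_group (A \<union> B))"
    by (auto simp: hom_def DirProd_def algebra_simps dest!: keys_add[THEN subsetD])
  moreover have "inj_on ?f (carrier (free_Abelian_group A \<times>\<times> free_Abelian_group B))"
  proof (rule inj_onI, clarsimp simp: DirProd_def)
    fix a b c d :: "'a \<Rightarrow>\<^sub>0 int"
    assume k: "Poly_Mapping.keys a \<subseteq> A" "Poly_Mapping.keys b \<subseteq> B" "Poly_Mapping.keys c \<subseteq> A" "Poly_Mapping.keys d \<subseteq> B"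
      and eq: "a + b = c + d"
    then have e: "a - c = d - b" by (simp add: algebra_simps)
    have "Poly_Mapping.keys (a - c) \<subseteq> A" "Poly_Mapping.keys (d - b) \<subseteq> B"
      using k keys_diff[of a c] keys_diff[of d b] by blast+
    then have "Poly_Mapping.keys (a - c) = {}" by (metis Int_subset_iff assms e subset_empty)
    then have "a - c = 0" by simp
    then show "a = c \<and> b = d" using eq by simp
  qed
  moreover have "?f ` carrier (free_Abelian_group A \<times>\<times> free_Abelian_group B) = carrier (free_Abelian_group (A \<union> B))"
  proof (intro equalityI subsetI)
    fix z assume "z \<in> ?f ` carrier (free_Abelian_group A \<times>\<times> free_Abelian_group B)"
    then obtain x y where xy: "z = x + y" "Poly_Mapping.keys x \<subseteq> A" "Poly_Mapping.keys y \<subseteq> B"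
      by (auto simp: DirProd_def)
    then have "Poly_Mapping.keys z \<subseteq> A \<union> B" using keys_add[of x y] by blast
    then show "z \<in> carrier (free_Abelian_group (A \<union> B))" by simp
  next
    fix z assume "z \<in> carrier (free_Abelian_group (A \<union> B))"
    then have "Poly_Mapping.keys z \<subseteq> A \<union> B" by simp
    then have "\<exists>x y. Poly_Mapping.keys x \<subseteq> A \<and> Poly_Mapping.keys y \<subseteq> B \<and> z = x + y"
    proof (rule free_Abelian_group_induct)
      fix a assume "a \<in> A \<union> B"
      then show "\<exists>x y. Poly_Mapping.keys x \<subseteq> A \<and> Poly_Mapping.keys y \<subseteq> B \<and> frag_of a = x + y"
      proof
        assume "a \<in> A"
        then show ?thesis by (intro exI[of _ "frag_of a"] exI[of _ 0]) auto
      next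
        assume "a \<in> B"
        then show ?thesis by (intro exI[of _ 0] exI[of _ "frag_of a"]) auto
      qed
    next
      fix x y :: "'a \<Rightarrow>\<^sub>0 int"
      assume "\<exists>a b. Poly_Mapping.keys a \<subseteq> A \<and> Poly_Mapping.keys b \<subseteq> B \<and> x = a + b"
        and "\<exists>a b. Poly_Mapping.keys a \<subseteq> A \<and> Poly_Mapping.keys b \<subseteq> B \<and> y = a + b"
      then obtain a b c d where "Poly_Mapping.keys a \<subseteq> A" "Poly_Mapping.keys b \<subseteq> B" "x = a + b"
        "Poly_Mapping.keys c \<subseteq> A" "Poly_Mapping.keys d \<subseteq> B" "y = c + d" by blast
      then show "\<exists>a b. Poly_Mapping.keys a \<subseteq> A \<and> Poly_Mapping.keys b \<subseteq> B \<and> x - y = a + b"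
        using keys_diff[of a c] keys_diff[of b d]
        by (intro exI[of _ "a - c"] exI[of _ "b - d"]) auto
    qed (auto intro!: exI[of _ 0])
    then show "z \<in> ?f ` carrier (free_Abelian_group A \<times>\<times> free_Abelian_group B)"
      by (force simp: DirProd_def)
  qed
  ultimately show ?thesis
    by (intro is_isoI[of ?f]) (simp add: iso_def bij_betw_def)
qed


section \<open>Homology of the doubled domain\<close>

definition vec3 :: "real \<Rightarrow> real \<Rightarrow> real \<Rightarrow> real^3" where
  "vec3 a b c = (\<chi> i. if i = 1 then a else if i = 2 then b else c)"

lemma vec3_nth [simp]: "vec3 a b c $ 1 = a" "vec3 a b c $ 2 = b" "vec3 a b c $ 3 = c"
  by (auto simp: vec3_def)

lemma vec3_eq_iff: "q = vec3 a b c \<longleftrightarrow> q $ 1 = a \<and> q $ 2 = b \<and> q $ 3 = c"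
  by (auto simp: vec_eq_iff forall_3)

lemma continuous_on_vec3:
  assumes "continuous_on S f" "continuous_on S g" "continuous_on S h"
  shows "continuous_on S (\<lambda>x. vec3 (f x) (g x) (h x))"
  unfolding vec3_def
proof (rule continuous_on_vec_lambda)
  fix i :: 3
  show "continuous_on S (\<lambda>x. if i = 1 then f x else if i = 2 then g x else h x)"
    using assms by (cases "i = 1"; cases "i = 2") auto
qed

definition shadow :: "real^3 \<Rightarrow> complex" where
  "shadow q = Complex (q $ 1) (q $ 2)"

text \<open>Written as the zero set of a difference, so that the results on regular level sets
  apply. The projection \<open>shadow\<close> is two-to-one where \<psi> is positive and folds along
  the zero set of \<psi>.\<close>

definition double_graph :: "(complex \<Rightarrow> real) \<Rightarrow> (real^3) set" where
  "double_graph \<psi> = {q. (q $ 3)\<^sup>2 - \<psi> (shadow q) = 0}"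

definition planar_poly :: "nat \<Rightarrow> complex \<Rightarrow> real" where
  "planar_poly g z = ((4 * real g + 4)\<^sup>2 - (norm z)\<^sup>2) * (\<Prod>i<g. (norm (z - hole_center i))\<^sup>2 - 1)"

text \<open>The set deliberately extends beyond the outer circle and over the full holes. This makes
  it open in the plane, and its preimage open in the surface; only its part over the domain is ever
  occupied.\<close>

definition boundary_collar :: "nat \<Rightarrow> complex set" where
  "boundary_collar g = {z. 4 * real g + 3 < norm z} \<union> (\<Union>i<g. ball (hole_center i) (3/2))"

lemma mem_hole_ball: "z \<in> ball (hole_center i) r \<longleftrightarrow> norm (z - hole_center i) < r"
  "z \<in> cball (hole_center i) r \<longleftrightarrow> norm (z - hole_center i) \<le> r"
  by (auto simp: dist_norm norm_minus_commute)

text \<open>Within distance \<open>3/2\<close> of one hole centre all other factors of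
  \<open>planar_poly\<close> are positive, so the sign of the polynomial and membership in the
  domain depend on that hole alone. The companion lemma below treats the points away from all holes,
  where only the outer circle counts.\<close>

lemma near_hole:
  assumes "i < g" "norm (z - hole_center i) < 3/2"
  shows "norm z < 4 * real g + 3" "j \<noteq> i \<Longrightarrow> norm (z - hole_center j) \<ge> 3/2"
    "z \<in> planar_closed g \<longleftrightarrow> norm (z - hole_center i) \<ge> 1"
    "z \<in> planar_open g \<longleftrightarrow> norm (z - hole_center i) > 1"
    "\<exists>c>0. planar_poly g z = c * ((norm (z - hole_center i))\<^sup>2 - 1)"
proof -
  show nz: "norm z < 4 * real g + 3" using hole_ball_subset[OF assms(1)] assms(2) mem_hole_ball(1)[of z i "3/2"] by auto
  show far: "norm (z - hole_center j) \<ge> 3/2" if "j \<noteq> i" for j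
    using hole_band_disjoint[OF that _ assms(2)] by fastforce
  have far1: "norm (z - hole_center j) > 1" if "j \<noteq> i" for j using far[OF that] by simp
  show "z \<in> planar_closed g \<longleftrightarrow> norm (z - hole_center i) \<ge> 1"
  proof
    assume "norm (z - hole_center i) \<ge> 1"
    then have "norm (z - hole_center j) \<ge> 1" for j using far1[of j] by (cases "j = i") auto
    then show "z \<in> planar_closed g" using nz unfolding planar_closed_def by (auto simp: mem_hole_ball not_less simp del: mem_ball)
  qed (use assms in \<open>auto simp: planar_closed_def mem_hole_ball not_less simp del: mem_ball\<close>)
  show "z \<in> planar_open g \<longleftrightarrow> norm (z - hole_center i) > 1"
  proof
    assume "norm (z - hole_center i) > 1"
    then have "norm (z - hole_center j) > 1" for j using far1[of j] by (cases "j = i") auto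
    then show "z \<in> planar_open g" using nz unfolding planar_open_def by (force simp: mem_hole_ball not_le simp del: mem_cball)
  qed (use assms in \<open>auto simp: planar_open_def mem_hole_ball not_le simp del: mem_cball\<close>)
  have "(\<Prod>j<g. (norm (z - hole_center j))\<^sup>2 - 1)
      = ((norm (z - hole_center i))\<^sup>2 - 1) * (\<Prod>j\<in>{..<g} - {i}. (norm (z - hole_center j))\<^sup>2 - 1)"
    using assms(1) by (subst prod.remove[of _ i]) auto
  moreover have "(\<Prod>j\<in>{..<g} - {i}. (norm (z - hole_center j))\<^sup>2 - 1) > 0"
  proof (rule prod_pos)
    fix j assume "j \<in> {..<g} - {i}"
    then have "norm (z - hole_center j) > 1" using far1 by auto
    then show "(norm (z - hole_center j))\<^sup>2 - 1 > 0" by (simp add: one_less_power)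
  qed
  moreover have "(4 * real g + 4)\<^sup>2 - (norm z)\<^sup>2 > 0"
  proof -
    have "(norm z)\<^sup>2 < (4 * real g + 4)\<^sup>2" using nz by (intro power_strict_mono) auto
    then show ?thesis by simp
  qed
  ultimately show "\<exists>c>0. planar_poly g z = c * ((norm (z - hole_center i))\<^sup>2 - 1)"
    unfolding planar_poly_def
    by (intro exI[of _ "((4 * real g + 4)\<^sup>2 - (norm z)\<^sup>2) * (\<Prod>j\<in>{..<g} - {i}. (norm (z - hole_center j))\<^sup>2 - 1)"]) auto
qed

lemma far_from_holes:
  assumes "\<And>i. i < g \<Longrightarrow> norm (z - hole_center i) \<ge> 3/2"
  shows "z \<in> planar_closed g \<longleftrightarrow> norm z \<le> 4 * real g + 4"
    "z \<in> planar_open g \<longleftrightarrow> norm z < 4 * real g + 4"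
    "\<exists>c>0. planar_poly g z = c * ((4 * real g + 4)\<^sup>2 - (norm z)\<^sup>2)"
proof -
  have f: "norm (z - hole_center i) > 1" if "i < g" for i using assms[OF that] by simp
  show "z \<in> planar_closed g \<longleftrightarrow> norm z \<le> 4 * real g + 4"
    using f by (force simp: planar_closed_def mem_hole_ball simp del: mem_ball)
  show "z \<in> planar_open g \<longleftrightarrow> norm z < 4 * real g + 4"
    using f by (force simp: planar_open_def mem_hole_ball simp del: mem_cball)
  have "(\<Prod>i<g. (norm (z - hole_center i))\<^sup>2 - 1) > 0"
  proof (rule prod_pos)
    fix j assume "j \<in> {..<g}"
    then have "norm (z - hole_center j) > 1" using f by auto
    then show "(norm (z - hole_center j))\<^sup>2 - 1 > 0" by (simp add: one_less_power)
  qed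
  then show "\<exists>c>0. planar_poly g z = c * ((4 * real g + 4)\<^sup>2 - (norm z)\<^sup>2)"
    unfolding planar_poly_def by (metis mult.commute)
qed

lemma planar_poly_sign:
  "planar_poly g z \<ge> 0 \<longleftrightarrow> z \<in> planar_closed g" "planar_poly g z > 0 \<longleftrightarrow> z \<in> planar_open g"
proof -
  have sq: "x\<^sup>2 - 1 \<ge> 0 \<longleftrightarrow> 1 \<le> x" "x\<^sup>2 - 1 > 0 \<longleftrightarrow> 1 < x" if "x \<ge> 0" for x :: real
    using that abs_le_square_iff[of 1 x] abs_square_le_1[of x] by (auto simp: not_le[symmetric] abs_if)
  have sq2: "r\<^sup>2 - x\<^sup>2 \<ge> 0 \<longleftrightarrow> x \<le> r" "r\<^sup>2 - x\<^sup>2 > 0 \<longleftrightarrow> x < r" if "x \<ge> 0" "r \<ge> 0" for x r :: real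
    using that abs_le_square_iff[of x r] abs_le_square_iff[of r x] by (auto simp: not_le[symmetric])
  have pos: "0 \<le> c * a \<longleftrightarrow> 0 \<le> a" "0 < c * a \<longleftrightarrow> 0 < a" if "c > 0" for c a :: real
    using that by (auto simp: zero_le_mult_iff zero_less_mult_iff)
  have "(planar_poly g z \<ge> 0 \<longleftrightarrow> z \<in> planar_closed g) \<and> (planar_poly g z > 0 \<longleftrightarrow> z \<in> planar_open g)"
  proof (cases "\<exists>i<g. norm (z - hole_center i) < 3/2")
    case True
    then obtain i where i: "i < g" "norm (z - hole_center i) < 3/2" by blast
    obtain c where "c > 0" "planar_poly g z = c * ((norm (z - hole_center i))\<^sup>2 - 1)"
      using near_hole(5)[OF i] by blast
    then show ?thesis
      unfolding near_hole(3,4)[OF i] using pos[of c] sq[of "norm (z - hole_center i)"] by simp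
  next
    case False
    then have f: "\<And>i. i < g \<Longrightarrow> norm (z - hole_center i) \<ge> 3/2" by force
    obtain c where "c > 0" "planar_poly g z = c * ((4 * real g + 4)\<^sup>2 - (norm z)\<^sup>2)"
      using far_from_holes(3)[OF f] by blast
    then show ?thesis
      using far_from_holes(1)[OF f] far_from_holes(2)[OF f] pos[of c] sq2[of "norm z" "4 * real g + 4"] by simp
  qed
  then show "planar_poly g z \<ge> 0 \<longleftrightarrow> z \<in> planar_closed g" "planar_poly g z > 0 \<longleftrightarrow> z \<in> planar_open g" by auto
qed

lemma planar_poly_eq_0:
  "planar_poly g z = 0 \<longleftrightarrow> norm z = 4 * real g + 4 \<or> (\<exists>i<g. norm (z - hole_center i) = 1)"
proof -
  have "x\<^sup>2 = r\<^sup>2 \<longleftrightarrow> x = r" if "x \<ge> 0" "r \<ge> 0" for x r :: real using that by (simp add: power2_eq_iff_nonneg)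
  from this[of _ 1] this[of "norm z" "4 * real g + 4"] show ?thesis
    unfolding planar_poly_def by (auto simp: prod_zero_iff)
qed

lemma planar_open_collar: "planar_open g \<inter> boundary_collar g = hole_collar g \<union> rim_collar g"
proof -
  have "z \<in> hole_collar g \<union> rim_collar g" if z: "z \<in> planar_open g" "z \<in> boundary_collar g" for z
    using z(2) unfolding boundary_collar_def
  proof
    assume "z \<in> {z. 4 * real g + 3 < norm z}"
    moreover have "norm z < 4 * real g + 4" using z(1) by (simp add: planar_open_def)
    ultimately show ?thesis by (simp add: rim_collar_def)
  next
    assume "z \<in> (\<Union>i<g. ball (hole_center i) (3/2))"
    then obtain i where i: "i < g" "norm (z - hole_center i) < 3/2" by (auto simp: mem_hole_ball simp del: mem_ball)
    with near_hole(4)[OF i] z(1) show ?thesis by (auto simp: hole_collar_def)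
  qed
  moreover have "hole_collar g \<subseteq> boundary_collar g" "rim_collar g \<subseteq> boundary_collar g"
    by (auto simp: hole_collar_def rim_collar_def boundary_collar_def mem_hole_ball simp del: mem_ball)
  ultimately show ?thesis using rim_collar_subset[of g] hole_collar_subset[of g] by blast
qed

text \<open>Radial projection of the collars to the boundary circles. The description operator is only meaningful
  within distance \<open>3/2\<close> of a hole, where the hole is unique.\<close>

definition boundary_push :: "nat \<Rightarrow> complex \<Rightarrow> complex" where
  "boundary_push g z = (if 4 * real g + 3 < norm z then ((4 * real g + 4) / norm z) *\<^sub>R z
     else let c = hole_center (SOME i. i < g \<and> norm (z - hole_center i) < 3/2) in c + (1 / norm (z - c)) *\<^sub>R (z - c))"

lemma boundary_push_hole:
  assumes i: "i < g" "norm (z - hole_center i) < 3/2"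
  shows "boundary_push g z = hole_center i + (1 / norm (z - hole_center i)) *\<^sub>R (z - hole_center i)"
proof -
  have "(SOME i. i < g \<and> norm (z - hole_center i) < 3/2) = i"
    using i near_hole(2)[OF i] by (intro some_equality) (auto simp: not_less[symmetric])
  then show ?thesis using near_hole(1)[OF i] by (simp add: boundary_push_def Let_def)
qed

lemma continuous_on_boundary_push: "continuous_on (boundary_collar g \<inter> planar_closed g) (boundary_push g)"
proof -
  have "continuous_on {z. 4 * real g + 3 < norm z} (boundary_push g)"
  proof (rule continuous_on_eq)
    show "continuous_on {z. 4 * real g + 3 < norm z} (\<lambda>z. ((4 * real g + 4) / norm z) *\<^sub>R z)"
      by (intro continuous_intros) auto
  qed (simp add: boundary_push_def)
  moreover have "continuous_on (\<Union>i<g. ball (hole_center i) (3/2) - {hole_center i}) (boundary_push g)"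
  proof (rule continuous_on_open_UN)
    fix i assume i: "i \<in> {..<g}"
    show "continuous_on (ball (hole_center i) (3/2) - {hole_center i}) (boundary_push g)"
    proof (rule continuous_on_eq)
      show "continuous_on (ball (hole_center i) (3/2) - {hole_center i}) (\<lambda>z. hole_center i + (1 / norm (z - hole_center i)) *\<^sub>R (z - hole_center i))"
        by (intro continuous_intros) auto
    qed (use i boundary_push_hole[of i g] in \<open>simp add: mem_hole_ball del: mem_ball\<close>)
  qed auto
  ultimately have "continuous_on ({z. 4 * real g + 3 < norm z} \<union> (\<Union>i<g. ball (hole_center i) (3/2) - {hole_center i})) (boundary_push g)"
    by (intro continuous_on_open_Un) (auto intro!: open_Collect_less continuous_intros)
  then show ?thesis
  proof (rule continuous_on_subset)
    show "boundary_collar g \<inter> planar_closed g \<subseteq> {z. 4 * real g + 3 < norm z} \<union> (\<Union>i<g. ball (hole_center i) (3/2) - {hole_center i})"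
    proof
      fix z assume z: "z \<in> boundary_collar g \<inter> planar_closed g"
      show "z \<in> {z. 4 * real g + 3 < norm z} \<union> (\<Union>i<g. ball (hole_center i) (3/2) - {hole_center i})"
      proof (cases "4 * real g + 3 < norm z")
        case False
        with z obtain i where i: "i < g" "norm (z - hole_center i) < 3/2"
          by (auto simp: boundary_collar_def mem_hole_ball simp del: mem_ball)
        then have "z \<noteq> hole_center i" using near_hole(3)[OF i] z by auto
        with i show ?thesis by (auto simp: mem_hole_ball simp del: mem_ball)
      qed simp
    qed
  qed
qed

text \<open>These are the properties of a strong deformation of the collar onto the boundary
  circles: the segment stays in the collar, ends on the zero set and is constant for boundary
  points. The distance from the relevant centre interpolates linearly along the segment.\<close>

lemma boundary_push_segment:
  assumes z: "z \<in> boundary_collar g" "z \<in> planar_closed g" and t: "0 \<le> t" "t \<le> 1"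
  defines "w \<equiv> (1 - t) *\<^sub>R z + t *\<^sub>R boundary_push g z"
  shows "w \<in> boundary_collar g" "w \<in> planar_closed g" "t = 1 \<Longrightarrow> planar_poly g w = 0"
    "planar_poly g z = 0 \<Longrightarrow> w = z"
proof -
  have "w \<in> boundary_collar g \<and> w \<in> planar_closed g \<and> (t = 1 \<longrightarrow> planar_poly g w = 0) \<and> (planar_poly g z = 0 \<longrightarrow> w = z)"
    using z(1)[unfolded boundary_collar_def]
  proof
    assume "z \<in> {z. 4 * real g + 3 < norm z}"
    then have n: "4 * real g + 3 < norm z" by simp
    have far: "\<And>i. i < g \<Longrightarrow> norm (x - hole_center i) \<ge> 3/2" if "4 * real g + 3 < norm x" for x
      using near_hole(1)[of _ g x] that by fastforce
    have nR: "norm z \<le> 4 * real g + 4" using far_from_holes(1)[OF far[OF n]] z(2) by simp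
    have n0: "norm z > 0" using n by linarith
    have w: "w = ((1 - t) + t * ((4 * real g + 4) / norm z)) *\<^sub>R z"
      unfolding w_def using n by (simp add: boundary_push_def scaleR_add_left)
    have nw: "norm w = (1 - t) * norm z + t * (4 * real g + 4)"
    proof -
      have "0 \<le> (1 - t) + t * ((4 * real g + 4) / norm z)" using t by simp
      then show ?thesis unfolding w norm_scaleR using n0 by (simp only: abs_of_nonneg) (simp add: field_simps)
    qed
    have "(1 - t) * (4 * real g + 3) \<le> (1 - t) * norm z" "(1 - t) * norm z \<le> (1 - t) * (4 * real g + 4)"
      using t n nR by (intro mult_left_mono; simp)+
    \<comment> \<open>The collar is open on its inner side, so a strict bound is needed: at
      \<open>t = 0\<close> it comes from \<open>z\<close>, for positive \<open>t\<close> from the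
      endpoint on the outer circle.\<close>
    moreover have "(1 - t) * (4 * real g + 3) < (1 - t) * norm z \<or> t > 0"
      using t n by (cases "t = 0") auto
    ultimately have b: "4 * real g + 3 < norm w" "norm w \<le> 4 * real g + 4"
      unfolding nw using t by (auto simp: algebra_simps)
    have "w = z" if "planar_poly g z = 0"
    proof -
      have "norm z = 4 * real g + 4"
        using that far[OF n] unfolding planar_poly_eq_0 by force
      then show ?thesis unfolding w using n0 by simp
    qed
    moreover have "planar_poly g w = 0" if "t = 1" unfolding planar_poly_eq_0 nw using that by simp
    moreover have "w \<in> planar_closed g" using far_from_holes(1)[of g w] far[OF b(1)] b(2) by blast
    moreover have "w \<in> boundary_collar g" using b by (simp add: boundary_collar_def)
    ultimately show ?thesis by simp
  next
    assume "z \<in> (\<Union>i<g. ball (hole_center i) (3/2))"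
    then obtain i where i: "i < g" "norm (z - hole_center i) < 3/2" by (auto simp: mem_hole_ball simp del: mem_ball)
    have n1: "norm (z - hole_center i) \<ge> 1" using near_hole(3)[OF i] z(2) by simp
    then have n0: "norm (z - hole_center i) > 0" by linarith
    have w: "w - hole_center i = ((1 - t) + t * (1 / norm (z - hole_center i))) *\<^sub>R (z - hole_center i)"
      unfolding w_def boundary_push_hole[OF i] by (simp add: algebra_simps)
    have nw: "norm (w - hole_center i) = (1 - t) * norm (z - hole_center i) + t"
    proof -
      have "0 \<le> (1 - t) + t * (1 / norm (z - hole_center i))" using t by simp
      then show ?thesis unfolding w norm_scaleR using n0 by (simp only: abs_of_nonneg) (simp add: field_simps)
    qed
    have "(1 - t) * 1 \<le> (1 - t) * norm (z - hole_center i)" "(1 - t) * norm (z - hole_center i) \<le> (1 - t) * (3/2)"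
      using t n1 i by (intro mult_left_mono; simp)+
    moreover have "(1 - t) * norm (z - hole_center i) < (1 - t) * (3/2) \<or> t > 0"
      using t i by (cases "t = 0") auto
    ultimately have b: "1 \<le> norm (w - hole_center i)" "norm (w - hole_center i) < 3/2"
      unfolding nw using t by (auto simp: algebra_simps)
    have "w = z" if "planar_poly g z = 0"
    proof -
      have "norm (z - hole_center i) = 1"
        using that near_hole(1,2)[OF i] unfolding planar_poly_eq_0 by force
      then show ?thesis using w by simp
    qed
    moreover have "planar_poly g w = 0" if "t = 1" unfolding planar_poly_eq_0 using nw that i by auto
    moreover have "w \<in> planar_closed g" using near_hole(3)[OF i(1) b(2)] b(1) by simp
    moreover have "w \<in> boundary_collar g"
      using b i by (auto simp: boundary_collar_def mem_hole_ball simp del: mem_ball)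
    ultimately show ?thesis by simp
  qed
  then show "w \<in> boundary_collar g" "w \<in> planar_closed g" "t = 1 \<Longrightarrow> planar_poly g w = 0"
    "planar_poly g z = 0 \<Longrightarrow> w = z" by auto
qed

section \<open>The two sheets of the double\<close>

definition lift_graph :: "(complex \<Rightarrow> real) \<Rightarrow> real \<Rightarrow> complex \<Rightarrow> real^3" where
  "lift_graph \<psi> s z = vec3 (Re z) (Im z) (s * sqrt (\<psi> z))"

lemma shadow_lift_graph [simp]: "shadow (lift_graph \<psi> s z) = z"
  by (simp add: shadow_def lift_graph_def)

lemma continuous_on_shadow: "continuous_on S shadow"
  unfolding shadow_def Complex_eq by (intro continuous_intros)

lemma continuous_on_lift_graph:
  "continuous_on (f ` S) \<psi> \<Longrightarrow> continuous_on S f \<Longrightarrow> continuous_on S (\<lambda>x. lift_graph \<psi> s (f x))"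
  unfolding lift_graph_def
  by (intro continuous_on_vec3 continuous_intros continuous_on_compose2[of "f ` S" \<psi> S f]) auto

lemma lift_graph_mem: "\<psi> z \<ge> 0 \<Longrightarrow> s\<^sup>2 = 1 \<Longrightarrow> lift_graph \<psi> s z \<in> double_graph \<psi>"
  by (simp add: double_graph_def) (simp add: lift_graph_def power_mult_distrib)

lemma double_graphD:
  assumes "q \<in> double_graph \<psi>"
  shows "\<psi> (shadow q) \<ge> 0" "q $ 3 \<ge> 0 \<Longrightarrow> lift_graph \<psi> 1 (shadow q) = q" "q $ 3 \<le> 0 \<Longrightarrow> lift_graph \<psi> (-1) (shadow q) = q"
    "q $ 3 = 0 \<longleftrightarrow> \<psi> (shadow q) = 0"
proof -
  have e: "\<psi> (shadow q) = (q $ 3)\<^sup>2" using assms by (simp add: double_graph_def)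
  show "\<psi> (shadow q) \<ge> 0" "q $ 3 = 0 \<longleftrightarrow> \<psi> (shadow q) = 0" by (simp_all add: e)
  show "lift_graph \<psi> 1 (shadow q) = q" if "q $ 3 \<ge> 0"
    using that unfolding lift_graph_def e by (subst eq_commute) (simp add: vec3_eq_iff shadow_def)
  show "lift_graph \<psi> (-1) (shadow q) = q" if "q $ 3 \<le> 0"
    using that unfolding lift_graph_def e by (subst eq_commute) (simp add: vec3_eq_iff shadow_def)
qed

lemma continuous_on_planar_poly: "continuous_on S (planar_poly g)"
  unfolding planar_poly_def by (intro continuous_intros)

lemma double_graph_planar_poly_eq:
  "double_graph (planar_poly g) = lift_graph (planar_poly g) 1 ` planar_closed g \<union> lift_graph (planar_poly g) (-1) ` planar_closed g"
proof (intro equalityI subsetI)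
  fix q assume q: "q \<in> double_graph (planar_poly g)"
  have z: "shadow q \<in> planar_closed g" using double_graphD(1)[OF q] planar_poly_sign(1) by simp
  show "q \<in> lift_graph (planar_poly g) 1 ` planar_closed g \<union> lift_graph (planar_poly g) (-1) ` planar_closed g"
  proof (cases "q $ 3 \<ge> 0")
    case True
    then show ?thesis using double_graphD(2)[OF q True] z by (metis UnI1 imageI)
  next
    case False
    then show ?thesis using double_graphD(3)[OF q] z by (metis UnI2 imageI linear)
  qed
qed (use planar_poly_sign(1) lift_graph_mem in force)

lemma continuous_on_lift_planar: "continuous_on S f \<Longrightarrow> continuous_on S (\<lambda>x. lift_graph (planar_poly g) s (f x))"
  by (rule continuous_on_lift_graph[OF continuous_on_planar_poly])

lemma compact_planar_closed: "compact (planar_closed g)"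
  unfolding planar_closed_def by (intro compact_diff open_UN) auto

lemma compact_double_graph_planar_poly: "compact (double_graph (planar_poly g))"
  unfolding double_graph_planar_poly_eq
  by (intro compact_Un compact_continuous_image compact_planar_closed continuous_on_lift_planar continuous_on_id)

lemma connected_double_graph_planar_poly: "connected (double_graph (planar_poly g))"
  unfolding double_graph_planar_poly_eq
proof (rule connected_Un)
  let ?z = "of_real (4 * real g + 4) :: complex"
  have n: "norm ?z = 4 * real g + 4" by (simp del: of_real_add of_real_mult)
  then have 0: "planar_poly g ?z = 0" unfolding planar_poly_eq_0 by simp
  then have "?z \<in> planar_closed g" using planar_poly_sign(1)[of g ?z] by simp
  moreover have "lift_graph (planar_poly g) 1 ?z = lift_graph (planar_poly g) (-1) ?z"
    unfolding lift_graph_def 0 by simp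
  ultimately show "lift_graph (planar_poly g) 1 ` planar_closed g \<inter> lift_graph (planar_poly g) (-1) ` planar_closed g \<noteq> {}"
    by (metis IntI empty_iff imageI)
qed (intro connected_continuous_image connected_planar_closed continuous_on_lift_planar continuous_on_id)+

text \<open>Stated for a sheet \<open>s\<close> and a condition \<open>P\<close> because two halves
  are needed: the closed upper one, fold included, and the open lower one.\<close>

lemma homeomorphic_maps_graph_half:
  assumes S: "S = {q \<in> double_graph (planar_poly g). P q}" and s: "s = 1 \<or> s = -1"
    and T: "\<And>z. z \<in> T \<Longrightarrow> planar_poly g z \<ge> 0 \<and> P (lift_graph (planar_poly g) s z)"
    and S': "\<And>q. q \<in> S \<Longrightarrow> shadow q \<in> T \<and> s * (q $ 3) \<ge> 0"
  shows "homeomorphic_maps (top_of_set S) (top_of_set T) shadow (lift_graph (planar_poly g) s)"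
  unfolding homeomorphic_maps_def
proof (intro conjI ballI)
  show "continuous_map (top_of_set S) (top_of_set T) shadow"
    using S' continuous_on_shadow by auto
  have "lift_graph (planar_poly g) s z \<in> S" if "z \<in> T" for z
    using T[OF that] s lift_graph_mem[of "planar_poly g" z s] by (auto simp: S)
  then show "continuous_map (top_of_set T) (top_of_set S) (lift_graph (planar_poly g) s)"
    using continuous_on_lift_planar[of T id g s] by (auto simp: continuous_on_id)
  fix q assume "q \<in> topspace (top_of_set S)"
  then have q: "q \<in> S" by simp
  then have "q \<in> double_graph (planar_poly g)" by (simp add: S)
  with S'[OF q] s show "lift_graph (planar_poly g) s (shadow q) = q"
    using double_graphD(2,3)[of q "planar_poly g"] by auto
qed simp

text \<open>The upper half \<open>P\<close> is a retract, so \<open>H\<^sub>1\<close> splits into \<open>H\<^sub>1(P)\<close> and the relative group, which excision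
  turns into that of the open domain modulo its collars. Each summand has rank \<open>g\<close>.\<close>

lemma homology_group_1_double_graph:
  "homology_group 1 (top_of_set (double_graph (planar_poly g))) \<cong> free_Abelian_group {..<2 * g}"
proof -
  define \<psi> where "\<psi> = planar_poly g"
  define S where "S = double_graph \<psi>"
  define P where "P = {q \<in> S. q $ 3 \<ge> 0}"
  define M where "M = {q \<in> S. q $ 3 < 0}"
  define N where "N = {q \<in> S. q $ 3 \<ge> 0 \<or> shadow q \<in> boundary_collar g}"
  let ?X = "top_of_set S"
  have sub: "P \<subseteq> N" "N \<subseteq> S" "P \<subseteq> S" by (auto simp: P_def N_def)
  have sP: "subtopology ?X P = top_of_set P" and sN: "subtopology ?X N = top_of_set N"
    and sNP: "subtopology (top_of_set N) P = top_of_set P"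
    using sub by (simp_all add: subtopology_subtopology Int_absorb1)
  have shS: "shadow q \<in> planar_closed g" if "q \<in> S" for q
    using double_graphD(1)[of q \<psi>] that planar_poly_sign(1) by (auto simp: S_def \<psi>_def)
  have retr: "P retract_of_space ?X"
    unfolding retract_of_space_def
  proof (intro conjI exI ballI)
    \<comment> \<open>The retraction folds the lower sheet onto the upper one by reflection in the
      third coordinate.\<close>
    let ?r = "\<lambda>q. vec3 (q $ 1) (q $ 2) \<bar>q $ 3\<bar>"
    have "?r q \<in> P" if "q \<in> S" for q using that by (auto simp: P_def S_def double_graph_def shadow_def)
    moreover have "continuous_on S ?r" by (intro continuous_on_vec3 continuous_intros)
    ultimately show "continuous_map ?X (subtopology ?X P) ?r" unfolding sP by auto
    show "?r q = q" if "q \<in> P" for q using that by (subst eq_commute) (auto simp: vec3_eq_iff P_def)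
  qed (use sub in auto)
  have 1: "homology_group 1 ?X \<cong> homology_group 1 (top_of_set P) \<times>\<times> relative_homology_group 1 ?X P"
    using isomorphic_group_homology_group_prod_retract[OF disjI2[OF retr], of 1] by (simp add: sP)
  have HP: "homology_group 1 (top_of_set P) \<cong> free_Abelian_group {..<g}"
  proof -
    have "homeomorphic_maps (top_of_set P) (top_of_set (planar_closed g)) shadow (lift_graph (planar_poly g) 1)"
    proof (rule homeomorphic_maps_graph_half)
      show "P = {q \<in> double_graph (planar_poly g). q $ 3 \<ge> 0}" by (simp add: P_def S_def \<psi>_def)
    qed (use shS planar_poly_sign(1) in \<open>auto simp: P_def lift_graph_def\<close>)
    then have "top_of_set P homeomorphic_space top_of_set (planar_closed g)"
      unfolding homeomorphic_space_def by blast
    from iso_trans[OF homeomorphic_space_imp_isomorphic_homology_groups[OF this] homology_group_1_planar_closed]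
    show ?thesis .
  qed
  have collar0: "shadow q \<in> boundary_collar g" if "q \<in> S" "q $ 3 = 0" for q
  proof -
    have "planar_poly g (shadow q) = 0" using double_graphD(4)[of q \<psi>] that by (simp add: S_def \<psi>_def)
    then consider "norm (shadow q) = 4 * real g + 4" | i where "i < g" "norm (shadow q - hole_center i) = 1"
      unfolding planar_poly_eq_0 by blast
    then show ?thesis
    proof cases
      case 2
      then have "shadow q \<in> ball (hole_center i) (3/2)" unfolding mem_hole_ball by simp
      with 2 show ?thesis unfolding boundary_collar_def by blast
    qed (simp add: boundary_collar_def)
  qed
  \<comment> \<open>The lower part of \<open>N\<close> slides along its sheet to the fold while the
    upper half stays fixed. The two clauses agree at height 0, because boundary points do not
    move.\<close>
  let ?h = "\<lambda>(t::real, q). if q $ 3 \<le> 0 then lift_graph \<psi> (-1) ((1 - t) *\<^sub>R shadow q + t *\<^sub>R boundary_push g (shadow q)) else q"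
  have hN: "?h (t, q) \<in> N \<and> (t = 0 \<longrightarrow> ?h (t, q) = q) \<and> (t = 1 \<longrightarrow> ?h (t, q) \<in> P) \<and> (q \<in> P \<longrightarrow> ?h (t, q) = q)"
    if t: "t \<in> {0..1}" and q: "q \<in> N" for t q
  proof (cases "q $ 3 \<le> 0")
    case True
    let ?z = "shadow q" and ?w = "(1 - t) *\<^sub>R shadow q + t *\<^sub>R boundary_push g (shadow q)"
    have qS: "q \<in> S" using q sub by auto
    have z: "?z \<in> boundary_collar g" "?z \<in> planar_closed g"
      using q True collar0[OF qS] shS[OF qS] by (auto simp: N_def)
    have w: "?w \<in> boundary_collar g" "?w \<in> planar_closed g" "t = 1 \<Longrightarrow> planar_poly g ?w = 0" "planar_poly g ?z = 0 \<Longrightarrow> ?w = ?z"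
      using boundary_push_segment[OF z] t by auto
    have lS: "lift_graph \<psi> (-1) ?w \<in> S"
      unfolding S_def by (rule lift_graph_mem) (use w planar_poly_sign(1)[of g ?w] in \<open>auto simp: \<psi>_def\<close>)
    have lq: "lift_graph \<psi> (-1) ?z = q" using double_graphD(3)[of q \<psi>] qS True by (simp add: S_def)
    have "?w = ?z" if "q \<in> P"
      using w(4) double_graphD(4)[of q \<psi>] qS True that by (auto simp: P_def S_def \<psi>_def)
    moreover have "lift_graph \<psi> (-1) ?w $ 3 = 0" if "t = 1" using w(3)[OF that] by (simp add: lift_graph_def \<psi>_def)
    moreover have "t = 0 \<Longrightarrow> ?w = ?z" by simp
    ultimately show ?thesis using True lS w(1) lq by (auto simp: N_def P_def)
  next
    case False
    then show ?thesis using q sub by (auto simp: N_def P_def)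
  qed
  have conth: "continuous_on ({0..1::real} \<times> N) ?h"
    unfolding case_prod_unfold
  proof (rule continuous_on_cases_le[where h="\<lambda>x. snd x $ 3" and a=0])
    show "continuous_on {x \<in> {0..1::real} \<times> N. snd x $ 3 \<le> 0}
      (\<lambda>x. lift_graph \<psi> (-1) ((1 - fst x) *\<^sub>R shadow (snd x) + fst x *\<^sub>R boundary_push g (shadow (snd x))))"
      unfolding \<psi>_def
    proof (rule continuous_on_lift_planar, intro continuous_intros)
      show "continuous_on {x \<in> {0..1::real} \<times> N. snd x $ 3 \<le> 0} (\<lambda>x. shadow (snd x))"
        by (rule continuous_on_compose2[OF continuous_on_shadow[of UNIV]]) (auto intro!: continuous_intros)
      then show "continuous_on {x \<in> {0..1::real} \<times> N. snd x $ 3 \<le> 0} (\<lambda>x. boundary_push g (shadow (snd x)))"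
      proof (rule continuous_on_compose2[OF continuous_on_boundary_push])
        show "(\<lambda>x. shadow (snd x)) ` {x \<in> {0..1::real} \<times> N. snd x $ 3 \<le> 0} \<subseteq> boundary_collar g \<inter> planar_closed g"
          using shS collar0 sub by (force simp: N_def)
      qed
    qed
    show "continuous_on {x \<in> {0..1::real} \<times> N. 0 \<le> snd x $ 3} snd" by (intro continuous_intros)
    show "continuous_on ({0..1::real} \<times> N) (\<lambda>x. snd x $ 3)" by (intro continuous_intros)
    fix x :: "real \<times> (real^3)" assume x: "x \<in> {0..1::real} \<times> N" "snd x $ 3 = 0"
    then have "snd x \<in> P" by (auto simp: N_def P_def)
    with hN[of "fst x" "snd x"] x show "lift_graph \<psi> (-1) ((1 - fst x) *\<^sub>R shadow (snd x) + fst x *\<^sub>R boundary_push g (shadow (snd x))) = snd x"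
      by auto
  qed
  let ?f = "\<lambda>q. ?h (1, q)"
  have contf: "continuous_map (top_of_set N) (top_of_set P) ?f"
  proof -
    have "continuous_on N (\<lambda>q. ?h (1, q))"
      by (rule continuous_on_compose2[OF conth]) (auto intro!: continuous_intros)
    then show ?thesis using hN[of 1] by auto
  qed
  \<comment> \<open>Since \<open>N\<close> deforms onto \<open>P\<close> relative to
    \<open>P\<close>, the pair has no homology, and in the exact sequence of the triple the subspace
    \<open>P\<close> can be enlarged to the open set \<open>N\<close>.\<close>
  have triv: "trivial_group (relative_homology_group p (top_of_set N) P)" for p
  proof (rule trivial_relative_homology_group_gen[where f="?f"])
    show "continuous_map (top_of_set N) (subtopology (top_of_set N) P) ?f" unfolding sNP by (rule contf)
    show "homotopic_with (\<lambda>h. True) (subtopology (top_of_set N) P) (subtopology (top_of_set N) P) ?f id"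
      unfolding sNP
    proof (rule homotopic_with_equal)
      show "continuous_map (top_of_set P) (top_of_set P) ?f"
        using continuous_map_from_subtopology[OF contf, of P] by (simp add: sNP)
      show "?f q = id q" if "q \<in> topspace (top_of_set P)" for q
        using hN[of 1 q] that sub by auto
    qed auto
    have "homotopic_with (\<lambda>h. True) (top_of_set N) (top_of_set N) id ?f"
    proof (subst homotopic_with, simp, intro exI[of _ ?h] conjI ballI)
      have "continuous_on ({0..1::real} \<times> N) ?h \<and> ?h ` ({0..1::real} \<times> N) \<subseteq> N" using conth hN by force
      then show "continuous_map (prod_topology (top_of_set {0..1}) (top_of_set N)) (top_of_set N) ?h"
        by (auto simp flip: subtopology_Times euclidean_product_topology)
    qed (use hN[of 0] in auto)
    then show "homotopic_with (\<lambda>k. True) (top_of_set N) (top_of_set N) ?f id"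
      by (rule homotopic_with_symD)
  qed
  have 2: "relative_homology_group 1 ?X P \<cong> relative_homology_group 1 ?X N"
  proof (rule is_isoI)
    show "hom_induced 1 ?X P ?X N id \<in> iso (relative_homology_group 1 ?X P) (relative_homology_group 1 ?X N)"
    proof (rule very_short_exact_sequence)
      show "exact_seq ([relative_homology_group 0 (top_of_set N) P, relative_homology_group 1 ?X N, relative_homology_group 1 ?X P, relative_homology_group 1 (top_of_set N) P],
        [hom_relboundary 1 ?X N P, hom_induced 1 ?X P ?X N id, hom_induced 1 (top_of_set N) P ?X P id])"
        using homology_exactness_triple_1[OF sub(1), of 1 ?X] homology_exactness_triple_3[OF sub(1), of 1 ?X] by (simp add: sN)
    qed (rule triv)+
  qed
  have SP: "S - P = M" by (auto simp: P_def M_def)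
  have sM: "subtopology ?X M = top_of_set M" by (simp add: subtopology_subtopology Int_absorb1 M_def)
  \<comment> \<open>\<open>P\<close> is closed and \<open>N\<close> is open in the surface, so
    \<open>P\<close> may be excised. The open lower half \<open>M\<close> remains, and its sheet
    projects homeomorphically onto the open domain.\<close>
  have 3: "relative_homology_group 1 (top_of_set M) (N - P) \<cong> relative_homology_group 1 ?X N"
  proof -
    have "closedin ?X P"
    proof -
      have "P = S \<inter> {q. 0 \<le> q $ 3}" by (auto simp: P_def)
      moreover have "closed {q::real^3. 0 \<le> q $ 3}" by (intro closed_Collect_le continuous_intros)
      ultimately show ?thesis by (metis closedin_closed_Int)
    qed
    moreover have "openin ?X N"
    proof -
      have "open (boundary_collar g)" unfolding boundary_collar_def
        by (auto intro!: open_Un open_UN open_Collect_less continuous_intros)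
      then have "open (shadow -` boundary_collar g)"
        using continuous_on_shadow[of UNIV] by (simp add: open_vimage continuous_on_eq_continuous_at)
      moreover have "open {q::real^3. 0 < q $ 3}" by (intro open_Collect_less continuous_intros)
      moreover have "N = S \<inter> ({q. 0 < q $ 3} \<union> shadow -` boundary_collar g)"
        using collar0 by (auto simp: N_def less_le)
      ultimately show ?thesis by (metis open_Un openin_open_Int)
    qed
    ultimately have "?X closure_of P \<subseteq> ?X interior_of N"
      using sub by (simp add: closure_of_closedin interior_of_openin)
    from homology_excision_axiom[OF this sub(2), of 1, THEN is_isoI]
    have "relative_homology_group 1 (subtopology ?X (S - P)) (N - P) \<cong> relative_homology_group 1 (subtopology ?X S) N" .
    moreover have "subtopology ?X S = ?X" by (simp add: subtopology_subtopology)
    ultimately show ?thesis by (simp add: SP sM)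
  qed
  have 4: "relative_homology_group 1 (top_of_set M) (N - P) \<cong> relative_homology_group 1 (top_of_set (planar_open g)) (hole_collar g \<union> rim_collar g)"
  proof -
    have shM: "shadow q \<in> planar_open g" if "q \<in> M" for q
    proof -
      have "\<psi> (shadow q) = (q $ 3)\<^sup>2" "q $ 3 \<noteq> 0" using that by (auto simp: M_def S_def double_graph_def)
      then show ?thesis using planar_poly_sign(2)[of g "shadow q"] by (simp add: \<psi>_def)
    qed
    have "homeomorphic_maps (top_of_set M) (top_of_set (planar_open g)) shadow (lift_graph (planar_poly g) (-1))"
    proof (rule homeomorphic_maps_graph_half)
      show "M = {q \<in> double_graph (planar_poly g). q $ 3 < 0}" by (simp add: M_def S_def \<psi>_def)
    qed (use shM planar_poly_sign(2) in \<open>auto simp: M_def lift_graph_def less_imp_le\<close>)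
    then have hm: "homeomorphic_map (top_of_set M) (top_of_set (planar_open g)) shadow"
      by (auto simp: homeomorphic_map_maps)
    have "shadow ` (N - P) = planar_open g \<inter> boundary_collar g"
    proof (intro equalityI subsetI)
      fix z assume "z \<in> shadow ` (N - P)"
      then obtain q where "q \<in> N" "q \<notin> P" and z: "z = shadow q" by blast
      then have q: "q \<in> M" "shadow q \<in> boundary_collar g" by (auto simp: N_def P_def M_def)
      then show "z \<in> planar_open g \<inter> boundary_collar g" using shM[OF q(1)] z by simp
    next
      fix z assume z: "z \<in> planar_open g \<inter> boundary_collar g"
      then have pz: "planar_poly g z > 0" using planar_poly_sign(2)[of g z] by simp
      then have "lift_graph \<psi> (-1) z \<in> S" unfolding S_def \<psi>_def by (intro lift_graph_mem) auto
      moreover have "lift_graph \<psi> (-1) z $ 3 < 0" using pz by (simp add: lift_graph_def \<psi>_def)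
      ultimately have "lift_graph \<psi> (-1) z \<in> N - P" using z by (auto simp: N_def P_def)
      then show "z \<in> shadow ` (N - P)" by (metis imageI shadow_lift_graph)
    qed
    then have "shadow ` (N - P) = hole_collar g \<union> rim_collar g" by (simp add: planar_open_collar)
    then show ?thesis
      by (intro is_isoI[OF homeomorphic_map_relative_homology_iso[OF hm]]) (auto simp: N_def P_def M_def)
  qed
  have "relative_homology_group 1 ?X P \<cong> free_Abelian_group {..<g}"
    using iso_trans[OF 2 iso_trans[OF group.iso_sym[OF _ 3] iso_trans[OF 4 relative_homology_group_planar_open]]] by simp
  \<comment> \<open>The second basis is shifted past the first to make the index sets
    disjoint.\<close>
  moreover have "free_Abelian_group {..<g} \<cong> free_Abelian_group {g..<2 * g}"
    by (simp add: isomorphic_free_Abelian_groups eqpoll_iff_card)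
  ultimately have "relative_homology_group 1 ?X P \<cong> free_Abelian_group {g..<2 * g}" by (rule iso_trans)
  from group.DirProd_iso_trans[OF _ HP this] 
  have A: "homology_group 1 (top_of_set P) \<times>\<times> relative_homology_group 1 ?X P \<cong> free_Abelian_group {..<g} \<times>\<times> free_Abelian_group {g..<2 * g}"
    by simp
  have B: "free_Abelian_group {..<g} \<times>\<times> free_Abelian_group {g..<2 * g} \<cong> free_Abelian_group {..<2 * g}"
  proof -
    have u: "{..<g} \<union> {g..<2 * g} = {..<2 * g}" and d: "{..<g} \<inter> {g..<2 * g} = {}" by auto
    show ?thesis using DirProd_free_Abelian_group[OF d] unfolding u .
  qed
  show ?thesis
    using iso_trans[OF 1 iso_trans[OF A B]] by (simp only: S_def \<psi>_def)
qed


section \<open>Tangent spaces and the squared determinant\<close>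

lemma smooth_map_on_local:
  assumes "\<And>x. x \<in> X \<Longrightarrow> \<exists>U. open U \<and> x \<in> U \<and> smooth_map_on (X \<inter> U) f"
  shows "smooth_map_on X f"
proof (rule smooth_map_onI)
  fix x assume x: "x \<in> X"
  then obtain U where U: "open U" "x \<in> U" "smooth_map_on (X \<inter> U) f" using assms by blast
  then obtain V h where V: "open V" "x \<in> V" "smooth_on V h" "\<And>y. y \<in> X \<inter> U \<Longrightarrow> y \<in> V \<Longrightarrow> f y = h y"
    using smooth_map_onE[OF U(3), of x] x by blast
  have "smooth_on (U \<inter> V) h" by (rule smooth_on_subset[OF V(3)]) auto
  with U V show "\<exists>W h. open W \<and> x \<in> W \<and> smooth_on W h \<and> (\<forall>y. y \<in> X \<longrightarrow> y \<in> W \<longrightarrow> f y = h y)"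
    by (intro exI[of _ "U \<inter> V"] exI[of _ h]) auto
qed

lemma smooth_curve_in_compose:
  assumes "smooth_curve_in M \<gamma>" "smooth_map_on M f" "f ` M \<subseteq> N"
  shows "smooth_curve_in N (\<lambda>t. f (\<gamma> t))"
proof -
  obtain e where e: "e > 0" "smooth_on {-e<..<e} \<gamma>" "\<gamma> ` {-e<..<e} \<subseteq> M"
    using assms(1) unfolding smooth_curve_in_def by blast
  have "smooth_map_on {-e<..<e} (\<lambda>t. f (\<gamma> t))"
    by (rule smooth_map_on_compose[OF smooth_on_imp_smooth_map_on[OF _ e(2) order_refl] assms(2) e(3)]) simp
  then have "smooth_on {-e<..<e} (\<lambda>t. f (\<gamma> t))" by (intro smooth_map_on_open) auto
  then show ?thesis unfolding smooth_curve_in_def using e assms(3) by (intro exI[of _ e]) auto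
qed

lemma smooth_curve_in_has_vector_derivative:
  "smooth_curve_in M \<gamma> \<Longrightarrow> (\<gamma> has_vector_derivative vector_derivative \<gamma> (at 0)) (at 0)"
  unfolding smooth_curve_in_def
  by (elim exE conjE, rule has_vector_derivative_smooth_curve) auto

text \<open>A chain rule for maps that are smooth only on a subset. The linear map \<open>D\<close>
  is the derivative of some local extension; which one does not affect the velocity, as the curve
  stays in the subset.\<close>

lemma smooth_map_along_curve:
  assumes "smooth_curve_in M \<gamma>" "smooth_map_on M f"
  obtains D where "linear D" "((\<lambda>t. f (\<gamma> t)) has_vector_derivative D (vector_derivative \<gamma> (at 0))) (at 0)"
proof -
  obtain e where e: "e > 0" "smooth_on {-e<..<e} \<gamma>" "\<gamma> ` {-e<..<e} \<subseteq> M"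
    using assms(1) unfolding smooth_curve_in_def by blast
  have "\<gamma> 0 \<in> M" using e by force
  then obtain U g where U: "open U" "\<gamma> 0 \<in> U" "smooth_on U g" "\<And>y. y \<in> M \<Longrightarrow> y \<in> U \<Longrightarrow> f y = g y"
    using smooth_map_onE[OF assms(2)] by metis
  let ?D = "frechet_derivative g (at (\<gamma> 0))"
  have D: "(g has_derivative ?D) (at (\<gamma> 0))" using smooth_onD[OF U(3) U(2)] .
  have "((g \<circ> \<gamma>) has_vector_derivative ?D (vector_derivative \<gamma> (at 0))) (at 0)"
    using vector_derivative_diff_chain_within[OF smooth_curve_in_has_vector_derivative[OF assms(1)], of g ?D] D
    by (simp add: has_derivative_at_withinI)
  moreover have "open ({-e<..<e} \<inter> \<gamma> -` U)"
    by (rule continuous_open_preimage[OF smooth_on_continuous[OF e(2)] _ U(1)]) simp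
  ultimately have "((\<lambda>t. f (\<gamma> t)) has_vector_derivative ?D (vector_derivative \<gamma> (at 0))) (at 0)"
    by (rule has_vector_derivative_transform_within_open[where S="{-e<..<e} \<inter> \<gamma> -` U"])
       (use e U in \<open>auto simp: image_subset_iff\<close>)
  then show thesis using that has_derivative_linear[OF D] by blast
qed

text \<open>A smooth left inverse recovers the velocity of a curve linearly from the velocity of its
  image, so a nonzero velocity cannot be killed.\<close>

lemma smooth_immersion_diffeo:
  assumes "smooth_map_on M f" "smooth_map_on (f ` M) g" "\<And>x. x \<in> M \<Longrightarrow> g (f x) = x"
  shows "smooth_immersion M f"
  unfolding smooth_immersion_def
proof (intro conjI allI impI assms(1))
  fix \<gamma> assume \<gamma>: "smooth_curve_in M \<gamma> \<and> vector_derivative \<gamma> (at 0) \<noteq> 0"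
  have c: "smooth_curve_in (f ` M) (\<lambda>t. f (\<gamma> t))"
    using smooth_curve_in_compose[of M \<gamma> f "f ` M"] \<gamma> assms(1) by blast
  obtain D where D: "linear D" "((\<lambda>t. g (f (\<gamma> t))) has_vector_derivative D (vector_derivative (\<lambda>t. f (\<gamma> t)) (at 0))) (at 0)"
    by (rule smooth_map_along_curve[OF c assms(2)])
  obtain e where e: "e > 0" "\<gamma> ` {-e<..<e} \<subseteq> M" using \<gamma> unfolding smooth_curve_in_def by blast
  have "(\<gamma> has_vector_derivative D (vector_derivative (\<lambda>t. f (\<gamma> t)) (at 0))) (at 0)"
    by (rule has_vector_derivative_transform_within_open[OF D(2), where S="{-e<..<e}"])
       (use e assms(3) in \<open>auto simp: image_subset_iff\<close>)
  then have "vector_derivative \<gamma> (at 0) = D (vector_derivative (\<lambda>t. f (\<gamma> t)) (at 0))"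
    by (rule vector_derivative_at)
  then show "vector_derivative (f \<circ> \<gamma>) (at 0) \<noteq> 0"
    using \<gamma> linear_0[OF D(1)] by (auto simp: o_def)
qed

lemma smooth_submanifold_diffeo:
  fixes M :: "'a::euclidean_space set" and f :: "'a \<Rightarrow> 'b::euclidean_space"
  assumes M: "smooth_submanifold TYPE('m::euclidean_space) M" and h: "homeomorphism M L f g"
    and sm: "smooth_map_on M f" "smooth_map_on L g"
  shows "smooth_submanifold TYPE('m) L"
  unfolding smooth_submanifold_def
proof
  fix p assume p: "p \<in> L"
  then have gp: "g p \<in> M" using h by (auto simp: homeomorphism_def)
  obtain W and V :: "'m set" and \<phi> ch where W: "openin (top_of_set M) W" "g p \<in> W" "open V"
    "homeomorphism V W \<phi> ch" "smooth_map_on V \<phi>" "smooth_map_on W ch"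
  proof -
    obtain W and V :: "'m set" where W: "openin (top_of_set M) W" "g p \<in> W" "open V" "diffeomorphic_sets V W"
      using M gp unfolding smooth_submanifold_def by meson
    then show thesis using that unfolding diffeomorphic_sets_def by metis
  qed
  have WM: "W \<subseteq> M" using openin_imp_subset[OF W(1)] .
  have o: "openin (top_of_set L) (f ` W)" using homeomorphism_imp_open_map[OF h W(1)] .
  have "homeomorphism W (f ` W) f g"
    by (rule homeomorphism_of_subsets[OF h WM _ refl]) (use openin_imp_subset[OF o] in auto)
  from homeomorphism_compose[OF W(4) this]
  have hh: "homeomorphism V (f ` W) (f \<circ> \<phi>) (ch \<circ> g)" .
  have "smooth_map_on V (f \<circ> \<phi>)"
    unfolding o_def using W(4) by (intro smooth_map_on_compose[OF W(5) smooth_map_on_subset[OF sm(1) WM]]) (auto simp: homeomorphism_def)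
  moreover have "smooth_map_on (f ` W) (ch \<circ> g)"
  proof -
    have fWL: "f ` W \<subseteq> L" using openin_imp_subset[OF o] .
    have "g ` (f ` W) \<subseteq> W" using h WM by (auto simp: homeomorphism_def)
    then show ?thesis unfolding o_def by (intro smooth_map_on_compose[OF smooth_map_on_subset[OF sm(2) fWL] W(6)])
  qed
  ultimately have "diffeomorphic_sets V (f ` W)" unfolding diffeomorphic_sets_def using hh by blast
  moreover have "p \<in> f ` W" using W(2) p h by (metis homeomorphism_def image_eqI)
  ultimately show "\<exists>W. openin (top_of_set L) W \<and> p \<in> W \<and> (\<exists>V::'m set. open V \<and> diffeomorphic_sets V W)"
    using o W(3) by blast
qed

text \<open>Tangent spaces are defined by curves, and the smooth inverse \<open>g\<close> pulls
  every smooth curve in \<open>L\<close> back to one in \<open>M\<close>.\<close>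

lemma tangent_space_diffeo:
  assumes h: "homeomorphism M L f g" and sm: "smooth_map_on M f" "smooth_map_on L g" and m: "m \<in> M"
  shows "tangent_space L (f m) = {vector_derivative (\<lambda>t. f (\<gamma> t)) (at 0) | \<gamma>. smooth_curve_in M \<gamma> \<and> \<gamma> 0 = m}"
proof (intro equalityI subsetI)
  note hd = h[unfolded homeomorphism_def]
  fix v assume "v \<in> tangent_space L (f m)"
  then obtain \<beta> where \<beta>: "v = vector_derivative \<beta> (at 0)" "smooth_curve_in L \<beta>" "\<beta> 0 = f m"
    unfolding tangent_space_def by blast
  obtain e where e: "e > 0" "\<beta> ` {-e<..<e} \<subseteq> L" using \<beta>(2) unfolding smooth_curve_in_def by blast
  have "smooth_curve_in M (\<lambda>t. g (\<beta> t))"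
    by (rule smooth_curve_in_compose[OF \<beta>(2) sm(2)]) (use hd in auto)
  moreover have "g (\<beta> 0) = m" using \<beta>(3) m hd by simp
  moreover have "((\<lambda>t. f (g (\<beta> t))) has_vector_derivative v) (at 0)"
    by (rule has_vector_derivative_transform_within_open[OF smooth_curve_in_has_vector_derivative[OF \<beta>(2), folded \<beta>(1)], where S="{-e<..<e}"])
       (use e hd in \<open>auto simp: image_subset_iff\<close>)
  ultimately show "v \<in> {vector_derivative (\<lambda>t. f (\<gamma> t)) (at 0) | \<gamma>. smooth_curve_in M \<gamma> \<and> \<gamma> 0 = m}"
    using vector_derivative_at by (auto intro!: exI[of _ "\<lambda>t. g (\<beta> t)"] simp: vector_derivative_at)
next
  fix v assume "v \<in> {vector_derivative (\<lambda>t. f (\<gamma> t)) (at 0) | \<gamma>. smooth_curve_in M \<gamma> \<and> \<gamma> 0 = m}"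
  then obtain \<gamma> where "v = vector_derivative (\<lambda>t. f (\<gamma> t)) (at 0)" "smooth_curve_in M \<gamma>" "\<gamma> 0 = m" by blast
  moreover from this have "smooth_curve_in L (\<lambda>t. f (\<gamma> t))"
    using h by (intro smooth_curve_in_compose[OF _ sm(1)]) (auto simp: homeomorphism_def)
  ultimately show "v \<in> tangent_space L (f m)"
    unfolding tangent_space_def by (auto intro!: exI[of _ "\<lambda>t. f (\<gamma> t)"])
qed

section \<open>Determinants of Lagrangian frames\<close>

lemma det_cnj: "det (\<chi> i j. cnj (A $ i $ j) :: complex ^'n^'n) = cnj (det A)"
  by (simp add: det_def cnj_sum cnj_prod)

lemma det_of_real: "det (\<chi> i j. complex_of_real (A $ i $ j) :: complex ^'n^'n) = of_real (det A)"
  by (simp add: det_def)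

lemma inner_std_symplectic_hermitian:
  fixes u v :: "complex^'n"
  shows "(\<Sum>j\<in>UNIV. cnj (u $ j) * v $ j) = Complex (inner u v) (std_symplectic u v)"
  by (simp add: complex_eq_iff inner_vec_def inner_complex_def std_symplectic_def)

text \<open>The hermitian product has the real inner product as real part and the symplectic form as
  imaginary part. On a Lagrangian subspace a real orthonormal basis is thus a unitary one.\<close>

lemma norm_det_lagrangian_basis:
  fixes b :: "'n::finite \<Rightarrow> complex^'n"
  assumes on: "\<forall>i j. inner (b i) (b j) = (if i = j then 1 else 0)"
    and lag: "\<And>i j. std_symplectic (b i) (b j) = 0"
  shows "norm (det (\<chi> i j. b j $ i)) = 1"
proof -
  let ?B = "(\<chi> i j. b j $ i) :: complex^'n^'n"
  let ?C = "transpose (\<chi> i j. cnj (?B $ i $ j)) :: complex^'n^'n"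
  have "?C ** ?B = mat 1"
    by (auto simp: matrix_matrix_mult_def mat_def transpose_def vec_eq_iff inner_std_symplectic_hermitian on lag complex_eq_iff)
  then have "det ?C * det ?B = 1" unfolding det_mul[symmetric] by simp
  moreover have "det ?C = cnj (det ?B)" unfolding det_transpose by (rule det_cnj)
  ultimately have "complex_of_real ((norm (det ?B))\<^sup>2) = 1"
    unfolding complex_norm_square by (simp add: mult.commute)
  then have "(norm (det ?B))\<^sup>2 = 1" by (simp only: of_real_eq_1_iff)
  then show ?thesis using norm_ge_zero[of "det ?B"] unfolding power2_eq_1_iff by linarith
qed

text \<open>The coefficients of \<open>v\<close> in the orthonormal basis \<open>b\<close> are real,
  and so is the determinant of their matrix.\<close>

lemma real_basis_change_det:
  fixes b v :: "'n::finite \<Rightarrow> complex^'n"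
  assumes on: "\<forall>i j. inner (b i) (b j) = (if i = j then 1 else 0)" and v: "range v \<subseteq> span (range b)"
  obtains r :: real where "det (\<chi> i j. v j $ i) = det (\<chi> i j. b j $ i) * of_real r"
proof -
  have exp: "x = (\<Sum>k\<in>UNIV. inner (b k) x *\<^sub>R b k)" if "x \<in> span (range b)" for x
    using that
  proof (induction rule: span_induct_alt)
    case base
    then show ?case by simp
  next
    case (step c x y)
    then obtain l where l: "x = b l" by auto
    have "(\<Sum>k\<in>UNIV. inner (b k) (c *\<^sub>R x + y) *\<^sub>R b k) = c *\<^sub>R (\<Sum>k\<in>UNIV. inner (b k) x *\<^sub>R b k) + (\<Sum>k\<in>UNIV. inner (b k) y *\<^sub>R b k)"
      by (simp add: inner_add_right scaleR_add_left sum.distrib scaleR_sum_right)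
    moreover have "(\<Sum>k\<in>UNIV. inner (b k) x *\<^sub>R b k) = (\<Sum>k\<in>UNIV. if k = l then b k else 0)"
      unfolding l by (intro sum.cong refl) (use on in auto)
    ultimately show ?case using step l by simp
  qed
  let ?R = "(\<chi> k j. inner (b k) (v j)) :: real^'n^'n"
  have "(\<chi> i j. v j $ i) = (\<chi> i j. b j $ i) ** (\<chi> k j. complex_of_real (?R $ k $ j))"
  proof (simp add: vec_eq_iff matrix_matrix_mult_def, intro allI)
    fix i j
    have "v j \<in> span (range b)" using v by auto
    from arg_cong[OF exp[OF this], of "\<lambda>x. x $ i"]
    have "v j $ i = (\<Sum>k\<in>UNIV. inner (b k) (v j) *\<^sub>R b k) $ i" .
    also have "\<dots> = (\<Sum>k\<in>UNIV. b k $ i * complex_of_real (inner (b k) (v j)))"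
      unfolding sum_component vector_scaleR_component by (simp add: scaleR_conv_of_real mult.commute)
    finally show "v j $ i = (\<Sum>k\<in>UNIV. b k $ i * complex_of_real (inner (b k) (v j)))" .
  qed
  then have "det (\<chi> i j. v j $ i) = det (\<chi> i j. b j $ i) * of_real (det ?R)"
    by (simp only: det_mul det_of_real)
  then show thesis by (rule that)
qed

text \<open>Any real frame may replace an orthonormal basis: its determinant differs from a unitary
  one by a nonzero real factor, normalisation leaves only the sign of that factor, and squaring
  removes it. The same argument shows that the description in \<open>det_squared\<close> is
  unique.\<close>

lemma det_squared_eq:
  fixes v :: "'n::finite \<Rightarrow> complex^'n"
  assumes sp: "subspace \<Lambda>" "dim \<Lambda> = CARD('n)" and lag: "\<And>x y. x \<in> \<Lambda> \<Longrightarrow> y \<in> \<Lambda> \<Longrightarrow> std_symplectic x y = 0"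
    and v: "range v \<subseteq> \<Lambda>" and nz: "det (\<chi> i j. v j $ i) \<noteq> 0"
  shows "det_squared \<Lambda> = (det (\<chi> i j. v j $ i) / norm (det (\<chi> i j. v j $ i)))\<^sup>2"
proof -
  let ?D = "det (\<chi> i j. v j $ i)"
  have uniq: "(det (\<chi> i j. b j $ i))\<^sup>2 = (?D / norm ?D)\<^sup>2"
    if on: "\<forall>i j. inner (b i) (b j) = (if i = j then 1 else 0)" and s: "span (range b) = \<Lambda>" for b :: "'n \<Rightarrow> complex^'n"
  proof -
    have "b i \<in> \<Lambda>" for i unfolding s[symmetric] by (rule span_base) auto
    then have n: "norm (det (\<chi> i j. b j $ i)) = 1" using norm_det_lagrangian_basis[OF on] lag by blast
    obtain r where r: "?D = det (\<chi> i j. b j $ i) * of_real r"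
      using real_basis_change_det[OF on, of v] v s by blast
    then have nr: "norm ?D = \<bar>r\<bar>" using n by (simp add: norm_mult)
    have "r \<noteq> 0" using r nz by auto
    moreover have "(complex_of_real \<bar>r\<bar>)\<^sup>2 = (complex_of_real r)\<^sup>2" by (metis of_real_power power2_abs)
    ultimately show ?thesis unfolding nr power_divide unfolding r power_mult_distrib by simp
  qed
  obtain B where B: "B \<subseteq> \<Lambda>" "pairwise orthogonal B" "\<And>x. x \<in> B \<Longrightarrow> norm x = 1" "independent B" "card B = dim \<Lambda>" "span B = \<Lambda>"
    using orthonormal_basis_subspace[OF sp(1)] by metis
  have "card B = CARD('n)" using B sp by simp
  moreover have "finite B" using B(4) by (rule finiteI_independent)
  ultimately obtain b where b: "bij_betw b (UNIV :: 'n set) B"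
    using finite_same_card_bij[of "UNIV :: 'n set" B] by auto
  have on: "\<forall>i j. inner (b i) (b j) = (if i = j then 1 else 0)"
  proof (intro allI)
    fix i j
    have "b i \<in> B" "b j \<in> B" using b by (auto simp: bij_betw_def)
    moreover have "i \<noteq> j \<Longrightarrow> b i \<noteq> b j" using b by (auto simp: bij_betw_def inj_def)
    ultimately show "inner (b i) (b j) = (if i = j then 1 else 0)"
      using B(2,3) by (auto simp: pairwise_def orthogonal_def dot_square_norm)
  qed
  have s: "span (range b) = \<Lambda>" using b B(6) by (simp add: bij_betw_def)
  show ?thesis
    unfolding det_squared_def
  proof (rule the_equality)
    show "\<exists>b. (\<forall>i j. inner (b i) (b j) = (if i = j then 1 else 0)) \<and> span (range b) = \<Lambda> \<and> (?D / norm ?D)\<^sup>2 = (det (\<chi> i j. b j $ i))\<^sup>2"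
      using on s uniq[OF on s] by (intro exI[of _ b]) simp
  next
    fix d assume "\<exists>b. (\<forall>i j. inner (b i) (b j) = (if i = j then 1 else 0)) \<and> span (range b) = \<Lambda> \<and> d = (det (\<chi> i j. b j $ i))\<^sup>2"
    then show "d = (?D / norm ?D)\<^sup>2" using uniq by blast
  qed
qed

lemma has_vector_derivative_vec:
  fixes h :: "real \<Rightarrow> ('b::euclidean_space)^'n"
  assumes "\<And>j. ((\<lambda>t. h t $ j) has_vector_derivative d $ j) F"
  shows "(h has_vector_derivative d) F"
proof -
  have e: "(\<Sum>j\<in>UNIV. axis j (x $ j)) = x" for x :: "'b^'n"
    by (auto simp: vec_eq_iff axis_def if_distrib cong: if_cong)
  have "((\<lambda>t. \<Sum>j\<in>UNIV. axis j (h t $ j)) has_vector_derivative (\<Sum>j\<in>UNIV. axis j (d $ j))) F"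
    by (intro has_vector_derivative_sum bounded_linear.has_vector_derivative[OF bounded_linear_axis] assms)
  then show ?thesis by (simp add: e)
qed

text \<open>The second difference \<open>?\<Delta>\<close> of \<open>b\<close> over a square of side
  \<open>h\<close> is evaluated twice by the mean value theorem, in the two orders of the variables.
  This gives equal values of \<open>bxy\<close> and \<open>byx\<close> at points near
  \<open>z\<close>, against a gap \<open>d\<close> at \<open>z\<close> and continuity.\<close>

lemma symmetric_second_derivative:
  fixes b :: "complex \<Rightarrow> real"
  assumes U: "open U" "convex U" and z: "z \<in> U"
    and b: "\<And>w. w \<in> U \<Longrightarrow> (b has_derivative (\<lambda>h. Re h * bx w + Im h * by w)) (at w)"
    and bx: "\<And>w. w \<in> U \<Longrightarrow> (bx has_derivative (\<lambda>h. Re h * bxx w + Im h * bxy w)) (at w)"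
    and byd: "\<And>w. w \<in> U \<Longrightarrow> (by has_derivative (\<lambda>h. Re h * byx w + Im h * byy w)) (at w)"
    and c: "continuous_on U bxy" "continuous_on U byx"
  shows "bxy z = byx z"
proof (rule ccontr)
  assume ne: "bxy z \<noteq> byx z"
  define d where "d = \<bar>bxy z - byx z\<bar>"
  have d: "d > 0" using ne by (simp add: d_def)
  obtain e1 where e1: "e1 > 0" "\<And>w. w \<in> U \<Longrightarrow> dist w z < e1 \<Longrightarrow> \<bar>bxy w - bxy z\<bar> < d/2"
    using c(1) z d unfolding continuous_on_iff dist_real_def by (metis half_gt_zero)
  obtain e2 where e2: "e2 > 0" "\<And>w. w \<in> U \<Longrightarrow> dist w z < e2 \<Longrightarrow> \<bar>byx w - byx z\<bar> < d/2"
    using c(2) z d unfolding continuous_on_iff dist_real_def by (metis half_gt_zero)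
  obtain e3 where e3: "e3 > 0" "ball z e3 \<subseteq> U" using U(1) z open_contains_ball by blast
  \<comment> \<open>Points of the square lie within \<open>2 * h\<close> of \<open>z\<close>, so a
    third of the smallest radius is enough.\<close>
  define h where "h = min e1 (min e2 e3) / 3"
  have h: "h > 0" using e1(1) e2(1) e3(1) by (simp add: h_def)
  define Z where "Z s t = z + Complex s t" for s t
  have near: "Z s t \<in> U" "dist (Z s t) z < e1" "dist (Z s t) z < e2" if "0 \<le> s" "s \<le> h" "0 \<le> t" "t \<le> h" for s t
  proof -
    have "dist (Z s t) z = norm (Complex s t)" by (simp add: Z_def dist_norm)
    also have "\<dots> \<le> \<bar>s\<bar> + \<bar>t\<bar>" using cmod_le[of "Complex s t"] by simp
    also have "\<dots> \<le> 2 * h" using that by simp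
    finally have "dist (Z s t) z \<le> 2 * h" .
    moreover have "2 * h < e1" "2 * h < e2" "2 * h < e3" using e1(1) e2(1) e3(1) by (auto simp: h_def)
    ultimately show "Z s t \<in> U" "dist (Z s t) z < e1" "dist (Z s t) z < e2"
      using e3(2) by (auto simp: dist_commute subset_iff)
  qed
  have Zs: "((\<lambda>s. Z s t) has_derivative (\<lambda>k. Complex k 0)) (at s)" for s t
    unfolding Z_def Complex_eq by (auto intro!: derivative_eq_intros)
  have Zt: "((\<lambda>t. Z s t) has_derivative (\<lambda>k. Complex 0 k)) (at t)" for s t
    unfolding Z_def Complex_eq by (auto intro!: derivative_eq_intros)
  have d_s: "((\<lambda>s. f (Z s t)) has_real_derivative fx (Z s t)) (at s)"
    if "\<And>w. w \<in> U \<Longrightarrow> (f has_derivative (\<lambda>h. Re h * fx w + Im h * fy w)) (at w)" "Z s t \<in> U" for f fx fy s t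
    using diff_chain_at[OF Zs that(1)[OF that(2)]] by (simp add: o_def has_field_derivative_def mult.commute[of _ "fx (Z s t)"])
  have d_t: "((\<lambda>t. f (Z s t)) has_real_derivative fy (Z s t)) (at t)"
    if "\<And>w. w \<in> U \<Longrightarrow> (f has_derivative (\<lambda>h. Re h * fx w + Im h * fy w)) (at w)" "Z s t \<in> U" for f fx fy s t
    using diff_chain_at[OF Zt that(1)[OF that(2)]] by (simp add: o_def has_field_derivative_def mult.commute[of _ "fy (Z s t)"])
  let ?\<Delta> = "b (Z h h) - b (Z h 0) - b (Z 0 h) + b (Z 0 0)"
  have "\<exists>s. 0 < s \<and> s < h \<and> (b (Z h h) - b (Z h 0)) - (b (Z 0 h) - b (Z 0 0)) = (h - 0) * (bx (Z s h) - bx (Z s 0))"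
  proof (rule MVT2[OF h])
    fix s assume "0 \<le> s" "s \<le> h"
    then show "((\<lambda>s. b (Z s h) - b (Z s 0)) has_real_derivative bx (Z s h) - bx (Z s 0)) (at s)"
      using near(1) h by (intro DERIV_diff d_s[OF b]) auto
  qed
  then obtain s where s: "0 < s" "s < h" "?\<Delta> = h * (bx (Z s h) - bx (Z s 0))" by auto
  have "\<exists>t. 0 < t \<and> t < h \<and> bx (Z s h) - bx (Z s 0) = (h - 0) * bxy (Z s t)"
  proof (rule MVT2[OF h])
    fix t assume "0 \<le> t" "t \<le> h"
    then show "((\<lambda>t. bx (Z s t)) has_real_derivative bxy (Z s t)) (at t)"
      using near(1) s by (intro d_t[OF bx]) auto
  qed
  then obtain t where t: "0 < t" "t < h" "bx (Z s h) - bx (Z s 0) = h * bxy (Z s t)" by auto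
  have "\<exists>t'. 0 < t' \<and> t' < h \<and> (b (Z h h) - b (Z 0 h)) - (b (Z h 0) - b (Z 0 0)) = (h - 0) * (by (Z h t') - by (Z 0 t'))"
  proof (rule MVT2[OF h])
    fix t assume "0 \<le> t" "t \<le> h"
    then show "((\<lambda>t. b (Z h t) - b (Z 0 t)) has_real_derivative by (Z h t) - by (Z 0 t)) (at t)"
      using near(1) h by (intro DERIV_diff d_t[OF b]) auto
  qed
  then obtain t' where t': "0 < t'" "t' < h" "?\<Delta> = h * (by (Z h t') - by (Z 0 t'))" by auto
  have "\<exists>s'. 0 < s' \<and> s' < h \<and> by (Z h t') - by (Z 0 t') = (h - 0) * byx (Z s' t')"
  proof (rule MVT2[OF h])
    fix s assume "0 \<le> s" "s \<le> h"
    then show "((\<lambda>s. by (Z s t')) has_real_derivative byx (Z s t')) (at s)"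
      using near(1) t' by (intro d_s[OF byd]) auto
  qed
  then obtain s' where s': "0 < s'" "s' < h" "by (Z h t') - by (Z 0 t') = h * byx (Z s' t')" by auto
  have eq: "bxy (Z s t) = byx (Z s' t')" using s t t' s' h by simp
  have "\<bar>bxy (Z s t) - bxy z\<bar> < d/2" using s t near[of s t] e1(2) by simp
  moreover have "\<bar>byx (Z s' t') - byx z\<bar> < d/2" using s' t' near[of s' t'] e2(2) by simp
  moreover have "d \<le> \<bar>bxy (Z s t) - bxy z\<bar> + \<bar>byx (Z s' t') - byx z\<bar>"
    unfolding d_def using eq by linarith
  ultimately show False by linarith
qed


section \<open>The suspended Lagrangian\<close>

text \<open>\<open>k\<close> and \<epsilon> are left free here: the formulas for the map and its
  tangent frames hold for all values, and bounds on the surface must be available before the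
  constants are chosen. The condition \<open>regular\<close> makes the surface smooth along the
  fold.\<close>

locale suspension =
  fixes \<psi> :: "complex \<Rightarrow> real" and k \<epsilon> :: real
  assumes smooth: "smooth_on UNIV \<psi>" and compact_\<Sigma>: "compact (double_graph \<psi>)"
    and regular: "\<And>z. \<psi> z = 0 \<Longrightarrow> \<exists>v. frechet_derivative \<psi> (at z) v \<noteq> 0"
begin

abbreviation "\<Sigma> \<equiv> double_graph \<psi>"
abbreviation "M \<equiv> sphere (0::complex) 1 \<times> \<Sigma>"

definition "\<psi>x z = frechet_derivative \<psi> (at z) 1"
definition "\<psi>y z = frechet_derivative \<psi> (at z) \<i>"
definition "\<psi>xx z = frechet_derivative \<psi>x (at z) 1"
definition "\<psi>xy z = frechet_derivative \<psi>x (at z) \<i>"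
definition "\<psi>yx z = frechet_derivative \<psi>y (at z) 1"
definition "\<psi>yy z = frechet_derivative \<psi>y (at z) \<i>"

lemma smooth_\<psi>x: "smooth_on UNIV \<psi>x" and smooth_\<psi>y: "smooth_on UNIV \<psi>y"
  unfolding \<psi>x_def[abs_def] \<psi>y_def[abs_def] using smooth_on_frechet_derivative[OF smooth] by auto

lemma smooth_second: "smooth_on UNIV \<psi>xx" "smooth_on UNIV \<psi>xy" "smooth_on UNIV \<psi>yx" "smooth_on UNIV \<psi>yy"
  unfolding \<psi>xx_def[abs_def] \<psi>xy_def[abs_def] \<psi>yx_def[abs_def] \<psi>yy_def[abs_def]
  by (rule smooth_on_frechet_derivative[OF smooth_\<psi>x] smooth_on_frechet_derivative[OF smooth_\<psi>y])+

lemma has_derivative_partials: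
  assumes "smooth_on UNIV (f::complex \<Rightarrow> real)"
  shows "(f has_derivative (\<lambda>h. Re h * frechet_derivative f (at z) 1 + Im h * frechet_derivative f (at z) \<i>)) (at z)"
proof -
  have D: "(f has_derivative frechet_derivative f (at z)) (at z)" using smooth_onD[OF assms] by simp
  then have l: "linear (frechet_derivative f (at z))" by (rule has_derivative_linear)
  have "frechet_derivative f (at z) h = Re h * frechet_derivative f (at z) 1 + Im h * frechet_derivative f (at z) \<i>" for h
  proof -
    have "h = Re h *\<^sub>R 1 + Im h *\<^sub>R \<i>" by (simp add: complex_eq_iff)
    then show ?thesis by (metis linear_add[OF l] linear_scale[OF l] real_scaleR_def)
  qed
  then have "frechet_derivative f (at z) = (\<lambda>h. Re h * frechet_derivative f (at z) 1 + Im h * frechet_derivative f (at z) \<i>)"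
    by (rule ext)
  with D show ?thesis by (rule has_derivative_eq_rhs)
qed

lemmas D\<psi> = has_derivative_partials[OF smooth, folded \<psi>x_def \<psi>y_def]
lemmas D\<psi>x = has_derivative_partials[OF smooth_\<psi>x, folded \<psi>xx_def \<psi>xy_def]
lemmas D\<psi>y = has_derivative_partials[OF smooth_\<psi>y, folded \<psi>yx_def \<psi>yy_def]

text \<open>This symmetry makes the second derivatives of \<psi> cancel in the symplectic form
  below, as for any graph of a differential. From here on the differential of \<open>f\<close> is
  expressed with \<open>\<psi>xy\<close> alone.\<close>

lemma \<psi>xy_eq: "\<psi>xy z = \<psi>yx z"
  by (rule symmetric_second_derivative[of UNIV z \<psi> \<psi>x \<psi>y \<psi>xx \<psi>xy \<psi>yx \<psi>yy])
     (use D\<psi> D\<psi>x D\<psi>y smooth_second in \<open>auto intro: smooth_on_continuous\<close>)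

lemma grad_nonzero: assumes "\<psi> z = 0" shows "(\<psi>x z)\<^sup>2 + (\<psi>y z)\<^sup>2 > 0"
proof -
  obtain v where "frechet_derivative \<psi> (at z) v \<noteq> 0" using regular[OF assms] by blast
  moreover have "frechet_derivative \<psi> (at z) v = Re v * \<psi>x z + Im v * \<psi>y z"
    using frechet_derivative_at[OF D\<psi>[of z]] by metis
  ultimately have "\<psi>x z \<noteq> 0 \<or> \<psi>y z \<noteq> 0" by auto
  then show ?thesis by (simp add: sum_power2_gt_zero_iff)
qed

definition "F q = (q $ 3)\<^sup>2 - \<psi> (shadow q)"

lemma \<Sigma>_eq: "\<Sigma> = {q. F q = 0}" by (simp add: double_graph_def F_def)

lemma smooth_map_on_shadow: "smooth_map_on X shadow"
  unfolding shadow_def by (intro smooth_intros)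

lemma smooth_map_on_comp_shadow: "smooth_on UNIV f \<Longrightarrow> smooth_map_on X (\<lambda>q. f (shadow q))"
  by (rule smooth_map_on_compose[OF smooth_map_on_shadow smooth_on_imp_smooth_map_on[OF open_UNIV _ subset_UNIV]]) auto

lemma smooth_F: "smooth_on UNIV F"
  unfolding F_def[abs_def]
  by (rule smooth_map_on_open[OF open_UNIV]) (intro smooth_intros smooth_map_on_comp_shadow smooth)

lemma DF: "(F has_derivative (\<lambda>v. 2 * q $ 3 * v $ 3 - (\<psi>x (shadow q) * v $ 1 + \<psi>y (shadow q) * v $ 2))) (at q)"
proof -
  have s: "(shadow has_derivative shadow) (at q)"
    unfolding shadow_def[abs_def] Complex_eq
    by (auto intro!: derivative_eq_intros bounded_linear.has_derivative[OF bounded_linear_vec_nth])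
  have "((\<lambda>q. \<psi> (shadow q)) has_derivative (\<lambda>v. Re (shadow v) * \<psi>x (shadow q) + Im (shadow v) * \<psi>y (shadow q))) (at q)"
    using diff_chain_at[OF s D\<psi>] by (simp add: o_def)
  then show ?thesis
    unfolding F_def[abs_def]
    by (auto intro!: derivative_eq_intros bounded_linear.has_derivative[OF bounded_linear_vec_nth] simp: shadow_def mult.commute)
qed

lemma frechet_F: "frechet_derivative F (at q) v = 2 * q $ 3 * v $ 3 - (\<psi>x (shadow q) * v $ 1 + \<psi>y (shadow q) * v $ 2)"
  unfolding frechet_derivative_at[OF DF, symmetric] ..

lemma F_regular: assumes "F q = 0" shows "\<exists>v. frechet_derivative F (at q) v \<noteq> 0"
proof (cases "q $ 3 = 0")
  case True
  then have "\<psi> (shadow q) = 0" using assms by (simp add: F_def)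
  then have n: "(\<psi>x (shadow q))\<^sup>2 + (\<psi>y (shadow q))\<^sup>2 > 0" by (rule grad_nonzero)
  then show ?thesis
    by (intro exI[of _ "vec3 (\<psi>x (shadow q)) (\<psi>y (shadow q)) 0"]) (auto simp: frechet_F power2_eq_square)
next
  case False
  then show ?thesis by (intro exI[of _ "vec3 0 0 1"]) (simp add: frechet_F)
qed

lemma orientable_\<Sigma>: "orientable_surface \<Sigma>"
  unfolding \<Sigma>_eq by (rule orientable_surface_level_set[OF smooth_F F_regular])

text \<open>On the surface the generating family has the value \<open>S = - 2/3 * k * w ^ 3\<close>,
  and the momenta \<open>- k * w * \<psi>x\<close>, \<open>- k * w * \<psi>y\<close> pair with the
  differentials of the positions to \<open>dS\<close>. The first entry has real part
  \<open>- S + \<epsilon> * Re e\<close> and imaginary part \<tau>. Scaling the momenta by the same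
  \<tau> cancels both contributions of \<open>dS\<close> and leaves \<epsilon>\<tau> times the
  differential of \<open>Re e\<close>.\<close>

definition f :: "complex \<times> (real^3) \<Rightarrow> complex^3" where
  "f p = (let e = fst p; q = snd p; \<tau> = 1 + \<epsilon> * Im e in
     \<chi> j. if j = 1 then Complex (2/3 * k * (q $ 3)^3 + \<epsilon> * Re e) \<tau>
          else if j = 2 then Complex (q $ 1) (- (\<tau> * k * (q $ 3) * \<psi>x (shadow q)))
          else Complex (q $ 2) (- (\<tau> * k * (q $ 3) * \<psi>y (shadow q))))"

lemma f_nth:
  "f p $ 1 = Complex (2/3 * k * (snd p $ 3)^3 + \<epsilon> * Re (fst p)) (1 + \<epsilon> * Im (fst p))"
  "f p $ 2 = Complex (snd p $ 1) (- ((1 + \<epsilon> * Im (fst p)) * k * (snd p $ 3) * \<psi>x (shadow (snd p))))"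
  "f p $ 3 = Complex (snd p $ 2) (- ((1 + \<epsilon> * Im (fst p)) * k * (snd p $ 3) * \<psi>y (shadow (snd p))))"
  by (simp_all add: f_def Let_def)

lemma smooth_f: "smooth_map_on X f"
proof -
  have s: "smooth_map_on X (\<lambda>p. g (shadow (snd p)))" if "smooth_on UNIV g" for g :: "complex \<Rightarrow> real" and X :: "(complex \<times> (real^3)) set"
    by (rule smooth_map_on_compose[OF smooth_map_on_snd[OF smooth_map_on_id] smooth_map_on_comp_shadow[OF that, of UNIV]]) auto
  have c: "smooth_map_on X (\<lambda>p. f p $ j)" for j
    using exhaust_3[of j]
    by (elim disjE; simp only: f_nth; intro smooth_intros s smooth_\<psi>x smooth_\<psi>y)
  have "smooth_map_on X (\<lambda>p. \<chi> j. f p $ j)" by (rule smooth_map_on_vec_lambda[OF c])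
  then show ?thesis by simp
qed

text \<open>The derivative of \<open>f\<close> in the direction \<open>(u, v)\<close>, given for all
  directions; tangency to the circle and to the surface enters later as linear conditions on
  \<open>u\<close> and \<open>v\<close>.\<close>

definition df :: "complex \<times> (real^3) \<Rightarrow> complex \<Rightarrow> real^3 \<Rightarrow> complex^3" where
  "df p u v = (let e = fst p; q = snd p; \<tau> = 1 + \<epsilon> * Im e; z = shadow q; w = q $ 3 in
     \<chi> j. if j = 1 then Complex (2 * k * w\<^sup>2 * v $ 3 + \<epsilon> * Re u) (\<epsilon> * Im u)
          else if j = 2 then Complex (v $ 1) (- (\<epsilon> * Im u * k * w * \<psi>x z) - \<tau> * k * (v $ 3 * \<psi>x z + w * (\<psi>xx z * v $ 1 + \<psi>xy z * v $ 2)))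
          else Complex (v $ 2) (- (\<epsilon> * Im u * k * w * \<psi>y z) - \<tau> * k * (v $ 3 * \<psi>y z + w * (\<psi>xy z * v $ 1 + \<psi>yy z * v $ 2))))"

lemma df_nth:
  "df p u v $ 1 = Complex (2 * k * (snd p $ 3)\<^sup>2 * v $ 3 + \<epsilon> * Re u) (\<epsilon> * Im u)"
  "df p u v $ 2 = Complex (v $ 1) (- (\<epsilon> * Im u * k * snd p $ 3 * \<psi>x (shadow (snd p)))
     - (1 + \<epsilon> * Im (fst p)) * k * (v $ 3 * \<psi>x (shadow (snd p)) + snd p $ 3 * (\<psi>xx (shadow (snd p)) * v $ 1 + \<psi>xy (shadow (snd p)) * v $ 2)))"
  "df p u v $ 3 = Complex (v $ 2) (- (\<epsilon> * Im u * k * snd p $ 3 * \<psi>y (shadow (snd p)))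
     - (1 + \<epsilon> * Im (fst p)) * k * (v $ 3 * \<psi>y (shadow (snd p)) + snd p $ 3 * (\<psi>xy (shadow (snd p)) * v $ 1 + \<psi>yy (shadow (snd p)) * v $ 2)))"
  by (simp_all add: df_def Let_def)

lemma has_vector_derivative_f:
  assumes c: "(c has_vector_derivative u) (at t)" and q: "(q has_vector_derivative v) (at t)"
  shows "((\<lambda>t. f (c t, q t)) has_vector_derivative df (c t, q t) u v) (at t)"
proof (rule has_vector_derivative_vec)
  have qi: "((\<lambda>t. q t $ i) has_real_derivative v $ i) (at t)" for i
    using bounded_linear.has_vector_derivative[OF bounded_linear_vec_nth q]
    by (simp add: has_real_derivative_iff_has_vector_derivative)
  have ci: "((\<lambda>t. Re (c t)) has_real_derivative Re u) (at t)" "((\<lambda>t. Im (c t)) has_real_derivative Im u) (at t)"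
    using c by (auto simp: has_vector_derivative_complex_iff)
  have sh: "((\<lambda>t. shadow (q t)) has_vector_derivative shadow v) (at t)"
    unfolding shadow_def has_vector_derivative_complex_iff using qi by simp
  have g: "((\<lambda>t. g (shadow (q t))) has_real_derivative v $ 1 * gx (shadow (q t)) + v $ 2 * gy (shadow (q t))) (at t)"
    if "\<And>z. (g has_derivative (\<lambda>h. Re h * gx z + Im h * gy z)) (at z)" for g gx gy
    using vector_derivative_diff_chain_within[OF sh has_derivative_at_withinI[OF that]]
    by (simp add: o_def shadow_def has_real_derivative_iff_has_vector_derivative)
  note gx = g[OF D\<psi>x] and gy = g[OF D\<psi>y, folded \<psi>xy_eq]
  fix j :: 3
  consider "j = 1" | "j = 2" | "j = 3" using exhaust_3 by blast
  then show "((\<lambda>t. f (c t, q t) $ j) has_vector_derivative df (c t, q t) u v $ j) (at t)"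
  proof cases
    case 1
    show ?thesis unfolding 1 f_nth df_nth has_vector_derivative_complex_iff
      by (auto intro!: derivative_eq_intros c qi ci simp: power2_eq_square)
  next
    case 2
    show ?thesis unfolding 2 f_nth df_nth has_vector_derivative_complex_iff
      by (auto intro!: derivative_eq_intros c qi ci gx simp: algebra_simps)
  next
    case 3
    show ?thesis unfolding 3 f_nth df_nth has_vector_derivative_complex_iff
      by (auto intro!: derivative_eq_intros c qi ci gy simp: algebra_simps)
  qed
qed

text \<open>The symplectic form is a combination of the three constraints: two tangency equations of
  the surface and the parallelism of \<open>u\<close> and \<open>u'\<close>, both being tangent to
  the same point of the circle. The Hessian terms cancel by symmetry.\<close>

lemma symplectic_df:
  assumes v: "2 * snd p $ 3 * v $ 3 = \<psi>x (shadow (snd p)) * v $ 1 + \<psi>y (shadow (snd p)) * v $ 2"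
    and v': "2 * snd p $ 3 * v' $ 3 = \<psi>x (shadow (snd p)) * v' $ 1 + \<psi>y (shadow (snd p)) * v' $ 2"
    and u: "Re u * Im u' = Im u * Re u'"
  shows "std_symplectic (df p u v) (df p u' v') = 0"
proof -
  have "std_symplectic (df p u v) (df p u' v') =
     \<epsilon>^2 * (Re u * Im u' - Im u * Re u')
     + \<epsilon> * k * snd p $ 3 * Im u' * (2 * snd p $ 3 * v $ 3 - (\<psi>x (shadow (snd p)) * v $ 1 + \<psi>y (shadow (snd p)) * v $ 2))
     - \<epsilon> * k * snd p $ 3 * Im u * (2 * snd p $ 3 * v' $ 3 - (\<psi>x (shadow (snd p)) * v' $ 1 + \<psi>y (shadow (snd p)) * v' $ 2))
     + (1 + \<epsilon> * Im (fst p)) * k * (v $ 3 * (\<psi>x (shadow (snd p)) * v' $ 1 + \<psi>y (shadow (snd p)) * v' $ 2 - 2 * snd p $ 3 * v' $ 3)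
        - v' $ 3 * (\<psi>x (shadow (snd p)) * v $ 1 + \<psi>y (shadow (snd p)) * v $ 2 - 2 * snd p $ 3 * v $ 3))"
    unfolding std_symplectic_def sum_3 df_nth complex.sel by (simp add: algebra_simps power2_eq_square)
  also have "\<dots> = 0" using u v v' by simp
  finally show ?thesis .
qed

end

text \<open>A nonzero complex determinant makes the columns linearly independent over the complex
  numbers, so also over the reals, where the span is formed.\<close>

lemma dim_span_columns:
  fixes v :: "'n::finite \<Rightarrow> complex^'n"
  assumes "det (\<chi> i j. v j $ i) \<noteq> 0"
  shows "dim (span (range v)) = CARD('n)"
proof -
  let ?A = "(\<chi> i j. v j $ i) :: complex^'n^'n"
  let ?\<phi> = "\<lambda>c::real^'n. \<Sum>j\<in>UNIV. (c $ j) *\<^sub>R v j"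
  have lin: "linear ?\<phi>"
    by (rule linearI) (simp_all add: scaleR_add_left sum.distrib scaleR_sum_right)
  obtain A' where A': "A' ** ?A = mat 1"
    using assms unfolding invertible_det_nz[symmetric] invertible_def by blast
  have "c = 0" if "?\<phi> c = 0" for c
  proof -
    let ?c = "\<chi> j. complex_of_real (c $ j)"
    have "?A *v ?c = 0"
    proof (rule vec_eq_iff[THEN iffD2], rule allI)
      fix i
      have "(?A *v ?c) $ i = ?\<phi> c $ i"
        unfolding matrix_vector_mult_def sum_component vector_scaleR_component
        by (simp add: scaleR_conv_of_real mult.commute)
      then show "(?A *v ?c) $ i = 0 $ i" using that by simp
    qed
    then have "?c = 0" using A' by (metis matrix_vector_mul_assoc matrix_vector_mul_lid matrix_vector_mult_0_right)
    then show ?thesis by (simp add: vec_eq_iff)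
  qed
  then have inj: "inj ?\<phi>" using linear_injective_0[OF lin] by blast
  have "range ?\<phi> = span (range v)"
  proof (rule span_unique[symmetric])
    show "range v \<subseteq> range ?\<phi>"
    proof
      fix x assume "x \<in> range v"
      then obtain j where "x = v j" by auto
      also have "v j = ?\<phi> (axis j 1)" by (simp add: axis_def if_distrib[of "\<lambda>c. c *\<^sub>R _"] cong: if_cong)
      finally show "x \<in> range ?\<phi>" by blast
    qed
    show "subspace (range ?\<phi>)" using linear_subspace_image[OF lin subspace_UNIV] .
    show "range ?\<phi> \<subseteq> T" if "range v \<subseteq> T" "subspace T" for T
      using that by (auto intro!: subspace_sum subspace_scale)
  qed
  moreover have "dim (range ?\<phi>) = dim (UNIV :: (real^'n) set)"
    by (rule dim_image_eq[OF lin]) (use inj in \<open>simp add: inj_on_def\<close>)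
  ultimately show ?thesis by simp
qed

text \<open>An algebraic parametrisation of the circle near \<open>e\<close> with velocity
  \<open>\<alpha> *\<^sub>R (\<i> * e)\<close>. It uses only the square root, and the same formula
  provides the charts of the circle.\<close>

lemma has_vector_derivative_circle_arc:
  "((\<lambda>t. e * Complex (sqrt (1 - (\<alpha> * t)\<^sup>2)) (\<alpha> * t)) has_vector_derivative \<alpha> *\<^sub>R (\<i> * e)) (at 0)"
proof -
  have "((\<lambda>t. sqrt (1 - (\<alpha> * t)\<^sup>2)) has_real_derivative 0) (at 0)"
    by (auto intro!: derivative_eq_intros)
  moreover have "((\<lambda>t. \<alpha> * t) has_real_derivative \<alpha>) (at 0)"
    by (auto intro!: derivative_eq_intros)
  ultimately have "((\<lambda>t. Complex (sqrt (1 - (\<alpha> * t)\<^sup>2)) (\<alpha> * t)) has_vector_derivative Complex 0 \<alpha>) (at 0)"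
    unfolding has_vector_derivative_complex_iff by simp
  from has_vector_derivative_mult_right[OF this, of e]
  have "((\<lambda>t. e * Complex (sqrt (1 - (\<alpha> * t)\<^sup>2)) (\<alpha> * t)) has_vector_derivative e * Complex 0 \<alpha>) (at 0)" .
  moreover have "e * Complex 0 \<alpha> = \<alpha> *\<^sub>R (\<i> * e)" by (simp add: complex_eq_iff)
  ultimately show ?thesis by simp
qed

lemma smooth_circle_arc:
  "smooth_map_on {t. \<bar>\<alpha> * t\<bar> < 1} (\<lambda>t. e * Complex (sqrt (1 - (\<alpha> * t)\<^sup>2)) (\<alpha> * t))"
  by (intro smooth_intros smooth_map_on_sqrt) (auto simp: abs_square_less_1)

lemma norm_circle_arc: "norm e = 1 \<Longrightarrow> \<bar>s\<bar> \<le> 1 \<Longrightarrow> norm (e * Complex (sqrt (1 - s\<^sup>2)) s) = 1"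
proof -
  assume e: "norm e = 1" and s: "\<bar>s\<bar> \<le> 1"
  have "s\<^sup>2 \<le> 1" using s by (simp add: abs_square_le_1)
  then have "norm (Complex (sqrt (1 - s\<^sup>2)) s) = 1" by (simp add: cmod_def)
  then show ?thesis by (simp add: norm_mult e)
qed

context suspension
begin

lemma smooth_submanifold_M: "smooth_submanifold TYPE(real^3) M"
  unfolding smooth_submanifold_def
proof
  fix p assume "p \<in> M"
  then obtain e0 q0 where p: "p = (e0, q0)" "norm e0 = 1" "q0 \<in> \<Sigma>" by auto
  have "smooth_submanifold TYPE(real^2) \<Sigma>"
    using orientable_\<Sigma> by (simp add: orientable_surface_def)
  then obtain W2 and V2 :: "(real^2) set" where W2: "openin (top_of_set \<Sigma>) W2" "q0 \<in> W2" "open V2" "diffeomorphic_sets V2 W2"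
    using p(3) unfolding smooth_submanifold_def by meson
  then obtain \<phi> ch where h: "homeomorphism V2 W2 \<phi> ch" and sm: "smooth_map_on V2 \<phi>" "smooth_map_on W2 ch"
    unfolding diffeomorphic_sets_def by blast
  note hd = h[unfolded homeomorphism_def]
  define pr where "pr v = (axis 1 (v $ 2) + axis 2 (v $ 3) :: real^2)" for v :: "real^3"
  have pr_nth: "pr v $ 1 = v $ 2" "pr v $ 2 = v $ 3" for v by (simp_all add: pr_def axis_def)
  have pr_lin: "bounded_linear pr"
    unfolding pr_def[abs_def] by (intro bounded_linear_add bounded_linear_compose[OF bounded_linear_axis bounded_linear_vec_nth])
  define V where "V = {v::real^3. \<bar>v $ 1\<bar> < 1} \<inter> pr -` V2"
  define W where "W = {x \<in> M. 0 < Re (fst x * cnj e0)} \<inter> {x. snd x \<in> W2}"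
  \<comment> \<open>A product chart: the first parameter runs along the half circle around
    \<open>e0\<close>, the other two through a chart of the surface. The inverse reads the first
    parameter as the imaginary part of \<open>e * cnj e0\<close>, which is injective on the half
    circle where the real part is positive.\<close>
  define \<Phi> where "\<Phi> v = (e0 * Complex (sqrt (1 - (v $ 1)\<^sup>2)) (v $ 1), \<phi> (pr v))" for v
  define \<Psi> where "\<Psi> x = vec3 (Im (fst x * cnj e0)) (ch (snd x) $ 1) (ch (snd x) $ 2)" for x
  have W2S: "W2 \<subseteq> \<Sigma>" using openin_imp_subset[OF W2(1)] .
  have oV: "open V"
    unfolding V_def using linear_continuous_on[OF pr_lin, of UNIV] W2(3)
    by (intro open_Int open_Collect_less open_vimage continuous_intros)
  have oW: "openin (top_of_set M) W"
  proof -
    obtain T where T: "open T" "W2 = \<Sigma> \<inter> T" using W2(1) by (auto simp: openin_open)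
    have "open ({x::complex \<times> (real^3). 0 < Re (fst x * cnj e0)} \<inter> snd -` T)"
      using T(1) by (intro open_Int open_Collect_less open_vimage continuous_intros)
    moreover have "W = M \<inter> ({x. 0 < Re (fst x * cnj e0)} \<inter> snd -` T)" unfolding W_def T(2) by auto
    ultimately show ?thesis by (metis openin_open_Int)
  qed
  have ee: "e0 * cnj e0 = 1" using p(2) by (metis complex_norm_square mult_1 of_real_1 power2_eq_square)
  have \<Phi>W: "\<Phi> v \<in> W" "\<Psi> (\<Phi> v) = v" if "v \<in> V" for v
  proof -
    have v: "\<bar>v $ 1\<bar> < 1" "pr v \<in> V2" using that by (auto simp: V_def)
    have f: "fst (\<Phi> v) * cnj e0 = Complex (sqrt (1 - (v $ 1)\<^sup>2)) (v $ 1)"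
      unfolding \<Phi>_def fst_conv using ee by (metis mult.assoc mult.commute mult_1)
    have "(v $ 1)\<^sup>2 < 1" using v(1) by (simp add: abs_square_less_1)
    moreover have "\<phi> (pr v) \<in> W2" "ch (\<phi> (pr v)) = pr v" using hd v(2) by auto
    ultimately have w2: "snd (\<Phi> v) \<in> W2" "ch (snd (\<Phi> v)) = pr v" and "(v $ 1)\<^sup>2 < 1" by (auto simp: \<Phi>_def)
    have R: "0 < Re (fst (\<Phi> v) * cnj e0)" "Im (fst (\<Phi> v) * cnj e0) = v $ 1"
      unfolding f using \<open>(v $ 1)\<^sup>2 < 1\<close> by simp_all
    have "\<Phi> v \<in> M" using norm_circle_arc[OF p(2), of "v $ 1"] v(1) W2S w2(1) by (auto simp: \<Phi>_def)
    then show "\<Phi> v \<in> W" unfolding W_def using R(1) w2(1) by blast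
    show "\<Psi> (\<Phi> v) = v" unfolding \<Psi>_def R(2) w2(2) by (simp add: vec_eq_iff forall_3 pr_nth)
  qed
  have \<Psi>V: "\<Psi> x \<in> V" "\<Phi> (\<Psi> x) = x" if "x \<in> W" for x
  proof -
    obtain e q where x: "x = (e, q)" by (cases x)
    have e: "norm e = 1" "0 < Re (e * cnj e0)" and q: "q \<in> W2" using that by (auto simp: W_def x)
    let ?a = "e * cnj e0"
    have n: "norm ?a = 1" using e p(2) by (simp add: norm_mult)
    then have r: "(Re ?a)\<^sup>2 + (Im ?a)\<^sup>2 = 1" by (metis cmod_power2 one_power2)
    then have "(Im ?a)\<^sup>2 < 1" using zero_less_power[OF e(2), of 2] by linarith
    then have i: "\<bar>Im ?a\<bar> < 1" using abs_square_less_1 by blast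
    have s: "sqrt (1 - (Im ?a)\<^sup>2) = Re ?a" using r e(2) by (intro real_sqrt_unique) auto
    have prq: "pr (\<Psi> x) = ch q" by (simp add: vec_eq_iff forall_2 pr_nth \<Psi>_def x)
    have a1: "\<Psi> x $ 1 = Im ?a" by (simp add: \<Psi>_def x)
    have "ch q \<in> V2" "\<phi> (ch q) = q" using hd q by auto
    then show "\<Psi> x \<in> V" unfolding V_def using i by (simp add: a1 prq)
    have "Complex (Re ?a) (Im ?a) = ?a" by (rule complex_surj)
    then have "e0 * Complex (Re ?a) (Im ?a) = e" using ee by (metis mult.assoc mult.commute mult_1)
    then show "\<Phi> (\<Psi> x) = x" unfolding \<Phi>_def prq a1 s using \<open>\<phi> (ch q) = q\<close> by (simp only: x)
  qed
  have sV: "smooth_map_on V (\<lambda>v. \<phi> (pr v))"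
    by (rule smooth_map_on_compose[OF smooth_map_on_bounded_linear[OF pr_lin] sm(1)]) (auto simp: V_def)
  have s\<Phi>: "smooth_map_on V \<Phi>"
    unfolding \<Phi>_def by (intro smooth_intros smooth_map_on_sqrt sV) (auto simp: V_def abs_square_less_1)
  have sW: "smooth_map_on W (\<lambda>x. ch (snd x))"
    by (rule smooth_map_on_compose[OF smooth_map_on_snd[OF smooth_map_on_id] sm(2)]) (auto simp: W_def)
  have s\<Psi>: "smooth_map_on W \<Psi>"
  proof -
    have "smooth_map_on W (\<lambda>x. if i = 1 then Im (fst x * cnj e0) else if i = 2 then ch (snd x) $ 1 else ch (snd x) $ 2)" for i :: 3
      by (cases "i = 1"; cases "i = 2"; simp; intro smooth_intros sW)
    then show ?thesis unfolding \<Psi>_def[abs_def] vec3_def by (intro smooth_map_on_vec_lambda)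
  qed
  have "homeomorphism V W \<Phi> \<Psi>"
  proof (rule homeomorphismI)
    show "continuous_on V \<Phi>" "continuous_on W \<Psi>"
      by (rule smooth_map_on_continuous[OF s\<Phi>] smooth_map_on_continuous[OF s\<Psi>])+
    show "\<Phi> ` V \<subseteq> W" "\<Psi> ` W \<subseteq> V" by (intro image_subsetI \<Phi>W(1) \<Psi>V(1); assumption)+
  qed (fact \<Phi>W(2) \<Psi>V(2))+
  then have "diffeomorphic_sets V W" unfolding diffeomorphic_sets_def using s\<Phi> s\<Psi> by blast
  moreover have "p \<in> W"
  proof -
    have "Re (fst p * cnj e0) = 1" by (simp only: p(1) fst_conv ee one_complex.sel)
    then have "0 < Re (fst p * cnj e0)" by linarith
    moreover have "p \<in> M" "snd p \<in> W2" using p W2(2) by auto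
    ultimately show ?thesis unfolding W_def by blast
  qed
  ultimately show "\<exists>W. openin (top_of_set M) W \<and> p \<in> W \<and> (\<exists>V::(real^3) set. open V \<and> diffeomorphic_sets V W)"
    using oW oV by blast
qed

lemma tangent_\<Sigma>: "q \<in> \<Sigma> \<Longrightarrow> tangent_space \<Sigma> q
   = {v. 2 * q $ 3 * v $ 3 = \<psi>x (shadow q) * v $ 1 + \<psi>y (shadow q) * v $ 2}"
proof -
  assume "q \<in> \<Sigma>"
  then have q: "F q = 0" by (simp add: \<Sigma>_eq)
  obtain v0 where "frechet_derivative F (at q) v0 \<noteq> 0" using F_regular[OF q] by blast
  from tangent_space_level_set[OF smooth_F q this] show ?thesis
    unfolding \<Sigma>_eq by (simp add: frechet_F)
qed

text \<open>The circle contributes exactly the multiples of \<open>\<i> * e\<close>, by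
  differentiating its equation, and the surface exactly its tangent vectors. Conversely every such
  pair must be realised by one curve, for which the circle arc is run alongside a curve in the
  surface.\<close>

lemma velocities_M:
  assumes p: "(e, q) \<in> M"
  shows "{vector_derivative (\<lambda>t. f (\<gamma> t)) (at 0) | \<gamma>. smooth_curve_in M \<gamma> \<and> \<gamma> 0 = (e, q)}
     = {df (e, q) (\<alpha> *\<^sub>R (\<i> * e)) v | \<alpha> v. 2 * q $ 3 * v $ 3 = \<psi>x (shadow q) * v $ 1 + \<psi>y (shadow q) * v $ 2}"
    (is "?L = ?R")
proof (intro equalityI subsetI)
  fix x assume "x \<in> ?L"
  then obtain \<gamma> where x: "x = vector_derivative (\<lambda>t. f (\<gamma> t)) (at 0)" and \<gamma>: "smooth_curve_in M \<gamma>" "\<gamma> 0 = (e, q)" by blast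
  obtain r where r: "r > 0" "\<gamma> ` {-r<..<r} \<subseteq> M" using \<gamma>(1) unfolding smooth_curve_in_def by blast
  obtain u v where uv: "vector_derivative \<gamma> (at 0) = (u, v)" by (cases "vector_derivative \<gamma> (at 0)")
  have d: "(\<gamma> has_vector_derivative (u, v)) (at 0)" using smooth_curve_in_has_vector_derivative[OF \<gamma>(1)] by (simp add: uv)
  have dc: "((\<lambda>t. fst (\<gamma> t)) has_vector_derivative u) (at 0)" and dq: "((\<lambda>t. snd (\<gamma> t)) has_vector_derivative v) (at 0)"
    using bounded_linear.has_vector_derivative[OF bounded_linear_fst d] bounded_linear.has_vector_derivative[OF bounded_linear_snd d] by auto
  have "smooth_curve_in \<Sigma> (\<lambda>t. snd (\<gamma> t))"
    by (rule smooth_curve_in_compose[OF \<gamma>(1) smooth_map_on_snd[OF smooth_map_on_id]]) auto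
  then have "vector_derivative (\<lambda>t. snd (\<gamma> t)) (at 0) \<in> tangent_space \<Sigma> q"
    unfolding tangent_space_def using \<gamma>(2) by (auto intro!: exI[of _ "\<lambda>t. snd (\<gamma> t)"])
  then have v: "2 * q $ 3 * v $ 3 = \<psi>x (shadow q) * v $ 1 + \<psi>y (shadow q) * v $ 2"
    using p vector_derivative_at[OF dq] by (auto simp: tangent_\<Sigma>)
  have dr: "((\<lambda>t. Re (fst (\<gamma> t))) has_real_derivative Re u) (at 0)" "((\<lambda>t. Im (fst (\<gamma> t))) has_real_derivative Im u) (at 0)"
    using dc unfolding has_vector_derivative_complex_iff by auto
  have "((\<lambda>t. (Re (fst (\<gamma> t)))\<^sup>2 + (Im (fst (\<gamma> t)))\<^sup>2) has_real_derivative 2 * (Re e * Re u + Im e * Im u)) (at 0)"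
    using DERIV_add[OF DERIV_power[OF dr(1), of 2] DERIV_power[OF dr(2), of 2]] \<gamma>(2)
    by (simp add: algebra_simps)
  moreover have "((\<lambda>t. (Re (fst (\<gamma> t)))\<^sup>2 + (Im (fst (\<gamma> t)))\<^sup>2) has_real_derivative 0) (at 0)"
  proof (rule DERIV_cong_ev[THEN iffD1, OF refl _ refl DERIV_const[of 1]])
    have "eventually (\<lambda>t. t \<in> {-r<..<r}) (nhds (0::real))" using r by (intro eventually_nhds_in_open) auto
    then show "eventually (\<lambda>t. 1 = (Re (fst (\<gamma> t)))\<^sup>2 + (Im (fst (\<gamma> t)))\<^sup>2) (nhds 0)"
    proof eventually_elim
      case (elim t)
      then have "\<gamma> t \<in> M" using r(2) by blast
      then have "norm (fst (\<gamma> t)) = 1" by (auto simp: mem_Times_iff)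
      then show ?case by (metis cmod_power2 one_power2)
    qed
  qed
  ultimately have o: "Re e * Re u + Im e * Im u = 0" using DERIV_unique by fastforce
  \<comment> \<open>The component of \<open>u\<close> along \<open>\<i> * e\<close>. The radial
    component vanishes by \<open>o\<close>, and the unit norm of \<open>e\<close> then recovers
    \<open>u\<close>.\<close>
  define \<alpha> where "\<alpha> = Re e * Im u - Im e * Re u"
  have ne: "(Re e)\<^sup>2 + (Im e)\<^sup>2 = 1" using p by (auto simp: cmod_power2[symmetric])
  have "Re u = - \<alpha> * Im e" "Im u = \<alpha> * Re e"
  proof -
    have "Re u = Re u * ((Re e)\<^sup>2 + (Im e)\<^sup>2) - Re e * (Re e * Re u + Im e * Im u)"
      "Im u = Im u * ((Re e)\<^sup>2 + (Im e)\<^sup>2) - Im e * (Re e * Re u + Im e * Im u)" by (simp_all add: o ne)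
    then show "Re u = - \<alpha> * Im e" "Im u = \<alpha> * Re e"
      unfolding \<alpha>_def by (simp_all add: power2_eq_square algebra_simps)
  qed
  then have u: "u = \<alpha> *\<^sub>R (\<i> * e)" by (simp add: complex_eq_iff)
  have "x = df (e, q) u v"
    unfolding x using has_vector_derivative_f[OF dc dq] \<gamma>(2) by (simp add: vector_derivative_at)
  then show "x \<in> ?R" using u v by blast
next
  fix x assume "x \<in> ?R"
  then obtain \<alpha> v where x: "x = df (e, q) (\<alpha> *\<^sub>R (\<i> * e)) v" and "2 * q $ 3 * v $ 3 = \<psi>x (shadow q) * v $ 1 + \<psi>y (shadow q) * v $ 2" by blast
  then have "v \<in> tangent_space \<Sigma> q" using p by (simp add: tangent_\<Sigma>)
  then obtain \<beta> where \<beta>: "v = vector_derivative \<beta> (at 0)" "smooth_curve_in \<Sigma> \<beta>" "\<beta> 0 = q"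
    unfolding tangent_space_def by blast
  obtain r where r: "r > 0" "smooth_on {-r<..<r} \<beta>" "\<beta> ` {-r<..<r} \<subseteq> \<Sigma>" using \<beta>(2) unfolding smooth_curve_in_def by blast
  let ?c = "\<lambda>t. e * Complex (sqrt (1 - (\<alpha> * t)\<^sup>2)) (\<alpha> * t)"
  \<comment> \<open>The interval is shortened until \<open>\<bar>\<alpha> * t\<bar> < 1\<close>,
    where the arc is defined; the summand 1 covers the case \<alpha> = 0.\<close>
  define s where "s = min r (1 / (\<bar>\<alpha>\<bar> + 1))"
  have s: "s > 0" "s \<le> r" using r by (auto simp: s_def)
  have small: "\<bar>\<alpha> * t\<bar> < 1" if "t \<in> {-s<..<s}" for t
  proof -
    have "\<bar>t\<bar> < 1 / (\<bar>\<alpha>\<bar> + 1)" using that by (auto simp: s_def)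
    then have "\<bar>t\<bar> * (\<bar>\<alpha>\<bar> + 1) < 1" by (simp add: field_simps)
    moreover have "\<bar>\<alpha>\<bar> * \<bar>t\<bar> \<le> \<bar>t\<bar> * (\<bar>\<alpha>\<bar> + 1)" by (simp add: algebra_simps)
    ultimately show ?thesis by (simp add: abs_mult)
  qed
  have "smooth_map_on {-s<..<s} (\<lambda>t. (?c t, \<beta> t))"
    by (intro smooth_map_on_Pair smooth_map_on_subset[OF smooth_circle_arc]
        smooth_on_imp_smooth_map_on[OF _ r(2)]) (use small s in auto)
  then have "smooth_on {-s<..<s} (\<lambda>t. (?c t, \<beta> t))" by (intro smooth_map_on_open) auto
  moreover have "(?c t, \<beta> t) \<in> M" if "t \<in> {-s<..<s}" for t
    using norm_circle_arc[of e "\<alpha> * t"] p small[OF that] r(3) that s by (auto simp: image_subset_iff)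
  ultimately have cu: "smooth_curve_in M (\<lambda>t. (?c t, \<beta> t))"
    unfolding smooth_curve_in_def using s(1) by blast
  have c0: "?c 0 = e" by (simp add: complex_eq_iff)
  have "((\<lambda>t. f (?c t, \<beta> t)) has_vector_derivative df (?c 0, \<beta> 0) (\<alpha> *\<^sub>R (\<i> * e)) v) (at 0)"
    by (rule has_vector_derivative_f[OF has_vector_derivative_circle_arc])
       (use smooth_curve_in_has_vector_derivative[OF \<beta>(2)] \<beta>(1) in simp)
  from vector_derivative_at[OF this[unfolded c0 \<beta>(3)]]
  have "x = vector_derivative (\<lambda>t. f (?c t, \<beta> t)) (at 0)" unfolding x by (rule sym)
  moreover have "(?c 0, \<beta> 0) = (e, q)" by (simp only: c0 \<beta>(3))
  ultimately show "x \<in> ?L" using cu by (intro CollectI exI[of _ "\<lambda>t. (?c t, \<beta> t)"] conjI)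
qed

end

lemma det_squared_span_eq:
  fixes v :: "'n::finite \<Rightarrow> complex^'n"
  assumes lag: "\<And>x y. x \<in> span (range v) \<Longrightarrow> y \<in> span (range v) \<Longrightarrow> std_symplectic x y = 0"
    and D: "det (\<chi> i j. v j $ i) = of_real r * d" "r \<noteq> 0" "d \<noteq> 0"
  shows "det_squared (span (range v)) = (d / norm d)\<^sup>2"
proof -
  have nz: "det (\<chi> i j. v j $ i) \<noteq> 0" using D by simp
  have "det_squared (span (range v)) = (det (\<chi> i j. v j $ i) / norm (det (\<chi> i j. v j $ i)))\<^sup>2"
    by (rule det_squared_eq[OF subspace_span dim_span_columns[OF nz] lag _ nz]) (auto intro: span_base)
  moreover have "(complex_of_real \<bar>r\<bar>)\<^sup>2 = (complex_of_real r)\<^sup>2" by (metis of_real_power power2_abs)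
  ultimately show ?thesis using D(2)
    by (simp add: D(1) norm_mult power_divide power_mult_distrib)
qed

lemma smooth_map_on_vec3:
  assumes "smooth_map_on X f" "smooth_map_on X g" "smooth_map_on X h"
  shows "smooth_map_on X (\<lambda>x. vec3 (f x) (g x) (h x))"
  unfolding vec3_def
proof (rule smooth_map_on_vec_lambda)
  fix i :: 3
  show "smooth_map_on X (\<lambda>x. if i = 1 then f x else if i = 2 then g x else h x)"
    using assms by (cases "i = 1"; cases "i = 2") auto
qed

context suspension
begin

section \<open>The phase of a tangent frame\<close>

definition "grad2 z = (\<psi>x z)\<^sup>2 + (\<psi>y z)\<^sup>2"
definition "hess_trace z = \<psi>xx z + \<psi>yy z"
definition "hess_det z = \<psi>xx z * \<psi>yy z - (\<psi>xy z)\<^sup>2"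
text \<open>The adjugate of the Hessian as a quadratic form on the gradient; equivalently the
  Hessian evaluated on the gradient turned by a right angle.\<close>

definition "hess_adj z = \<psi>yy z * (\<psi>x z)\<^sup>2 - 2 * \<psi>xy z * \<psi>x z * \<psi>y z + \<psi>xx z * (\<psi>y z)\<^sup>2"

text \<open>The complex determinant of a tangent frame at \<open>f (e, q)\<close> is \<open>\<i> * e * phase_factor e q\<close>
  up to a nonzero real factor.\<close>

definition phase_factor :: "complex \<Rightarrow> real^3 \<Rightarrow> complex" where
  "phase_factor e q = (let z = shadow q; w = q $ 3; \<tau> = 1 + \<epsilon> * Im e in
     Complex (2 * w - \<tau>\<^sup>2 * k\<^sup>2 * (w * hess_adj z + 2 * w ^ 3 * hess_det z))
             (- (\<tau> * k * grad2 z) - 2 * \<tau> * k * w\<^sup>2 * hess_trace z)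
     + cnj e * of_real (2 * k\<^sup>2 * w ^ 3 * Re e) * Complex (grad2 z) (- (\<tau> * k * w * hess_adj z)))"

text \<open>The two surface vectors solve the tangency equation with prescribed shadow components.
  They become parallel at the fold, where the real factor \<open>2 * q $ 3 * \<epsilon>\<close>
  vanishes. Dividing it out leaves a phase that extends over the fold.\<close>

lemma det_frame_generic:
  assumes "norm e = 1"
  shows "det (\<chi> i j. (\<lambda>j::3. if j = 1 then df (e, q) (\<i> * e) 0
      else if j = 2 then df (e, q) 0 (vec3 (2 * q $ 3) 0 (\<psi>x (shadow q)))
      else df (e, q) 0 (vec3 0 (2 * q $ 3) (\<psi>y (shadow q)))) j $ i)
     = of_real (2 * q $ 3 * \<epsilon>) * (\<i> * e * phase_factor e q)"
proof -
  have ee: "e * cnj e = 1" using assms by (metis complex_norm_square mult_1 of_real_1 power2_eq_square)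
  define c s where "c = Re e" and "s = Im e"
  define \<tau> where "\<tau> = 1 + \<epsilon> * s"
  define w X Y A B C where "w = q $ 3" and "X = \<psi>x (shadow q)" and "Y = \<psi>y (shadow q)"
    and "A = \<psi>xx (shadow q)" and "B = \<psi>xy (shadow q)" and "C = \<psi>yy (shadow q)"
  have r: "\<i> * e * phase_factor e q = \<i> * (e * Complex (2 * w - \<tau>\<^sup>2 * k\<^sup>2 * (w * (C * X\<^sup>2 - 2 * B * X * Y + A * Y\<^sup>2) + 2 * w ^ 3 * (A * C - B\<^sup>2)))
             (- (\<tau> * k * (X\<^sup>2 + Y\<^sup>2)) - 2 * \<tau> * k * w\<^sup>2 * (A + C))
     + of_real (2 * k\<^sup>2 * w ^ 3 * c) * Complex (X\<^sup>2 + Y\<^sup>2) (- (\<tau> * k * w * (C * X\<^sup>2 - 2 * B * X * Y + A * Y\<^sup>2))))"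
  proof -
    \<comment> \<open>Multiplying through by \<open>e\<close> removes \<open>cnj e\<close>. This is
      where the unit norm enters; what remains is a polynomial identity in \<open>c\<close>,
      \<open>s\<close>, \<open>w\<close> and the derivatives of \<psi>.\<close>
    have "\<i> * e * (P + cnj e * R * S) = \<i> * (e * P + (e * cnj e) * R * S)" for P R S by (simp add: algebra_simps)
    then show ?thesis unfolding phase_factor_def Let_def ee
      by (simp add: ee c_def s_def \<tau>_def w_def X_def Y_def A_def B_def C_def grad2_def hess_trace_def hess_det_def hess_adj_def)
  qed
  have e: "e = Complex c s" by (simp add: c_def s_def)
  show ?thesis
    unfolding r unfolding det_3
    apply (simp add: df_nth flip: w_def X_def Y_def A_def B_def C_def)
    unfolding e complex_eq_iff
    by (simp flip: \<tau>_def) (simp add: algebra_simps power2_eq_square power3_eq_cube)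
qed

text \<open>At the fold the tangent plane is spanned by the vertical direction and the gradient
  turned by a right angle. The same \<open>phase_factor\<close> appears, so one formula describes
  the Lagrangian phase on the whole surface.\<close>

lemma det_frame_fold:
  assumes "norm e = 1" "q $ 3 = 0"
  shows "det (\<chi> i j. (\<lambda>j::3. if j = 1 then df (e, q) (\<i> * e) 0
      else if j = 2 then df (e, q) 0 (vec3 (- \<psi>y (shadow q)) (\<psi>x (shadow q)) 0)
      else df (e, q) 0 (vec3 0 0 1)) j $ i)
     = of_real (- \<epsilon>) * (\<i> * e * phase_factor e q)"
  unfolding det_3 phase_factor_def Let_def
  by (simp add: df_nth assms(2) complex_eq_iff grad2_def power2_eq_square algebra_simps)

lemma df_linear: "df p (a *\<^sub>R u + b *\<^sub>R u') (a *\<^sub>R v + b *\<^sub>R v') = a *\<^sub>R df p u v + b *\<^sub>R df p u' v'"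
  by (simp add: vec_eq_iff forall_3 df_nth complex_eq_iff algebra_simps)

lemma smooth_on_comp_shadow_cont: "smooth_on UNIV g \<Longrightarrow> continuous_on S (\<lambda>q. g (shadow q))"
  using smooth_map_on_continuous[OF smooth_map_on_comp_shadow] .

end

text \<open>\<open>gap\<close> separates the double points over the critical points of \<open>\<psi>\<close>; \<open>slit\<close> makes the phase factor avoid
  the closed half-line of nonnegative imaginary numbers, so that it does not contribute to the Maslov index.\<close>

locale good_suspension = suspension +
  assumes k_pos: "k > 0" and eps: "0 < \<epsilon>" "\<epsilon> \<le> 1/2"
    and gap: "\<And>q. q \<in> double_graph \<psi> \<Longrightarrow> grad2 (shadow q) = 0 \<Longrightarrow> 2 * \<epsilon> < 4/3 * k * \<bar>q $ 3\<bar> ^ 3"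
    and slit: "\<And>e q. norm e = 1 \<Longrightarrow> q \<in> double_graph \<psi> \<Longrightarrow> Re (phase_factor e q) = 0 \<Longrightarrow> Im (phase_factor e q) < 0"
begin

lemma tau_pos: "norm e = 1 \<Longrightarrow> 1 + \<epsilon> * Im e > 0"
proof -
  assume "norm e = 1"
  then have "\<bar>Im e\<bar> \<le> 1" using abs_Im_le_cmod[of e] by simp
  then have "\<bar>\<epsilon> * Im e\<bar> \<le> 1/2 * 1" unfolding abs_mult using eps by (intro mult_mono) auto
  then show ?thesis by linarith
qed

section \<open>Embeddedness and the smooth inverse\<close>

text \<open>An inverse of \<open>f\<close> once the height \<open>w\<close> is known. Injectivity
  and smoothness of the inverse are thus reduced to the reconstruction of one real number.\<close>

definition recover :: "real \<Rightarrow> complex^3 \<Rightarrow> complex \<times> (real^3)" where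
  "recover w p = (Complex ((Re (p $ 1) - 2/3 * k * w ^ 3) / \<epsilon>) ((Im (p $ 1) - 1) / \<epsilon>), vec3 (Re (p $ 2)) (Re (p $ 3)) w)"

lemma recover_f: "recover (q $ 3) (f (e, q)) = (e, q)"
  using eps by (simp add: recover_def f_nth complex_eq_iff vec_eq_iff forall_3)

lemma shadow_f: "Complex (Re (f (e, q) $ 2)) (Re (f (e, q) $ 3)) = shadow q"
  by (simp add: f_nth shadow_def)

text \<open>Pairing the two momenta with the gradient gives the height times
  \<open>- \<tau> * k * grad2\<close>, and \<tau> itself is read off as the imaginary part of the
  first entry.\<close>

lemma height_f:
  assumes "norm e = 1" "grad2 (shadow q) \<noteq> 0"
  shows "q $ 3 = - (Im (f (e, q) $ 2) * \<psi>x (shadow q) + Im (f (e, q) $ 3) * \<psi>y (shadow q)) / (Im (f (e, q) $ 1) * k * grad2 (shadow q))"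
proof -
  have "- (Im (f (e, q) $ 2) * \<psi>x (shadow q) + Im (f (e, q) $ 3) * \<psi>y (shadow q)) = q $ 3 * (Im (f (e, q) $ 1) * k * grad2 (shadow q))"
    by (simp add: f_nth grad2_def algebra_simps power2_eq_square)
  moreover have "Im (f (e, q) $ 1) * k * grad2 (shadow q) \<noteq> 0"
    using tau_pos[OF assms(1)] assms(2) k_pos by (simp add: f_nth)
  ultimately show ?thesis by simp
qed

lemma inj_f: "inj_on f M"
proof (rule inj_onI)
  fix p p' assume "p \<in> M" "p' \<in> M" and eq: "f p = f p'"
  then obtain e q e' q' where p: "p = (e, q)" "p' = (e', q')" and e: "norm e = 1" "norm e' = 1" and q: "q \<in> \<Sigma>" "q' \<in> \<Sigma>" by auto
  have sh: "shadow q = shadow q'" using shadow_f[of e q] shadow_f[of e' q'] eq p by simp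
  have "q $ 3 = q' $ 3"
  proof (cases "grad2 (shadow q) = 0")
    case False
    then show ?thesis using height_f[of e q] height_f[of e' q'] e eq p sh by simp
  next
    case True
    show ?thesis
    proof (rule ccontr)
      assume ne: "q $ 3 \<noteq> q' $ 3"
      have "(q $ 3)\<^sup>2 = (q' $ 3)\<^sup>2" using q sh by (simp add: double_graph_def)
      then have op: "q' $ 3 = - (q $ 3)" using ne by (simp add: power2_eq_iff)
      have "Re (f (e, q) $ 1) = Re (f (e', q') $ 1)" using eq p by simp
      then have "4/3 * k * (q $ 3)^3 = \<epsilon> * (Re e' - Re e)" by (simp add: f_nth op algebra_simps)
      then have "4/3 * k * \<bar>q $ 3\<bar>^3 = \<epsilon> * \<bar>Re e' - Re e\<bar>"
      proof -
        have "\<bar>4/3 * k * (q $ 3)^3\<bar> = \<bar>\<epsilon> * (Re e' - Re e)\<bar>" by (simp only: \<open>4/3 * k * (q $ 3)^3 = _\<close>)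
        then show ?thesis using k_pos eps by (simp add: abs_mult power_abs)
      qed
      also have "\<dots> \<le> \<epsilon> * 2"
        using eps abs_Re_le_cmod[of e] abs_Re_le_cmod[of e'] e by (intro mult_left_mono) auto
      finally show False using gap[OF q(1) True] by simp
    qed
  qed
  then have "recover (q $ 3) (f p) = recover (q' $ 3) (f p')" by (simp only: eq)
  then show "p = p'" unfolding p recover_f .
qed

abbreviation "L \<equiv> f ` M"

definition "finv = inv_into M f"

lemma homeomorphism_f: "homeomorphism M L f finv"
proof -
  have "compact M" using compact_\<Sigma> by (intro compact_Times) auto
  then obtain g where g: "homeomorphism M L f g"
    using homeomorphism_compact[OF _ smooth_map_on_continuous[OF smooth_f] refl inj_f] by blast
  moreover have "g y = finv y" if "y \<in> L" for y
    using that g inj_f by (auto simp: finv_def homeomorphism_def)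
  ultimately show ?thesis by (auto intro!: homeomorphism_cong[OF g])
qed

lemma finv_f: "p \<in> M \<Longrightarrow> finv (f p) = p"
  using homeomorphism_f by (auto simp: homeomorphism_def)

lemma smooth_map_on_recover: "smooth_map_on X w \<Longrightarrow> smooth_map_on X (\<lambda>p. recover (w p) p)"
  unfolding recover_def using eps
  by (intro smooth_intros smooth_map_on_vec3 smooth_map_on_divide) auto

text \<open>Two local formulas for the height cover the image. Where the gradient is nonzero, the
  height is a quotient of image coordinates. Where it vanishes, \<psi> is positive and the height is
  a signed square root of \<psi>. By \<open>regular\<close> there is no point at which both
  fail.\<close>

lemma smooth_finv: "smooth_map_on L finv"
proof (rule smooth_map_on_local)
  fix p assume "p \<in> L"
  then obtain e q where p: "p = f (e, q)" and e: "norm e = 1" and q: "q \<in> \<Sigma>" by auto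
  let ?z = "\<lambda>p::complex^3. Complex (Re (p $ 2)) (Re (p $ 3))"
  have sz: "smooth_map_on X (\<lambda>p. g (?z p))" if "smooth_on UNIV g" for g :: "complex \<Rightarrow> real" and X
    by (rule smooth_map_on_compose[OF _ smooth_on_imp_smooth_map_on[OF open_UNIV that subset_UNIV, of UNIV]])
       (intro smooth_intros, simp)
  have cz: "continuous_on UNIV (\<lambda>p. g (?z p))" if "smooth_on UNIV g" for g :: "complex \<Rightarrow> real"
    using smooth_map_on_continuous[OF sz[OF that]] .
  have fr: "finv (f (e', q')) = recover (q' $ 3) (f (e', q'))" if "norm e' = 1" "q' \<in> \<Sigma>" for e' q'
    using finv_f[of "(e', q')"] that recover_f[of q' e'] by simp
  show "\<exists>U. open U \<and> p \<in> U \<and> smooth_map_on (L \<inter> U) finv"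
  proof (cases "grad2 (shadow q) = 0")
    case False
    let ?U = "{p::complex^3. grad2 (?z p) \<noteq> 0} \<inter> {p. Im (p $ 1) \<noteq> 0}"
    let ?w = "\<lambda>p. - (Im (p $ 2) * \<psi>x (?z p) + Im (p $ 3) * \<psi>y (?z p)) / (Im (p $ 1) * k * grad2 (?z p))"
    have "open ?U" unfolding grad2_def
      by (intro open_Int open_Collect_neq continuous_intros cz smooth_\<psi>x smooth_\<psi>y)
    moreover have "p \<in> ?U" using False tau_pos[OF e] by (simp add: p shadow_f) (simp add: f_nth)
    moreover have "smooth_map_on (L \<inter> ?U) finv"
    proof (rule smooth_map_on_cong)
      show "smooth_map_on (L \<inter> ?U) (\<lambda>p. recover (?w p) p)"
        using k_pos unfolding grad2_def
        by (intro smooth_map_on_recover smooth_map_on_divide smooth_intros sz smooth_\<psi>x smooth_\<psi>y) auto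
      fix p' assume p': "p' \<in> L \<inter> ?U"
      then obtain e' q' where pq: "p' = f (e', q')" "norm e' = 1" "q' \<in> \<Sigma>" by auto
      then have "grad2 (shadow q') \<noteq> 0" using p' by (simp add: shadow_f)
      from height_f[OF pq(2) this] have "?w p' = q' $ 3" by (simp add: pq(1) shadow_f)
      then show "recover (?w p') p' = finv p'" using fr[OF pq(2,3)] pq(1) by simp
    qed
    ultimately show ?thesis by blast
  next
    case True
    then have "\<psi> (shadow q) \<noteq> 0" using grad_nonzero[of "shadow q"] by (auto simp: grad2_def)
    then have q3: "q $ 3 \<noteq> 0" using q by (auto simp: double_graph_def)
    define s where "s = sgn (q $ 3)"
    have s: "s = 1 \<or> s = -1" "s * q $ 3 > 0" using q3 by (auto simp: s_def sgn_if)
    \<comment> \<open>The two sheets have the same shadow, so the sign of the height must be kept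
      fixed on a neighbourhood in the image. Continuity of the inverse, obtained from compactness,
      makes that neighbourhood open.\<close>
    have "continuous_on L (\<lambda>p. s * snd (finv p) $ 3)"
      using homeomorphism_f by (intro continuous_intros) (auto simp: homeomorphism_def)
    then have "openin (top_of_set L) (L \<inter> (\<lambda>p. s * snd (finv p) $ 3) -` {0<..})"
      by (rule continuous_openin_preimage_gen) auto
    then obtain T where T: "open T" "L \<inter> (\<lambda>p. s * snd (finv p) $ 3) -` {0<..} = L \<inter> T"
      by (auto simp: openin_open)
    let ?U = "T \<inter> {p. 0 < \<psi> (?z p)}"
    have "open ?U" by (intro open_Int T open_Collect_less continuous_intros cz smooth)
    moreover have "p \<in> ?U"
    proof -
      have "p \<in> L \<inter> (\<lambda>p. s * snd (finv p) $ 3) -` {0<..}" using finv_f[of "(e, q)"] e q s by (auto simp: p)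
      moreover have "\<psi> (shadow q) > 0"
      proof -
        have "\<psi> (shadow q) = (q $ 3)\<^sup>2" using q by (simp add: double_graph_def)
        then show ?thesis using q3 by simp
      qed
      ultimately show ?thesis using T(2) by (auto simp: p shadow_f)
    qed
    moreover have "smooth_map_on (L \<inter> ?U) finv"
    proof (rule smooth_map_on_cong)
      show "smooth_map_on (L \<inter> ?U) (\<lambda>p. recover (s * sqrt (\<psi> (?z p))) p)"
        by (intro smooth_map_on_recover smooth_map_on_sqrt smooth_intros sz smooth) auto
      fix p' assume p': "p' \<in> L \<inter> ?U"
      then obtain e' q' where pq: "p' = f (e', q')" "norm e' = 1" "q' \<in> \<Sigma>" by auto
      have "p' \<in> L \<inter> T" using p' by auto
      then have "s * snd (finv p') $ 3 > 0" using T(2) by auto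
      then have pos: "s * q' $ 3 > 0" using finv_f[of "(e', q')"] pq by simp
      have "\<psi> (shadow q') = (q' $ 3)\<^sup>2" using pq(3) by (simp add: double_graph_def)
      then have "s * sqrt (\<psi> (?z p')) = q' $ 3" using s(1) pos by (auto simp: pq(1) shadow_f)
      then show "recover (s * sqrt (\<psi> (?z p'))) p' = finv p'" using fr[OF pq(2,3)] pq(1) by simp
    qed
    ultimately show ?thesis by blast
  qed
qed

lemma tangent_L:
  assumes "(e, q) \<in> M"
  shows "tangent_space L (f (e, q)) = {df (e, q) (\<alpha> *\<^sub>R (\<i> * e)) v | \<alpha> v. 2 * q $ 3 * v $ 3 = \<psi>x (shadow q) * v $ 1 + \<psi>y (shadow q) * v $ 2}"
  unfolding tangent_space_diffeo[OF homeomorphism_f smooth_f smooth_finv assms] by (rule velocities_M[OF assms])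

lemma isotropic_L: "p \<in> L \<Longrightarrow> x \<in> tangent_space L p \<Longrightarrow> y \<in> tangent_space L p \<Longrightarrow> std_symplectic x y = 0"
proof -
  assume "p \<in> L" and xy: "x \<in> tangent_space L p" "y \<in> tangent_space L p"
  then obtain e q where p: "(e, q) \<in> M" "p = f (e, q)" by auto
  from xy show ?thesis unfolding p(2) tangent_L[OF p(1)] by (auto intro!: symplectic_df)
qed

lemma lagrangian_submanifold_L: "lagrangian_submanifold L"
  unfolding lagrangian_submanifold_def
  using smooth_submanifold_diffeo[OF smooth_submanifold_M homeomorphism_f smooth_f smooth_finv] isotropic_L by blast

lemma lagrangian_embedding_f: "lagrangian_embedding M f"
  unfolding lagrangian_embedding_def smooth_embedding_def
  using smooth_immersion_diffeo[OF smooth_f smooth_finv finv_f] homeomorphism_f lagrangian_submanifold_L by blast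

lemma phase_factor_nonzero: "norm e = 1 \<Longrightarrow> q \<in> \<Sigma> \<Longrightarrow> phase_factor e q \<noteq> 0"
  using slit[of e q] by auto

lemma det_squared_L:
  assumes "(e, q) \<in> M"
  shows "det_squared (tangent_space L (f (e, q))) = (\<i> * e * (phase_factor e q / norm (phase_factor e q)))\<^sup>2"
proof -
  have e: "norm e = 1" and q: "q \<in> \<Sigma>" using assms by auto
  let ?d = "\<i> * e * phase_factor e q"
  have dn: "?d \<noteq> 0" using phase_factor_nonzero[OF e q] e by auto
  have nd: "norm ?d = norm (phase_factor e q)" using e by (simp add: norm_mult)
  \<comment> \<open>It remains to supply two vectors spanning the tangent plane of the surface
    together with the determinant of the resulting frame, in one form off the fold and in another on
    it.\<close>
  have main: ?thesis if va: "2 * q $ 3 * a $ 3 = \<psi>x (shadow q) * a $ 1 + \<psi>y (shadow q) * a $ 2"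
      "2 * q $ 3 * b $ 3 = \<psi>x (shadow q) * b $ 1 + \<psi>y (shadow q) * b $ 2"
    and ex: "\<And>v. 2 * q $ 3 * v $ 3 = \<psi>x (shadow q) * v $ 1 + \<psi>y (shadow q) * v $ 2 \<Longrightarrow> \<exists>r s. v = r *\<^sub>R a + s *\<^sub>R b"
    and D: "det (\<chi> i j. (\<lambda>j::3. if j = 1 then df (e, q) (\<i> * e) 0 else if j = 2 then df (e, q) 0 a else df (e, q) 0 b) j $ i) = of_real r * ?d" "r \<noteq> 0"
    for a b r
  proof -
    let ?v = "\<lambda>j::3. if j = 1 then df (e, q) (\<i> * e) 0 else if j = 2 then df (e, q) 0 a else df (e, q) 0 b"
    have T: "tangent_space L (f (e, q)) = span (range ?v)"
      unfolding tangent_L[OF assms]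
    proof (intro equalityI subsetI)
      fix x assume "x \<in> {df (e, q) (\<alpha> *\<^sub>R (\<i> * e)) v | \<alpha> v. 2 * q $ 3 * v $ 3 = \<psi>x (shadow q) * v $ 1 + \<psi>y (shadow q) * v $ 2}"
      then obtain \<alpha> v where x: "x = df (e, q) (\<alpha> *\<^sub>R (\<i> * e)) v" and "2 * q $ 3 * v $ 3 = \<psi>x (shadow q) * v $ 1 + \<psi>y (shadow q) * v $ 2" by blast
      then obtain r s where v: "v = r *\<^sub>R a + s *\<^sub>R b" using ex by blast
      have "x = \<alpha> *\<^sub>R df (e, q) (\<i> * e) 0 + (r *\<^sub>R df (e, q) 0 a + s *\<^sub>R df (e, q) 0 b)"
        using df_linear[of "(e, q)" \<alpha> "\<i> * e" 1 0 0 v] df_linear[of "(e, q)" r 0 s 0 a b] by (simp add: x v)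
      also have "\<dots> = \<alpha> *\<^sub>R ?v 1 + (r *\<^sub>R ?v 2 + s *\<^sub>R ?v 3)" by simp
      also have "\<dots> \<in> span (range ?v)"
        by (intro span_add span_scale span_base) blast+
      finally show "x \<in> span (range ?v)" .
    next
      fix x assume "x \<in> span (range ?v)"
      then show "x \<in> {df (e, q) (\<alpha> *\<^sub>R (\<i> * e)) v | \<alpha> v. 2 * q $ 3 * v $ 3 = \<psi>x (shadow q) * v $ 1 + \<psi>y (shadow q) * v $ 2}" (is "_ \<in> ?T")
      proof (induction rule: span_induct_alt)
        case base
        have "0 = df (e, q) (0 *\<^sub>R (\<i> * e)) 0" using df_linear[of "(e, q)" 0 0 0 0 0 0] by simp
        then show ?case by (intro CollectI exI[of _ 0] conjI) simp_all
      next
        case (step c x y)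
        then obtain \<alpha> v where y: "y = df (e, q) (\<alpha> *\<^sub>R (\<i> * e)) v" "2 * q $ 3 * v $ 3 = \<psi>x (shadow q) * v $ 1 + \<psi>y (shadow q) * v $ 2" by blast
        have "\<exists>\<beta> w. x = df (e, q) (\<beta> *\<^sub>R (\<i> * e)) w \<and> 2 * q $ 3 * w $ 3 = \<psi>x (shadow q) * w $ 1 + \<psi>y (shadow q) * w $ 2"
        proof -
          have "x = df (e, q) (1 *\<^sub>R (\<i> * e)) 0 \<or> x = df (e, q) (0 *\<^sub>R (\<i> * e)) a \<or> x = df (e, q) (0 *\<^sub>R (\<i> * e)) b"
            using step(1) by (auto split: if_splits)
          then show ?thesis using va by (metis mult_zero_right zero_index add.right_neutral)
        qed
        then obtain \<beta> w where x: "x = df (e, q) (\<beta> *\<^sub>R (\<i> * e)) w" "2 * q $ 3 * w $ 3 = \<psi>x (shadow q) * w $ 1 + \<psi>y (shadow q) * w $ 2" by blast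
        have "c *\<^sub>R x + y = df (e, q) ((c * \<beta> + \<alpha>) *\<^sub>R (\<i> * e)) (c *\<^sub>R w + v)"
          using df_linear[of "(e, q)" c "\<beta> *\<^sub>R (\<i> * e)" 1 "\<alpha> *\<^sub>R (\<i> * e)" w v] by (simp add: x y scaleR_add_left)
        moreover have "2 * q $ 3 * (c *\<^sub>R w + v) $ 3 = \<psi>x (shadow q) * (c *\<^sub>R w + v) $ 1 + \<psi>y (shadow q) * (c *\<^sub>R w + v) $ 2"
          using x(2) y(2) by (simp add: algebra_simps)
        ultimately show ?case by blast
      qed
    qed
    have "det_squared (span (range ?v)) = (?d / norm ?d)\<^sup>2"
    proof (rule det_squared_span_eq[OF _ D(1) D(2) dn])
      show "std_symplectic x y = 0" if "x \<in> span (range ?v)" "y \<in> span (range ?v)" for x y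
        using isotropic_L[of "f (e, q)" x y] assms that unfolding T by blast
    qed
    then show ?thesis unfolding T nd by simp
  qed
  show ?thesis
  proof (cases "q $ 3 = 0")
    case False
    show ?thesis
    proof (rule main[OF _ _ _ det_frame_generic[OF e]])
      fix v :: "real^3" assume v: "2 * q $ 3 * v $ 3 = \<psi>x (shadow q) * v $ 1 + \<psi>y (shadow q) * v $ 2"
      then have v3: "v $ 3 = (\<psi>x (shadow q) * v $ 1 + \<psi>y (shadow q) * v $ 2) / (2 * q $ 3)" using False by (simp add: field_simps)
      show "\<exists>r s. v = r *\<^sub>R vec3 (2 * q $ 3) 0 (\<psi>x (shadow q)) + s *\<^sub>R vec3 0 (2 * q $ 3) (\<psi>y (shadow q))"
        using False by (intro exI[of _ "v $ 1 / (2 * q $ 3)"] exI[of _ "v $ 2 / (2 * q $ 3)"])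
          (simp add: vec_eq_iff forall_3 v3 field_simps)
    qed (use False eps in auto)
  next
    case True
    then have g: "grad2 (shadow q) > 0" using grad_nonzero[of "shadow q"] q by (auto simp: grad2_def double_graph_def)
    show ?thesis
    proof (rule main[OF _ _ _ det_frame_fold[OF e True]])
      fix v :: "real^3" assume v: "2 * q $ 3 * v $ 3 = \<psi>x (shadow q) * v $ 1 + \<psi>y (shadow q) * v $ 2"
      let ?X = "\<psi>x (shadow q)" and ?Y = "\<psi>y (shadow q)" and ?n = "grad2 (shadow q)"
      have 0: "?X * v $ 1 + ?Y * v $ 2 = 0" using v True by simp
      \<comment> \<open>At the fold the shadow of \<open>v\<close> is orthogonal to the gradient,
        hence a multiple of the gradient turned by a right angle; the factor is the cross product
        divided by \<open>grad2\<close>.\<close>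
      have "(?X * v $ 2 - ?Y * v $ 1) * - ?Y = v $ 1 * ?n - ?X * (?X * v $ 1 + ?Y * v $ 2)"
        "(?X * v $ 2 - ?Y * v $ 1) * ?X = v $ 2 * ?n - ?Y * (?X * v $ 1 + ?Y * v $ 2)"
        by (simp_all add: grad2_def power2_eq_square algebra_simps)
      then have "v $ 1 = (?X * v $ 2 - ?Y * v $ 1) / ?n * - ?Y" "v $ 2 = (?X * v $ 2 - ?Y * v $ 1) / ?n * ?X"
        using g unfolding 0 by (simp_all add: field_simps)
      then show "\<exists>r s. v = r *\<^sub>R vec3 (- ?Y) ?X 0 + s *\<^sub>R vec3 0 0 1"
        by (intro exI[of _ "(?X * v $ 2 - ?Y * v $ 1) / ?n"] exI[of _ "v $ 3"]) (simp add: vec_eq_iff forall_3)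
    qed (use True eps in auto)
  qed
qed

end


section \<open>Green's formula on the disc\<close>

text \<open>Lebesgue measure on the complex numbers agrees with the product measure of the plane on
  boxes. This opens the way to Fubini.\<close>

lemma distr_lborel_complex: "distr lborel borel (\<lambda>(x, y). Complex x y) = lborel"
proof (rule lborel_eqI[symmetric])
  let ?\<sigma> = "\<lambda>(x, y). Complex x y"
  have c: "continuous_on UNIV ?\<sigma>" unfolding split_beta Complex_eq by (intro continuous_intros)
  then have m: "?\<sigma> \<in> borel_measurable lborel" by (simp add: borel_measurable_continuous_onI)
  fix l u :: complex assume le: "\<And>b. b \<in> Basis \<Longrightarrow> l \<bullet> b \<le> u \<bullet> b"
  have "?\<sigma> -` box l u = box (Re l, Im l) (Re u, Im u)"
    by (auto simp: box_def Basis_complex_def Basis_prod_def inner_complex_def)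
  then have "emeasure (distr lborel borel ?\<sigma>) (box l u) = emeasure lborel (box (Re l, Im l) (Re u, Im u))"
    using m by (simp add: emeasure_distr)
  also have "\<dots> = (\<Prod>b\<in>Basis. (u - l) \<bullet> b)"
    using le[of 1] le[of \<i>] by (subst emeasure_lborel_box) (auto simp: Basis_complex_def Basis_prod_def inner_complex_def prod.union_disjoint)
  finally show "emeasure (distr lborel borel ?\<sigma>) (box l u) = (\<Prod>b\<in>Basis. (u - l) \<bullet> b)" .
qed simp

text \<open>The integrand is cut off outside the closed disc, where nothing is known about
  \<open>H\<close>. The closed disc is compact, which gives integrability, and the circle between it
  and the open disc is negligible.\<close>

lemma has_integral_ball_slices:
  fixes H :: "complex \<Rightarrow> real"
  assumes "continuous_on (cball 0 1) H"
  shows "(H has_integral (\<integral>x. (\<integral>y. indicator (cball 0 1) (Complex x y) * H (Complex x y) \<partial>lborel) \<partial>lborel)) (ball 0 1)" (is ?A)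
    and "(H has_integral (\<integral>y. (\<integral>x. indicator (cball 0 1) (Complex x y) * H (Complex x y) \<partial>lborel) \<partial>lborel)) (ball 0 1)" (is ?B)
proof -
  let ?h = "\<lambda>z. indicator (cball 0 1) z *\<^sub>R H z" and ?\<sigma> = "\<lambda>(x, y). Complex x y"
  have i: "integrable lborel ?h" by (rule borel_integrable_compact[OF compact_cball assms])
  have c: "continuous_on UNIV ?\<sigma>" unfolding split_beta Complex_eq by (intro continuous_intros)
  then have m: "?\<sigma> \<in> lborel \<rightarrow>\<^sub>M borel" by (simp add: borel_measurable_continuous_onI)
  have d: "distr lborel borel ?\<sigma> = lborel" by (rule distr_lborel_complex)
  have i2: "integrable (lborel \<Otimes>\<^sub>M lborel) (\<lambda>(x, y). ?h (Complex x y))"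
    using integrable_distr[OF m, of ?h] i unfolding d lborel_prod by (simp add: case_prod_unfold)
  have e: "integral\<^sup>L lborel ?h = integral\<^sup>L (lborel \<Otimes>\<^sub>M lborel) (\<lambda>(x, y). ?h (Complex x y))"
    using integral_distr[OF m, of ?h] i unfolding d lborel_prod by (simp add: case_prod_unfold borel_measurable_integrable)
  have hi: "(?h has_integral integral\<^sup>L lborel ?h) UNIV" by (rule has_integral_integral_lborel[OF i])
  have "?h = (\<lambda>z. if z \<in> cball 0 1 then H z else 0)" by (auto simp: indicator_def)
  then have "(H has_integral integral\<^sup>L lborel ?h) (cball 0 1)" using hi has_integral_restrict_UNIV[of "cball 0 1" H] by simp
  then have "(H has_integral integral\<^sup>L lborel ?h) (ball 0 1)"
    using has_integral_interior[of "cball 0 1" H] negligible_sphere[of "0::complex" 1] by (simp add: interior_cball frontier_cball)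
  note r = this[unfolded e]
  show ?A using r unfolding lborel_pair.integral_fst[OF i2, symmetric] by simp
  show ?B using r unfolding lborel_pair.integral_snd[OF i2, symmetric] by simp
qed


lemma mem_cball_Complex: "Complex x y \<in> cball 0 1 \<longleftrightarrow> x\<^sup>2 + y\<^sup>2 \<le> 1"
  by (simp add: dist_norm cmod_def)

text \<open>The fundamental theorem of calculus on the chord over \<open>x\<close>. For
  \<open>\<bar>x\<bar>\<close> above 1 the chord is empty, and the indicator on the right matches
  this.\<close>

lemma integral_chord:
  fixes F :: "real \<Rightarrow> real"
  assumes F: "\<And>y. x\<^sup>2 + y\<^sup>2 \<le> 1 \<Longrightarrow> (F has_real_derivative F' y) (at y within {y. x\<^sup>2 + y\<^sup>2 \<le> 1})"
    and c: "continuous_on {y. x\<^sup>2 + y\<^sup>2 \<le> 1} F'"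
  shows "(\<integral>y. indicator {y. x\<^sup>2 + y\<^sup>2 \<le> 1} y * F' y \<partial>lborel)
    = indicator {-1..1} x * (F (sqrt (1 - x\<^sup>2)) - F (- sqrt (1 - x\<^sup>2)))"
proof (cases "x \<in> {-1..1}")
  case True
  then have x: "x\<^sup>2 \<le> 1" by (auto simp: abs_square_le_1)
  have S: "{y. x\<^sup>2 + y\<^sup>2 \<le> 1} = {- sqrt (1 - x\<^sup>2) .. sqrt (1 - x\<^sup>2)}"
  proof (intro equalityI subsetI)
    fix y assume "y \<in> {y. x\<^sup>2 + y\<^sup>2 \<le> 1}"
    then have "y\<^sup>2 \<le> 1 - x\<^sup>2" by simp
    then have "\<bar>y\<bar> \<le> sqrt (1 - x\<^sup>2)" by (metis real_sqrt_abs real_sqrt_le_iff)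
    then show "y \<in> {- sqrt (1 - x\<^sup>2) .. sqrt (1 - x\<^sup>2)}" by auto
  next
    fix y assume "y \<in> {- sqrt (1 - x\<^sup>2) .. sqrt (1 - x\<^sup>2)}"
    then have "\<bar>y\<bar> \<le> sqrt (1 - x\<^sup>2)" by auto
    then have "y\<^sup>2 \<le> (sqrt (1 - x\<^sup>2))\<^sup>2" by (metis abs_le_square_iff abs_of_nonneg real_sqrt_ge_zero diff_ge_0_iff_ge x)
    then show "y \<in> {y. x\<^sup>2 + y\<^sup>2 \<le> 1}" using x by simp
  qed
  have "(\<integral>y. indicator {- sqrt (1 - x\<^sup>2) .. sqrt (1 - x\<^sup>2)} y *\<^sub>R F' y \<partial>lborel) = F (sqrt (1 - x\<^sup>2)) - F (- sqrt (1 - x\<^sup>2))"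
  proof (rule integral_FTC_atLeastAtMost)
    show "- sqrt (1 - x\<^sup>2) \<le> sqrt (1 - x\<^sup>2)" using x by simp
    show "(F has_vector_derivative F' y) (at y within {- sqrt (1 - x\<^sup>2)..sqrt (1 - x\<^sup>2)})"
      if "- sqrt (1 - x\<^sup>2) \<le> y" "y \<le> sqrt (1 - x\<^sup>2)" for y
      using F[of y] that unfolding S by (metis (no_types, lifting) S atLeastAtMost_iff has_real_derivative_iff_has_vector_derivative mem_Collect_eq)
    show "continuous_on {- sqrt (1 - x\<^sup>2)..sqrt (1 - x\<^sup>2)} F'" using c unfolding S .
  qed
  then show ?thesis unfolding S using True by simp
next
  case False
  then have x: "x\<^sup>2 > 1" by (auto simp: abs_square_le_1 simp flip: not_le)
  have e: "indicator {y. x\<^sup>2 + y\<^sup>2 \<le> 1} y = (0::real)" for y 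
  proof -
    have "\<not> x\<^sup>2 + y\<^sup>2 \<le> 1" using x zero_le_power2[of y] by linarith
    then show ?thesis by simp
  qed
  show ?thesis unfolding e using False by simp
qed

text \<open>The two cases of the divergence theorem on the unit disc, obtained by integrating along
  vertical and horizontal chords.\<close>

lemma has_integral_ball_partial:
  fixes h :: "complex \<Rightarrow> real"
  assumes D: "\<And>z. z \<in> cball 0 1 \<Longrightarrow> (h has_derivative (\<lambda>v. Re v * hx z + Im v * hy z)) (at z within cball 0 1)"
    and c: "continuous_on (cball 0 1) hx" "continuous_on (cball 0 1) hy"
  shows "(hx has_integral integral {0..1} (\<lambda>t. 2 * pi * cos (2 * pi * t) * h (cis (2 * pi * t)))) (ball 0 1)" (is ?A)
    and "(hy has_integral integral {0..1} (\<lambda>t. 2 * pi * sin (2 * pi * t) * h (cis (2 * pi * t)))) (ball 0 1)" (is ?B)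
proof -
  have ch: "continuous_on (cball 0 1) h" by (rule has_derivative_continuous_on[OF D])
  have C: "continuous_on S (\<lambda>t. g (Complex (a t) (b t)))"
    if "continuous_on (cball 0 1) g" "continuous_on S a" "continuous_on S b" "\<And>t. t \<in> S \<Longrightarrow> (a t)\<^sup>2 + (b t)\<^sup>2 \<le> 1" for g :: "complex \<Rightarrow> real" and a b S
  proof (rule continuous_on_compose2[OF that(1)])
    show "continuous_on S (\<lambda>t. Complex (a t) (b t))" unfolding Complex_eq by (intro continuous_intros that(2,3))
    show "(\<lambda>t. Complex (a t) (b t)) ` S \<subseteq> cball 0 1" unfolding image_subset_iff mem_cball_Complex using that(4) by blast
  qed
  have ind: "indicator (cball 0 1) (Complex x y) = (indicator {y. x\<^sup>2 + y\<^sup>2 \<le> 1} y :: real)"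
    "indicator (cball 0 1) (Complex x y) = (indicator {x. y\<^sup>2 + x\<^sup>2 \<le> 1} x :: real)" for x y
    unfolding indicator_def mem_cball_Complex mem_Collect_eq by (simp_all only: add.commute)
  have dy: "((\<lambda>y. h (Complex x y)) has_real_derivative hy (Complex x y)) (at y within {y. x\<^sup>2 + y\<^sup>2 \<le> 1})"
    if "x\<^sup>2 + y\<^sup>2 \<le> 1" for x y
  proof -
    have "((\<lambda>y. Complex x y) has_derivative (\<lambda>v. Complex 0 v)) (at y within {y. x\<^sup>2 + y\<^sup>2 \<le> 1})"
      unfolding Complex_eq by (auto intro!: derivative_eq_intros)
    from diff_chain_within[OF this, of h "\<lambda>v. Re v * hx (Complex x y) + Im v * hy (Complex x y)"]
    have c: "?thesis" if "(h has_derivative (\<lambda>v. Re v * hx (Complex x y) + Im v * hy (Complex x y))) (at (Complex x y) within (\<lambda>y. Complex x y) ` {y. x\<^sup>2 + y\<^sup>2 \<le> 1})"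
      using that by (simp add: o_def has_field_derivative_def mult.commute[of _ "hx (Complex x y)"] mult.commute[of _ "hy (Complex x y)"])
    show ?thesis by (rule c[OF has_derivative_subset[OF D]]) (use that in \<open>auto simp: cmod_def\<close>)

  qed
  have dx: "((\<lambda>x. h (Complex x y)) has_real_derivative hx (Complex x y)) (at x within {x. y\<^sup>2 + x\<^sup>2 \<le> 1})"
    if "y\<^sup>2 + x\<^sup>2 \<le> 1" for x y
  proof -
    have "((\<lambda>x. Complex x y) has_derivative (\<lambda>v. Complex v 0)) (at x within {x. y\<^sup>2 + x\<^sup>2 \<le> 1})"
      unfolding Complex_eq by (auto intro!: derivative_eq_intros)
    from diff_chain_within[OF this, of h "\<lambda>v. Re v * hx (Complex x y) + Im v * hy (Complex x y)"]
    have c: "?thesis" if "(h has_derivative (\<lambda>v. Re v * hx (Complex x y) + Im v * hy (Complex x y))) (at (Complex x y) within (\<lambda>x. Complex x y) ` {x. y\<^sup>2 + x\<^sup>2 \<le> 1})"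
      using that by (simp add: o_def has_field_derivative_def mult.commute[of _ "hx (Complex x y)"] mult.commute[of _ "hy (Complex x y)"])
    show ?thesis by (rule c[OF has_derivative_subset[OF D]]) (use that in \<open>auto simp: cmod_def add.commute\<close>)

  qed
  let ?s = "\<lambda>x. sqrt (1 - x\<^sup>2)"
  have s1: "x\<^sup>2 + (?s x)\<^sup>2 = 1" if "x \<in> {-1..1}" for x :: real
  proof -
    have "x\<^sup>2 \<le> 1" using that by (auto simp: abs_square_le_1)
    then show ?thesis by simp
  qed
  have cs: "continuous_on S ?s" for S by (intro continuous_intros)
  have U: "continuous_on {-1..1} (\<lambda>x. h (Complex x (?s x)))" "continuous_on {-1..1} (\<lambda>x. h (Complex x (- ?s x)))"
    "continuous_on {-1..1} (\<lambda>x. h (Complex (?s x) x))" "continuous_on {-1..1} (\<lambda>x. h (Complex (- ?s x) x))"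
    by (rule C[OF ch]; (intro continuous_intros)?; simp add: s1 add.commute)+
  have lint: "(\<integral>x. indicator {-1..1} x * G x \<partial>lborel) = integral {-1..1} G" if "continuous_on {-1..1} G" for G :: "real \<Rightarrow> real"
    using set_borel_integral_eq_integral(2)[of "{-1..1}" G] borel_integrable_compact[OF compact_Icc that]
    by (simp add: set_lebesgue_integral_def set_integrable_def)
  have rs: "\<bar>sin a\<bar> = sqrt (1 - (cos a)\<^sup>2)" "\<bar>cos a\<bar> = sqrt (1 - (sin a)\<^sup>2)" for a :: real
    by (metis real_sqrt_abs sin_squared_eq) (metis real_sqrt_abs cos_squared_eq)
  \<comment> \<open>The form with two integrals covers both directions of travel: the integral with
    reversed bounds is 0 and the other carries the orientation.\<close>
  have subs: "((\<lambda>t. g' t * G (g t)) has_integral (integral {g a..g b} G - integral {g b..g a} G)) {a..b}"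
    if "a \<le> b" "\<And>t. (g has_real_derivative g' t) (at t)" "\<And>t. g t \<in> {-1..1}" "continuous_on {-1..1} G" for g g' G :: "real \<Rightarrow> real" and a b
  proof -
    have "((\<lambda>t. g' t *\<^sub>R G (g t)) has_integral (integral {g a..g b} G - integral {g b..g a} G)) {a..b}"
      by (rule has_integral_substitution_general[of "{}" a b g "-1" 1 G])
         (use that in \<open>auto intro: has_field_derivative_at_within DERIV_continuous_on\<close>)
    then show ?thesis by simp
  qed
  have gc: "((\<lambda>t. cos (2 * pi * t)) has_real_derivative - (2 * pi * sin (2 * pi * t))) (at t)"
    "((\<lambda>t. sin (2 * pi * t)) has_real_derivative 2 * pi * cos (2 * pi * t)) (at t)" for t
    by (auto intro!: derivative_eq_intros)
  \<comment> \<open>Along the upper half circle the abscissa decreases from 1 to -1, so the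
    substitution yields the negative of the wanted integral. On the lower half circle it
    increases.\<close>
  have i1: "((\<lambda>t. 2 * pi * sin (2 * pi * t) * h (cis (2 * pi * t))) has_integral integral {-1..1} (\<lambda>x. h (Complex x (?s x)))) {0..1/2}"
  proof -
    have "((\<lambda>t. - (2 * pi * sin (2 * pi * t)) * h (Complex (cos (2 * pi * t)) (?s (cos (2 * pi * t))))) has_integral - integral {-1..1} (\<lambda>x. h (Complex x (?s x)))) {0..1/2}"
      using subs[OF _ gc(1) _ U(1), of 0 "1/2"] by simp
    from has_integral_neg[OF this] have "((\<lambda>t. 2 * pi * sin (2 * pi * t) * h (Complex (cos (2 * pi * t)) (?s (cos (2 * pi * t))))) has_integral integral {-1..1} (\<lambda>x. h (Complex x (?s x)))) {0..1/2}" by simp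
    then show ?thesis
    proof (rule has_integral_eq[rotated])
      fix t :: real assume t: "t \<in> {0..1/2}"
      then have "sin (2 * pi * t) \<ge> 0" by (intro sin_ge_zero) (auto simp: field_simps)
      then have "sin (2 * pi * t) = ?s (cos (2 * pi * t))" using rs(1)[of "2 * pi * t"] by simp
      then show "2 * pi * sin (2 * pi * t) * h (Complex (cos (2 * pi * t)) (?s (cos (2 * pi * t)))) = 2 * pi * sin (2 * pi * t) * h (cis (2 * pi * t))"
        by (simp add: cis.code)
    qed
  qed
  have i2: "((\<lambda>t. 2 * pi * sin (2 * pi * t) * h (cis (2 * pi * t))) has_integral - integral {-1..1} (\<lambda>x. h (Complex x (- ?s x)))) {1/2..1}"
  proof -
    have "((\<lambda>t. - (2 * pi * sin (2 * pi * t)) * h (Complex (cos (2 * pi * t)) (- ?s (cos (2 * pi * t))))) has_integral integral {-1..1} (\<lambda>x. h (Complex x (- ?s x)))) {1/2..1}"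
      using subs[OF _ gc(1) _ U(2), of "1/2" 1] by simp
    from has_integral_neg[OF this] have "((\<lambda>t. 2 * pi * sin (2 * pi * t) * h (Complex (cos (2 * pi * t)) (- ?s (cos (2 * pi * t))))) has_integral - integral {-1..1} (\<lambda>x. h (Complex x (- ?s x)))) {1/2..1}" by simp
    then show ?thesis
    proof (rule has_integral_eq[rotated])
      fix t :: real assume t: "t \<in> {1/2..1}"
      then have "2 * pi * t - pi \<ge> 0" "2 * pi * t - pi \<le> pi" by (auto simp: field_simps)
      then have "sin (2 * pi * t - pi) \<ge> 0" by (intro sin_ge_zero) auto
      then have "sin (2 * pi * t) \<le> 0" by (simp add: sin_diff)
      then have "sin (2 * pi * t) = - ?s (cos (2 * pi * t))" using rs(1)[of "2 * pi * t"] by simp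
      then show "2 * pi * sin (2 * pi * t) * h (Complex (cos (2 * pi * t)) (- ?s (cos (2 * pi * t)))) = 2 * pi * sin (2 * pi * t) * h (cis (2 * pi * t))"
        by (simp add: cis.code)
    qed
  qed
  have j: "((\<lambda>t. 2 * pi * cos (2 * pi * t) * h (cis (2 * pi * t))) has_integral
      integral {sin (2 * pi * a)..sin (2 * pi * b)} (\<lambda>x. h (Complex (?s x) x)) - integral {sin (2 * pi * b)..sin (2 * pi * a)} (\<lambda>x. h (Complex (?s x) x))) {a..b}"
    if ab: "a \<le> b" and pos: "\<And>t. t \<in> {a..b} \<Longrightarrow> cos (2 * pi * t) \<ge> 0" for a b
  proof (rule has_integral_eq[OF _ subs[OF ab gc(2) _ U(3)]])
    fix t assume t: "t \<in> {a..b}"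
    have "cos (2 * pi * t) = ?s (sin (2 * pi * t))" using rs(2)[of "2 * pi * t"] pos[OF t] by simp
    then show "2 * pi * cos (2 * pi * t) * h (Complex (?s (sin (2 * pi * t))) (sin (2 * pi * t))) = 2 * pi * cos (2 * pi * t) * h (cis (2 * pi * t))"
      by (simp add: cis.code)
  qed simp
  \<comment> \<open>The parametrisation starts in the middle of the right half circle, so this half
    consists of the first and the last quarter of the parameter interval.\<close>
  have j1: "((\<lambda>t. 2 * pi * cos (2 * pi * t) * h (cis (2 * pi * t))) has_integral integral {0..1} (\<lambda>x. h (Complex (?s x) x))) {0..1/4}"
  proof -
    have "cos (2 * pi * t) \<ge> 0" if "t \<in> {0..1/4}" for t
      using that by (intro cos_ge_zero) (auto simp: field_simps intro: order_trans[of _ 0])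
    then show ?thesis using j[of 0 "1/4"] by simp
  qed
  have j3: "((\<lambda>t. 2 * pi * cos (2 * pi * t) * h (cis (2 * pi * t))) has_integral integral {-1..0} (\<lambda>x. h (Complex (?s x) x))) {3/4..1}"
  proof -
    have "cos (2 * pi * t) \<ge> 0" if "t \<in> {3/4..1}" for t
    proof -
      have "cos (2 * pi * t - 2 * pi) \<ge> 0" using that by (intro cos_ge_zero) (auto simp: field_simps)
      then show ?thesis by (simp add: cos_diff)
    qed
    moreover have "sin (2 * pi * (3/4)) = -1" using sin_3over2_pi by (simp add: mult.commute)
    ultimately show ?thesis using j[of "3/4" 1] by simp
  qed
  have j2: "((\<lambda>t. 2 * pi * cos (2 * pi * t) * h (cis (2 * pi * t))) has_integral - integral {-1..1} (\<lambda>x. h (Complex (- ?s x) x))) {1/4..3/4}"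
  proof -
    have "sin (2 * pi * (3/4)) = -1" using sin_3over2_pi by (simp add: mult.commute)
    then have "((\<lambda>t. 2 * pi * cos (2 * pi * t) * h (Complex (- ?s (sin (2 * pi * t))) (sin (2 * pi * t)))) has_integral - integral {-1..1} (\<lambda>x. h (Complex (- ?s x) x))) {1/4..3/4}"
      using subs[OF _ gc(2) _ U(4), of "1/4" "3/4"] by simp
    then show ?thesis
    proof (rule has_integral_eq[rotated])
      fix t :: real assume t: "t \<in> {1/4..3/4}"
      then have "cos (2 * pi * t - pi) \<ge> 0" by (intro cos_ge_zero) (auto simp: field_simps)
      then have "cos (2 * pi * t) \<le> 0" by (simp add: cos_diff)
      then have "cos (2 * pi * t) = - ?s (sin (2 * pi * t))" using rs(2)[of "2 * pi * t"] by simp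
      then show "2 * pi * cos (2 * pi * t) * h (Complex (- ?s (sin (2 * pi * t))) (sin (2 * pi * t))) = 2 * pi * cos (2 * pi * t) * h (cis (2 * pi * t))"
        by (simp add: cis.code)
    qed
  qed
  have inty: "(\<integral>y. indicator (cball 0 1) (Complex x y) * hy (Complex x y) \<partial>lborel) = indicator {-1..1} x * (h (Complex x (?s x)) - h (Complex x (- ?s x)))" for x
    unfolding ind(1) by (rule integral_chord[OF dy C[OF c(2)]]) (auto intro: continuous_intros)
  have intx: "(\<integral>x. indicator (cball 0 1) (Complex x y) * hx (Complex x y) \<partial>lborel) = indicator {-1..1} y * (h (Complex (?s y) y) - h (Complex (- ?s y) y))" for y
    unfolding ind(2) by (rule integral_chord[OF dx C[OF c(1)]]) (auto intro: continuous_intros simp: add.commute)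
  have "integral {0..1} (\<lambda>t. 2 * pi * sin (2 * pi * t) * h (cis (2 * pi * t))) = integral {-1..1} (\<lambda>x. h (Complex x (?s x))) - integral {-1..1} (\<lambda>x. h (Complex x (- ?s x)))"
    using integral_unique[OF has_integral_combine[OF _ _ i1 i2]] by simp
  also have "\<dots> = integral {-1..1} (\<lambda>x. h (Complex x (?s x)) - h (Complex x (- ?s x)))"
    by (rule integral_diff[symmetric]) (auto intro!: integrable_continuous_interval U)
  finally have y: "integral {0..1} (\<lambda>t. 2 * pi * sin (2 * pi * t) * h (cis (2 * pi * t))) = \<dots>" .
  show ?B using has_integral_ball_slices(1)[OF c(2)] unfolding inty y
    by (subst (asm) lint) (auto intro!: continuous_intros U)
  have "integral {0..1} (\<lambda>t. 2 * pi * cos (2 * pi * t) * h (cis (2 * pi * t))) = integral {0..1} (\<lambda>x. h (Complex (?s x) x)) - integral {-1..1} (\<lambda>x. h (Complex (- ?s x) x)) + integral {-1..0} (\<lambda>x. h (Complex (?s x) x))"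
    using integral_unique[OF has_integral_combine[OF _ _ has_integral_combine[OF _ _ j1 j2] j3]] by simp
  also have "\<dots> = integral {-1..1} (\<lambda>x. h (Complex (?s x) x)) - integral {-1..1} (\<lambda>x. h (Complex (- ?s x) x))"
    using Henstock_Kurzweil_Integration.integral_combine[of "-1" 0 1 "\<lambda>x. h (Complex (?s x) x)"] U(3) by (simp add: integrable_continuous_interval)
  also have "\<dots> = integral {-1..1} (\<lambda>x. h (Complex (?s x) x) - h (Complex (- ?s x) x))"
    by (rule integral_diff[symmetric]) (auto intro!: integrable_continuous_interval U)
  finally have x: "integral {0..1} (\<lambda>t. 2 * pi * cos (2 * pi * t) * h (cis (2 * pi * t))) = \<dots>" .
  show ?A using has_integral_ball_slices(2)[OF c(1)] unfolding intx x
    by (subst (asm) lint) (auto intro!: continuous_intros U)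
qed

text \<open>The partial derivatives extend smoothly to the closed disc because local extensions agree on the
  interior, and boundary values are limits from there.\<close>

lemma smooth_map_on_disc_partials:
  fixes a :: "complex \<Rightarrow> real"
  assumes "smooth_map_on (cball 0 1) a"
  obtains ax ay where "smooth_map_on (cball 0 1) ax" "smooth_map_on (cball 0 1) ay"
    "\<And>z. z \<in> cball 0 1 \<Longrightarrow> (a has_derivative (\<lambda>v. Re v * ax z + Im v * ay z)) (at z within cball 0 1)"
proof -
  define A where "A v z = Lim (at z within ball 0 1) (\<lambda>z. frechet_derivative a (at z) v)" for v z
  have loc: "\<exists>U g. open U \<and> z \<in> U \<and> smooth_on U g \<and> (\<forall>y. y \<in> cball 0 1 \<longrightarrow> y \<in> U \<longrightarrow> a y = g y \<and> (\<forall>v. A v y = frechet_derivative g (at y) v))"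
    if z: "z \<in> cball 0 1" for z
  proof -
    obtain U g where U: "open U" "z \<in> U" "smooth_on U g" and eq: "\<And>y. y \<in> cball 0 1 \<Longrightarrow> y \<in> U \<Longrightarrow> a y = g y"
      using smooth_map_onE[OF assms z] by metis
    have fd: "frechet_derivative a (at y) = frechet_derivative g (at y)" if "y \<in> ball 0 1 \<inter> U" for y
    proof -
      have "(a has_derivative frechet_derivative g (at y)) (at y)"
        by (rule has_derivative_transform_within_open[OF smooth_onD[OF U(3)], of y "ball 0 1 \<inter> U"])
           (use that U eq in auto)
      then show ?thesis by (rule frechet_derivative_at[symmetric])
    qed
    have "A v y = frechet_derivative g (at y) v" if y: "y \<in> cball 0 1" "y \<in> U" for v y
      unfolding A_def
    proof (rule tendsto_Lim)
      have "y islimpt ball 0 1" using y by (simp add: islimpt_ball)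
      then show "at y within ball 0 1 \<noteq> bot" by (simp add: trivial_limit_within)
      have "continuous_on U (\<lambda>y. frechet_derivative g (at y) v)"
        by (rule smooth_on_continuous[OF smooth_on_frechet_derivative[OF U(3)]])
      then have "((\<lambda>y. frechet_derivative g (at y) v) \<longlongrightarrow> frechet_derivative g (at y) v) (at y)"
        using U(1) y(2) by (simp add: continuous_on_eq_continuous_at isCont_def)
      then have "((\<lambda>y. frechet_derivative g (at y) v) \<longlongrightarrow> frechet_derivative g (at y) v) (at y within ball 0 1)"
        by (rule tendsto_within_subset) simp
      moreover have "\<forall>\<^sub>F x in at y within ball 0 1. frechet_derivative g (at x) v = frechet_derivative a (at x) v"
        unfolding eventually_at_topological using U(1) y(2) fd by auto
      ultimately show "((\<lambda>y. frechet_derivative a (at y) v) \<longlongrightarrow> frechet_derivative g (at y) v) (at y within ball 0 1)"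
        by (rule Lim_transform_eventually)
    qed
    then show ?thesis using U eq by blast
  qed
  have sm: "smooth_map_on (cball 0 1) (A v)" for v
  proof (rule smooth_map_onI)
    fix z :: complex assume "z \<in> cball 0 1"
    from loc[OF this] obtain U g where U: "open U" "z \<in> U" "smooth_on U g"
      and eq: "\<And>y. y \<in> cball 0 1 \<Longrightarrow> y \<in> U \<Longrightarrow> A v y = frechet_derivative g (at y) v" by blast
    then show "\<exists>U g. open U \<and> z \<in> U \<and> smooth_on U g \<and> (\<forall>y. y \<in> cball 0 1 \<longrightarrow> y \<in> U \<longrightarrow> A v y = g y)"
      by (intro exI[of _ U] exI[of _ "\<lambda>y. frechet_derivative g (at y) v"] conjI allI impI smooth_on_frechet_derivative)
  qed
  have "(a has_derivative (\<lambda>v. Re v * A 1 z + Im v * A \<i> z)) (at z within cball 0 1)" if z: "z \<in> cball 0 1" for z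
  proof -
    from loc[OF z] obtain U g where U: "open U" "z \<in> U" "smooth_on U g"
      and eq: "\<And>y. y \<in> cball 0 1 \<Longrightarrow> y \<in> U \<Longrightarrow> a y = g y"
      and A: "\<And>v. A v z = frechet_derivative g (at z) v" using z by blast
    have l: "linear (frechet_derivative g (at z))" using has_derivative_linear[OF smooth_onD[OF U(3,2)]] .
    have "frechet_derivative g (at z) v = Re v * A 1 z + Im v * A \<i> z" for v
    proof -
      have "v = Re v *\<^sub>R 1 + Im v *\<^sub>R \<i>" by (simp add: complex_eq_iff)
      then show ?thesis unfolding A by (metis linear_add[OF l] linear_scale[OF l] real_scaleR_def)
    qed
    then have "frechet_derivative g (at z) = (\<lambda>v. Re v * A 1 z + Im v * A \<i> z)" by (rule ext)
    then have D: "(g has_derivative (\<lambda>v. Re v * A 1 z + Im v * A \<i> z)) (at z within cball 0 1)"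
      using smooth_onD[OF U(3,2)] has_derivative_at_withinI by metis
    obtain d where d: "d > 0" "ball z d \<subseteq> U" using U(1,2) open_contains_ball by blast
    show ?thesis
      by (rule has_derivative_transform_within[OF D d(1) z]) (use eq d(2) in \<open>auto simp: subset_iff dist_commute\<close>)
  qed
  with sm that show thesis by blast
qed

lemma has_derivative_cball_ball:
  "(a has_derivative D) (at z within cball 0 1) \<Longrightarrow> z \<in> ball 0 1 \<Longrightarrow> (a has_derivative D) (at z)"
  using at_within_open_subset[of z "ball 0 1" "cball 0 1"] by auto

lemma has_derivative_partials_eq:
  assumes "(a has_derivative (\<lambda>v. Re v * x + Im v * y)) (at z)"
  shows "frechet_derivative a (at z) 1 = x" "frechet_derivative a (at z) \<i> = y"
  unfolding frechet_derivative_at[OF assms, symmetric] by simp_all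

text \<open>The integrand is the exterior derivative of \<open>a\<close> times the differential of
  \<open>b\<close>. The two divergence formulas are applied to \<open>a\<close> times the partial
  derivatives of \<open>b\<close>; the mixed second derivatives cancel, and the boundary terms
  combine to \<open>b'\<close> by the chain rule on the circle.\<close>

lemma green_disc:
  fixes a b :: "complex \<Rightarrow> real"
  assumes a: "smooth_map_on (cball 0 1) a" and b: "smooth_map_on (cball 0 1) b"
    and b': "\<And>t. ((\<lambda>t. b (cis (2 * pi * t))) has_real_derivative b' t) (at t)"
  shows "((\<lambda>z. frechet_derivative a (at z) 1 * frechet_derivative b (at z) \<i>
      - frechet_derivative a (at z) \<i> * frechet_derivative b (at z) 1)
    has_integral integral {0..1} (\<lambda>t. a (cis (2 * pi * t)) * b' t)) (ball 0 1)"
proof -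
  obtain ax ay where A: "smooth_map_on (cball 0 1) ax" "smooth_map_on (cball 0 1) ay"
    "\<And>z. z \<in> cball 0 1 \<Longrightarrow> (a has_derivative (\<lambda>v. Re v * ax z + Im v * ay z)) (at z within cball 0 1)"
    using smooth_map_on_disc_partials[OF a] by metis
  obtain bx "by" where B: "smooth_map_on (cball 0 1) bx" "smooth_map_on (cball 0 1) by"
    "\<And>z. z \<in> cball 0 1 \<Longrightarrow> (b has_derivative (\<lambda>v. Re v * bx z + Im v * by z)) (at z within cball 0 1)"
    using smooth_map_on_disc_partials[OF b] by metis
  obtain bxx bxy where BX: "smooth_map_on (cball 0 1) bxx" "smooth_map_on (cball 0 1) bxy"
    "\<And>z. z \<in> cball 0 1 \<Longrightarrow> (bx has_derivative (\<lambda>v. Re v * bxx z + Im v * bxy z)) (at z within cball 0 1)"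
    using smooth_map_on_disc_partials[OF B(1)] by metis
  obtain byx byy where BY: "smooth_map_on (cball 0 1) byx" "smooth_map_on (cball 0 1) byy"
    "\<And>z. z \<in> cball 0 1 \<Longrightarrow> (by has_derivative (\<lambda>v. Re v * byx z + Im v * byy z)) (at z within cball 0 1)"
    using smooth_map_on_disc_partials[OF B(2)] by metis
  have sym: "bxy z = byx z" if "z \<in> ball 0 1" for z
    by (rule symmetric_second_derivative[OF open_ball convex_ball that, of b bx "by" bxx bxy byx byy])
       (use B(3) BX(3) BY(3) has_derivative_cball_ball
          continuous_on_subset[OF smooth_map_on_continuous[OF BX(2)] ball_subset_cball]
          continuous_on_subset[OF smooth_map_on_continuous[OF BY(1)] ball_subset_cball] ball_subset_cball in blast)+
  have I1: "((\<lambda>z. ax z * by z + a z * byx z) has_integral integral {0..1} (\<lambda>t. 2 * pi * cos (2 * pi * t) * (a (cis (2 * pi * t)) * by (cis (2 * pi * t))))) (ball 0 1)"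
  proof (rule has_integral_ball_partial(1)[of _ _ "\<lambda>z. ay z * by z + a z * byy z"])
    show "((\<lambda>z. a z * by z) has_derivative (\<lambda>v. Re v * (ax z * by z + a z * byx z) + Im v * (ay z * by z + a z * byy z))) (at z within cball 0 1)"
      if "z \<in> cball 0 1" for z
      by (rule has_derivative_eq_rhs[OF has_derivative_mult[OF A(3)[OF that] BY(3)[OF that]]]) (simp add: fun_eq_iff algebra_simps)
  qed (intro continuous_intros smooth_map_on_continuous A B a BX BY)+
  have I2: "((\<lambda>z. ay z * bx z + a z * bxy z) has_integral integral {0..1} (\<lambda>t. 2 * pi * sin (2 * pi * t) * (a (cis (2 * pi * t)) * bx (cis (2 * pi * t))))) (ball 0 1)"
  proof (rule has_integral_ball_partial(2)[of _ "\<lambda>z. ax z * bx z + a z * bxx z"])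
    show "((\<lambda>z. a z * bx z) has_derivative (\<lambda>v. Re v * (ax z * bx z + a z * bxx z) + Im v * (ay z * bx z + a z * bxy z))) (at z within cball 0 1)"
      if "z \<in> cball 0 1" for z
      by (rule has_derivative_eq_rhs[OF has_derivative_mult[OF A(3)[OF that] BX(3)[OF that]]]) (simp add: fun_eq_iff algebra_simps)
  qed (intro continuous_intros smooth_map_on_continuous A B a BX BY)+
  have cc: "continuous_on S (\<lambda>t. g (cis (2 * pi * t)))" if "smooth_map_on (cball 0 1) g" for g :: "complex \<Rightarrow> real" and S
    by (rule continuous_on_compose2[OF smooth_map_on_continuous[OF that]]) (auto intro!: continuous_intros)
  have b'eq: "b' t = 2 * pi * cos (2 * pi * t) * by (cis (2 * pi * t)) - 2 * pi * sin (2 * pi * t) * bx (cis (2 * pi * t))" for t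
  proof -
    have "((\<lambda>t. cis (2 * pi * t)) has_vector_derivative Complex (- (2 * pi * sin (2 * pi * t))) (2 * pi * cos (2 * pi * t))) (at t within UNIV)"
      unfolding has_vector_derivative_complex_iff by (auto intro!: derivative_eq_intros)
    then have c: "((\<lambda>t. cis (2 * pi * t)) has_derivative (\<lambda>v. Complex (- (2 * pi * v * sin (2 * pi * t))) (2 * pi * v * cos (2 * pi * t)))) (at t within UNIV)"
      unfolding has_vector_derivative_def by (rule has_derivative_eq_rhs) (simp add: fun_eq_iff complex_eq_iff algebra_simps)
    have m: "cis (2 * pi * t) \<in> cball 0 1" "range (\<lambda>t. cis (2 * pi * t)) \<subseteq> cball 0 1" by auto
    have "((\<lambda>t. b (cis (2 * pi * t))) has_derivative (\<lambda>v. - (2 * pi * v * sin (2 * pi * t)) * bx (cis (2 * pi * t)) + (2 * pi * v * cos (2 * pi * t)) * by (cis (2 * pi * t)))) (at t)"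
      using diff_chain_within[OF c has_derivative_subset[OF B(3)[OF m(1)] m(2)]] by (simp add: o_def)
    then have "((\<lambda>t. b (cis (2 * pi * t))) has_real_derivative 2 * pi * cos (2 * pi * t) * by (cis (2 * pi * t)) - 2 * pi * sin (2 * pi * t) * bx (cis (2 * pi * t))) (at t)"
      unfolding has_field_derivative_def by (rule has_derivative_eq_rhs) (simp add: fun_eq_iff algebra_simps)
    then show ?thesis by (rule DERIV_unique[OF b'])
  qed
  have "integral {0..1} (\<lambda>t. a (cis (2 * pi * t)) * b' t)
     = integral {0..1} (\<lambda>t. 2 * pi * cos (2 * pi * t) * (a (cis (2 * pi * t)) * by (cis (2 * pi * t))) - 2 * pi * sin (2 * pi * t) * (a (cis (2 * pi * t)) * bx (cis (2 * pi * t))))"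
    unfolding b'eq by (simp add: algebra_simps)
  also have "\<dots> = integral {0..1} (\<lambda>t. 2 * pi * cos (2 * pi * t) * (a (cis (2 * pi * t)) * by (cis (2 * pi * t)))) - integral {0..1} (\<lambda>t. 2 * pi * sin (2 * pi * t) * (a (cis (2 * pi * t)) * bx (cis (2 * pi * t))))"
    by (rule integral_diff) (intro integrable_continuous_interval continuous_intros cc a B)+
  finally have e: "integral {0..1} (\<lambda>t. a (cis (2 * pi * t)) * b' t) = \<dots>" .
  show ?thesis unfolding e
  proof (rule has_integral_eq[OF _ has_integral_diff[OF I1 I2]])
    fix z :: complex assume z: "z \<in> ball 0 1"
    then have zc: "z \<in> cball 0 1" by simp
    note da = has_derivative_partials_eq[OF has_derivative_cball_ball[OF A(3)[OF zc] z]]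
    note db = has_derivative_partials_eq[OF has_derivative_cball_ball[OF B(3)[OF zc] z]]
    show "ax z * by z + a z * byx z - (ay z * bx z + a z * bxy z) = frechet_derivative a (at z) 1 * frechet_derivative b (at z) \<i> - frechet_derivative a (at z) \<i> * frechet_derivative b (at z) 1"
      unfolding da db sym[OF z] by simp
  qed
qed


section \<open>Area and Maslov index\<close>

text \<open>A continuous logarithm \<open>r\<close> of \<open>e\<close> and the principal argument
  of \<open>h\<close>, continuous because \<open>h\<close> avoids the branch cut, together give a
  logarithm of the path. Since \<open>h\<close> returns to its initial value, its argument
  contributes nothing and only \<open>e\<close> is counted, twice because of the square.\<close>

lemma winding_number_square_slit:
  fixes e h :: "real \<Rightarrow> complex"
  assumes e: "path e" "0 \<notin> path_image e"
    and h: "continuous_on {0..1} h" "h 1 = h 0" "\<And>t. t \<in> {0..1} \<Longrightarrow> h t \<notin> \<real>\<^sub>\<le>\<^sub>0"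
  shows "winding_number (\<lambda>t. (e t * (h t / norm (h t)))\<^sup>2) 0 = 2 * winding_number e 0"
proof -
  obtain r where r: "path r" "pathfinish r - pathstart r = 2 * of_real pi * \<i> * winding_number e 0"
    "\<And>t. t \<in> {0..1} \<Longrightarrow> e t = 0 + exp (r t)"
    by (rule winding_number_as_continuous_log[OF e]) blast
  let ?s = "\<lambda>t. 2 * (r t + \<i> * of_real (Im (Ln (h t))))"
  have s: "path ?s"
    using r(1) unfolding path_def by (intro continuous_intros h) (use h(3) in auto)
  have "(e t * (h t / norm (h t)))\<^sup>2 = (exp \<circ> ?s) t" if t: "0 \<le> t" "t \<le> 1" for t
  proof -
    have h0: "h t \<noteq> 0" using h(3)[of t] t by auto
    then have "h t = of_real (exp (Re (Ln (h t)))) * cis (Im (Ln (h t)))" "norm (h t) = exp (Re (Ln (h t)))"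
      using exp_eq_polar[of "Ln (h t)"] norm_exp_eq_Re[of "Ln (h t)"] by simp_all
    then have "h t / norm (h t) = exp (\<i> * of_real (Im (Ln (h t))))"
      by (metis cis_conv_exp exp_not_eq_zero nonzero_mult_div_cancel_left of_real_eq_0_iff)
    then show ?thesis using r(3)[of t] t by (simp add: exp_double exp_add power_mult_distrib)
  qed
  then have "winding_number (\<lambda>t. (e t * (h t / norm (h t)))\<^sup>2) 0 = winding_number (exp \<circ> ?s) 0"
    by (rule winding_number_cong)
  also have "\<dots> = (?s 1 - ?s 0) / (2 * of_real pi * \<i>)"
    using winding_number_compose_exp[OF s] by (simp add: pathfinish_def pathstart_def)
  also have "\<dots> = 2 * (r 1 - r 0) / (2 * of_real pi * \<i>)" using h(2) by (simp add: algebra_simps)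
  also have "\<dots> = 2 * winding_number e 0" using r(2) by (simp add: pathfinish_def pathstart_def)
  finally show ?thesis .
qed

lemma has_vector_derivative_smooth_real:
  fixes g :: "real \<Rightarrow> 'a::euclidean_space"
  assumes "smooth_map_on UNIV g"
  shows "(g has_vector_derivative frechet_derivative g (at t) 1) (at t)"
    and "continuous_on S (\<lambda>t. frechet_derivative g (at t) 1)"
proof -
  have s: "smooth_on UNIV g" using smooth_map_on_open[OF open_UNIV assms] .
  have d: "(g has_derivative frechet_derivative g (at t)) (at t)" using smooth_onD[OF s] by simp
  have "frechet_derivative g (at t) x = x *\<^sub>R frechet_derivative g (at t) 1" for x
    using linear_scale[OF has_derivative_linear[OF d], of x 1] unfolding real_scaleR_def mult_1_right .
  then have "frechet_derivative g (at t) = (\<lambda>x. x *\<^sub>R frechet_derivative g (at t) 1)" by (rule ext)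
  then show "(g has_vector_derivative frechet_derivative g (at t) 1) (at t)"
    unfolding has_vector_derivative_def using d by metis
  show "continuous_on S (\<lambda>t. frechet_derivative g (at t) 1)"
    using continuous_on_subset[OF smooth_on_continuous[OF smooth_on_frechet_derivative[OF s]]] by blast
qed

lemma smooth_map_on_cis: "smooth_map_on X (\<lambda>t::real. cis (2 * pi * t))"
proof -
  \<comment> \<open>The constant \<open>c\<close> makes the family closed under
    differentiation.\<close>
  have "Ck_on k (\<lambda>t::real. c * cis (2 * pi * t)) UNIV" for k c
  proof (induction k arbitrary: c)
    case 0
    show ?case by (auto intro!: continuous_intros)
  next
    case (Suc k)
    have "((\<lambda>t. c * cis (2 * pi * t)) has_vector_derivative c * (2 * pi * \<i>) * cis (2 * pi * t)) (at t)" for t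
    proof -
      have "((\<lambda>t. cis (2 * pi * t)) has_vector_derivative 2 * pi * \<i> * cis (2 * pi * t)) (at t)"
        unfolding has_vector_derivative_complex_iff by (auto intro!: derivative_eq_intros)
      from has_vector_derivative_mult_right[OF this, of c] show ?thesis by (simp add: mult.assoc)
    qed
    then have D: "((\<lambda>t. c * cis (2 * pi * t)) has_derivative (\<lambda>v. v *\<^sub>R (c * (2 * pi * \<i>) * cis (2 * pi * t)))) (at t)" for t
      unfolding has_vector_derivative_def .
    then have "(\<lambda>t. frechet_derivative (\<lambda>t. c * cis (2 * pi * t)) (at t) v) = (\<lambda>t. (v *\<^sub>R (c * (2 * pi * \<i>))) * cis (2 * pi * t))" for v
      using frechet_derivative_at[OF D] by (simp add: fun_eq_iff)
    then have "Ck_on k (\<lambda>t. frechet_derivative (\<lambda>t. c * cis (2 * pi * t)) (at t) v) UNIV" for v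
      using Suc.IH by (simp only:)
    then show ?case using D unfolding differentiable_def Ck_on.simps by blast
  qed
  from this[of _ 1] have "smooth_on UNIV (\<lambda>t::real. cis (2 * pi * t))" by (simp add: smooth_on_def)
  then show ?thesis using smooth_on_imp_smooth_map_on by blast
qed

lemma smooth_map_on_circle_param:
  "smooth_map_on (sphere 0 1) g \<Longrightarrow> smooth_map_on UNIV (\<lambda>t::real. g (cis (2 * pi * t)))"
  by (rule smooth_map_on_compose[OF smooth_map_on_cis]) auto

text \<open>On the unit circle the reciprocal is the conjugate, so the winding number is the
  integral of \<open>cnj e\<close> times the velocity of \<open>e\<close>. Its imaginary part is
  \<open>2 * pi\<close> times the winding number.\<close>

lemma circle_loop_area:
  fixes e :: "real \<Rightarrow> complex"
  assumes s: "smooth_map_on UNIV e" and n: "\<And>t. norm (e t) = 1" and loop: "e 1 = e 0"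
  shows "integral {0..1} (\<lambda>t. Im (e t) * Re (frechet_derivative e (at t) 1)) = - pi * Re (winding_number e 0)"
    and "valid_path e"
proof -
  let ?e = "\<lambda>t. frechet_derivative e (at t) 1"
  note d = has_vector_derivative_smooth_real[OF s]
  have ce: "continuous_on S e" for S using continuous_on_subset[OF smooth_map_on_continuous[OF s]] by blast
  show v: "valid_path e"
    unfolding valid_path_def
    by (rule C1_differentiable_imp_piecewise) (auto simp: C1_differentiable_on_def intro!: exI[of _ ?e] d)
  have z: "0 \<notin> path_image e" 
  proof
    assume "0 \<in> path_image e"
    then obtain t where "e t = 0" by (auto simp: path_image_def)
    then show False using n[of t] by simp
  qed
  have inv: "1 / e t = cnj (e t)" for t
  proof -
    have "e t * cnj (e t) = 1" using n[of t] by (metis complex_norm_square of_real_1 one_power2)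
    moreover have "e t \<noteq> 0" using n[of t] by auto
    ultimately show ?thesis by (simp add: field_simps)
  qed
  have "winding_number e 0 = 1 / (2 * of_real pi * \<i>) * contour_integral e (\<lambda>w. 1 / (w - 0))"
    using winding_number_valid_path[OF v z] by simp
  also have "contour_integral e (\<lambda>w. 1 / (w - 0)) = integral {0..1} (\<lambda>t. cnj (e t) * ?e t)"
    unfolding contour_integral_integral by (simp add: inv vector_derivative_at[OF d(1)])
  finally have w: "integral {0..1} (\<lambda>t. cnj (e t) * ?e t) = 2 * of_real pi * \<i> * winding_number e 0" by simp
  have ic: "(\<lambda>t. cnj (e t) * ?e t) integrable_on {0..1}"
    by (intro integrable_continuous_interval continuous_intros ce d)
  have I1: "((\<lambda>t. Im (cnj (e t) * ?e t)) has_integral 2 * pi * Re (winding_number e 0)) {0..1}"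
    using has_integral_linear[OF integrable_integral[OF ic] bounded_linear_Im] unfolding w by (simp add: o_def)
  \<comment> \<open>The total derivative of \<open>Re e * Im e\<close> integrates to 0 over the
    loop. Half its difference from the winding integrand is exactly \<open>Im e\<close> times the
    derivative of \<open>Re e\<close>.\<close>
  have "((\<lambda>t. Re (e t) * Im (?e t) + Re (?e t) * Im (e t)) has_integral Re (e 1) * Im (e 1) - Re (e 0) * Im (e 0)) {0..1}"
  proof (rule fundamental_theorem_of_calculus)
    fix t :: real
    have "((\<lambda>t. Re (e t)) has_real_derivative Re (?e t)) (at t)" "((\<lambda>t. Im (e t)) has_real_derivative Im (?e t)) (at t)"
      using d(1)[of t] by (auto simp: has_vector_derivative_complex_iff)
    from DERIV_mult[OF this] show "((\<lambda>t. Re (e t) * Im (e t)) has_vector_derivative Re (e t) * Im (?e t) + Re (?e t) * Im (e t)) (at t within {0..1})"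
      by (simp add: has_real_derivative_iff_has_vector_derivative has_vector_derivative_at_within algebra_simps)
  qed simp
  then have I2: "((\<lambda>t. Re (e t) * Im (?e t) + Re (?e t) * Im (e t)) has_integral 0) {0..1}" using loop by simp
  have "((\<lambda>t. (Re (e t) * Im (?e t) + Re (?e t) * Im (e t) - Im (cnj (e t) * ?e t)) * (1/2)) has_integral (0 - 2 * pi * Re (winding_number e 0)) * (1/2)) {0..1}"
    by (intro has_integral_mult_left has_integral_diff I1 I2)
  then have "((\<lambda>t. Im (e t) * Re (?e t)) has_integral - pi * Re (winding_number e 0)) {0..1}"
    by (simp add: algebra_simps)
  then show "integral {0..1} (\<lambda>t. Im (e t) * Re (?e t)) = - pi * Re (winding_number e 0)" by (rule integral_unique)
qed

text \<open>Green's formula is applied in each coordinate with the imaginary part as first and the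
  real part as second function; exchanging their order accounts for the minus sign.\<close>

lemma symplectic_area_eq_boundary_integral:
  fixes u :: "complex \<Rightarrow> complex^'n"
  assumes u: "smooth_map_on (cball 0 1) u"
    and u': "\<And>t. ((\<lambda>t. u (cis (2 * pi * t))) has_vector_derivative u' t) (at t)"
    and c: "continuous_on {0..1} u'"
  shows "symplectic_area u = - integral {0..1} (\<lambda>t. \<Sum>j\<in>UNIV. Im (u (cis (2 * pi * t)) $ j) * Re (u' t $ j))"
proof -
  let ?a = "\<lambda>j z. Re (u z $ j)" and ?b = "\<lambda>j z. Im (u z $ j)" and ?u = "\<lambda>t. u (cis (2 * pi * t))"
  have sa: "smooth_map_on (cball 0 1) (?a j)" and sb: "smooth_map_on (cball 0 1) (?b j)" for j
    by (intro smooth_map_on_Re smooth_map_on_Im smooth_map_on_nth u)+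
  have a': "((\<lambda>t. ?a j (cis (2 * pi * t))) has_real_derivative Re (u' t $ j)) (at t)" for j t
    using bounded_linear.has_vector_derivative[OF bounded_linear_compose[OF bounded_linear_Re bounded_linear_vec_nth[of j]] u'[of t]]
    by (simp add: has_real_derivative_iff_has_vector_derivative)
  have u0: "smooth_on (ball 0 1) u"
    by (rule smooth_map_on_open[OF open_ball smooth_map_on_subset[OF u ball_subset_cball]])
  have pd: "frechet_derivative (?a j) (at z) v = Re (frechet_derivative u (at z) v $ j)"
    "frechet_derivative (?b j) (at z) v = Im (frechet_derivative u (at z) v $ j)" if "z \<in> ball 0 1" for j z v
  proof -
    note D = smooth_onD[OF u0 that]
    have "(?a j has_derivative (\<lambda>v. Re (frechet_derivative u (at z) v $ j))) (at z)"
      "(?b j has_derivative (\<lambda>v. Im (frechet_derivative u (at z) v $ j))) (at z)"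
      using bounded_linear.has_derivative[OF bounded_linear_compose[OF bounded_linear_Re bounded_linear_vec_nth[of j]] D]
        bounded_linear.has_derivative[OF bounded_linear_compose[OF bounded_linear_Im bounded_linear_vec_nth[of j]] D] by simp_all
    from this[THEN frechet_derivative_at] show "frechet_derivative (?a j) (at z) v = Re (frechet_derivative u (at z) v $ j)"
      "frechet_derivative (?b j) (at z) v = Im (frechet_derivative u (at z) v $ j)" by (metis, metis)
  qed
  have cu: "continuous_on {0..1} (\<lambda>t. ?b j (cis (2 * pi * t)) * Re (u' t $ j))" for j
  proof (intro continuous_intros c)
    show "continuous_on {0..1} ?u"
      using u' continuous_at_imp_continuous_on has_vector_derivative_continuous by blast
  qed
  have "((\<lambda>z. - (\<Sum>j\<in>UNIV. frechet_derivative (?b j) (at z) 1 * frechet_derivative (?a j) (at z) \<i>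
      - frechet_derivative (?b j) (at z) \<i> * frechet_derivative (?a j) (at z) 1)) has_integral
      - (\<Sum>j\<in>UNIV. integral {0..1} (\<lambda>t. ?b j (cis (2 * pi * t)) * Re (u' t $ j)))) (ball 0 1)"
    by (intro has_integral_neg has_integral_sum finite_UNIV finite green_disc sa sb a')
  then have "((\<lambda>z. std_symplectic (frechet_derivative u (at z) 1) (frechet_derivative u (at z) \<i>)) has_integral
      - (\<Sum>j\<in>UNIV. integral {0..1} (\<lambda>t. ?b j (cis (2 * pi * t)) * Re (u' t $ j)))) (ball 0 1)"
    by (rule has_integral_eq[rotated]) (simp add: pd std_symplectic_def algebra_simps flip: sum_negf)
  then have "symplectic_area u = - (\<Sum>j\<in>UNIV. integral {0..1} (\<lambda>t. ?b j (cis (2 * pi * t)) * Re (u' t $ j)))"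
    unfolding symplectic_area_def by (rule integral_unique)
  also have "(\<Sum>j\<in>UNIV. integral {0..1} (\<lambda>t. ?b j (cis (2 * pi * t)) * Re (u' t $ j))) = integral {0..1} (\<lambda>t. \<Sum>j\<in>UNIV. ?b j (cis (2 * pi * t)) * Re (u' t $ j))"
    by (rule integral_sum[symmetric]) (auto intro!: integrable_continuous_interval cu)
  finally show ?thesis .
qed

context good_suspension
begin

lemma smooth_phase_factor:
  assumes "smooth_map_on X e" "smooth_map_on X q"
  shows "smooth_map_on X (\<lambda>t. phase_factor (e t) (q t))"
proof -
  have s: "smooth_map_on X (\<lambda>t. g (shadow (q t)))" if "smooth_on UNIV g" for g :: "complex \<Rightarrow> real"
    by (rule smooth_map_on_compose[OF assms(2) smooth_map_on_comp_shadow[OF that, where X = UNIV]]) simp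
  show ?thesis
    unfolding phase_factor_def Let_def grad2_def hess_trace_def hess_det_def hess_adj_def
    by (intro smooth_intros s smooth_\<psi>x smooth_\<psi>y smooth_second assms)
qed

text \<open>The factor \<open>\<i>\<close> turns the forbidden half-line of imaginary numbers into
  the branch cut of the principal logarithm.\<close>

lemma rotated_phase_factor_slit:
  assumes "norm e = 1" "q \<in> \<Sigma>"
  shows "\<i> * phase_factor e q \<notin> \<real>\<^sub>\<le>\<^sub>0"
  using slit[OF assms] by (auto simp: complex_nonpos_Reals_iff)

text \<open>The smooth inverse turns the boundary of the disc into a smooth loop
  \<open>(e, q)\<close> in the product. Area and Maslov index are both computed on this loop, and
  both see only the winding of \<open>e\<close>, whatever the class of \<open>q\<close> in the
  surface.\<close>

lemma monotone_boundary_loop: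
  assumes u: "disc_with_boundary_on L u"
  defines "e \<equiv> \<lambda>t. fst (finv (u (cis (2 * pi * t))))"
  shows "symplectic_area u = pi * \<epsilon>\<^sup>2 * Re (winding_number e 0)"
    and "of_int (maslov_index L u) = 2 * winding_number e 0"
proof -
  define q where "q = (\<lambda>t. snd (finv (u (cis (2 * pi * t)))))"
  have us: "smooth_map_on (cball 0 1) u" and ub: "u ` sphere 0 1 \<subseteq> L" using u by (auto simp: disc_with_boundary_on_def)
  have m: "u (cis (2 * pi * t)) \<in> L" for t using ub by (auto simp: image_subset_iff)
  have sl: "smooth_map_on (sphere 0 1) (\<lambda>z. finv (u z))"
    by (rule smooth_map_on_compose[OF smooth_map_on_subset[OF us] smooth_finv ub]) auto
  have p: "smooth_map_on UNIV (\<lambda>t::real. finv (u (cis (2 * pi * t))))"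
    by (rule smooth_map_on_circle_param[OF sl])
  have se: "smooth_map_on UNIV e" and sq: "smooth_map_on UNIV q"
    unfolding e_def q_def by (intro smooth_map_on_fst smooth_map_on_snd p)+
  have fin: "finv y \<in> M \<and> f (finv y) = y" if "y \<in> L" for y
    using homeomorphism_f that by (auto simp: homeomorphism_def)
  have eq: "norm (e t) = 1" "q t \<in> \<Sigma>" "u (cis (2 * pi * t)) = f (e t, q t)" for t
    using fin[OF m[of t]] unfolding e_def q_def by (auto simp: mem_Times_iff)
  have loop: "e 1 = e 0" "q 1 = q 0" by (simp_all add: e_def q_def)
  define e' where "e' t = frechet_derivative e (at t) 1" for t
  define q' where "q' t = frechet_derivative q (at t) 1" for t
  note de = has_vector_derivative_smooth_real[OF se, folded e'_def]
  note dq = has_vector_derivative_smooth_real[OF sq, folded q'_def]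
  note W = circle_loop_area[OF se eq(1) loop(1), folded e'_def]
  have u': "((\<lambda>t. u (cis (2 * pi * t))) has_vector_derivative df (e t, q t) (e' t) (q' t)) (at t)" for t
    unfolding eq(3) by (rule has_vector_derivative_f[OF de(1) dq(1)])
  have su: "smooth_map_on UNIV (\<lambda>t::real. u (cis (2 * pi * t)))"
    by (rule smooth_map_on_circle_param[OF smooth_map_on_subset[OF us]]) auto
  have "df (e t, q t) (e' t) (q' t) = frechet_derivative (\<lambda>t. u (cis (2 * pi * t))) (at t) 1" for t
    by (rule vector_derivative_unique_at[OF u' has_vector_derivative_smooth_real(1)[OF su]])
  then have cu': "continuous_on {0..1} (\<lambda>t. df (e t, q t) (e' t) (q' t))"
    using has_vector_derivative_smooth_real(2)[OF su] by simp
  have tang: "2 * q t $ 3 * q' t $ 3 = \<psi>x (shadow (q t)) * q' t $ 1 + \<psi>y (shadow (q t)) * q' t $ 2" for t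
  proof -
    have "((\<lambda>t. F (q t)) has_vector_derivative 2 * q t $ 3 * q' t $ 3 - (\<psi>x (shadow (q t)) * q' t $ 1 + \<psi>y (shadow (q t)) * q' t $ 2)) (at t)"
      using vector_derivative_diff_chain_within[OF dq(1) has_derivative_at_withinI[OF DF]] by (simp add: o_def)
    moreover have "F (q t) = 0" for t using eq(2)[of t] by (simp add: \<Sigma>_eq)
    then have "((\<lambda>t. F (q t)) has_vector_derivative 0) (at t)" by simp
    ultimately show ?thesis using vector_derivative_unique_at by force
  qed
  have "(\<Sum>j\<in>UNIV. Im (u (cis (2 * pi * t)) $ j) * Re (df (e t, q t) (e' t) (q' t) $ j))
     = \<epsilon> * Re (e' t) + \<epsilon>\<^sup>2 * (Im (e t) * Re (e' t))" for t
  proof -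
    \<comment> \<open>All terms coming from the surface collect in one bracket, which is the
      tangency equation and vanishes along the loop.\<close>
    have "(\<Sum>j\<in>UNIV. Im (u (cis (2 * pi * t)) $ j) * Re (df (e t, q t) (e' t) (q' t) $ j))
      = (1 + \<epsilon> * Im (e t)) * (\<epsilon> * Re (e' t) + k * q t $ 3 * (2 * q t $ 3 * q' t $ 3 - (\<psi>x (shadow (q t)) * q' t $ 1 + \<psi>y (shadow (q t)) * q' t $ 2)))"
      unfolding eq(3) sum_3 f_nth df_nth complex.sel fst_conv snd_conv by (simp add: algebra_simps power2_eq_square)
    then show ?thesis unfolding tang by (simp add: algebra_simps power2_eq_square)
  qed
  then have "symplectic_area u = - integral {0..1} (\<lambda>t. \<epsilon> * Re (e' t) + \<epsilon>\<^sup>2 * (Im (e t) * Re (e' t)))"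
    unfolding symplectic_area_eq_boundary_integral[OF us u' cu'] by simp
  also have "integral {0..1} (\<lambda>t. \<epsilon> * Re (e' t) + \<epsilon>\<^sup>2 * (Im (e t) * Re (e' t)))
      = \<epsilon> * integral {0..1} (\<lambda>t. Re (e' t)) + \<epsilon>\<^sup>2 * integral {0..1} (\<lambda>t. Im (e t) * Re (e' t))"
  proof -
    have "(\<lambda>t. Re (e' t)) integrable_on {0..1}" "(\<lambda>t. Im (e t) * Re (e' t)) integrable_on {0..1}"
      by (intro integrable_continuous_interval continuous_intros de continuous_on_subset[OF smooth_map_on_continuous[OF se]] subset_UNIV)+
    from this[THEN integrable_integral] show ?thesis by (intro integral_unique has_integral_add has_integral_mult_right)
  qed
  also have "integral {0..1} (\<lambda>t. Re (e' t)) = 0"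
  proof -
    have "((\<lambda>t. Re (e' t)) has_integral Re (e 1) - Re (e 0)) {0..1}"
      by (rule fundamental_theorem_of_calculus) 
         (auto intro!: bounded_linear.has_vector_derivative[OF bounded_linear_Re] has_vector_derivative_at_within[OF de(1)])
    then show ?thesis using loop by (simp add: integral_unique)
  qed
  finally show "symplectic_area u = pi * \<epsilon>\<^sup>2 * Re (winding_number e 0)" unfolding W(1) by simp
  let ?h = "\<lambda>t. \<i> * phase_factor (e t) (q t)"
  have ch: "continuous_on {0..1} ?h"
    using smooth_map_on_continuous[OF smooth_phase_factor[OF se sq]] by (intro continuous_intros) (rule continuous_on_subset, auto)
  have z: "0 \<notin> path_image e"
  proof
    assume "0 \<in> path_image e"
    then obtain t where "e t = 0" by (auto simp: path_image_def)
    then show False using eq(1)[of t] by simp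
  qed
  have "det_squared (tangent_space L (u (exp (2 * of_real pi * \<i> * of_real t)))) = (e t * (?h t / norm (?h t)))\<^sup>2" for t
  proof -
    have c: "exp (2 * of_real pi * \<i> * of_real t) = cis (2 * pi * t)" by (simp add: cis_conv_exp algebra_simps)
    have "(e t, q t) \<in> M" using eq by simp
    from det_squared_L[OF this] show ?thesis unfolding c eq(3) by (simp add: norm_mult mult_ac)
  qed
  then have wn: "winding_number (\<lambda>t. det_squared (tangent_space L (u (exp (2 * of_real pi * \<i> * of_real t))))) 0 = 2 * winding_number e 0"
    using winding_number_square_slit[OF valid_path_imp_path[OF W(2)] z ch] loop rotated_phase_factor_slit[OF eq(1,2)] by simp
  have "winding_number e 0 \<in> \<int>"
    by (rule integer_winding_number[OF valid_path_imp_path[OF W(2)] _ z]) (simp add: pathstart_def pathfinish_def loop)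
  then obtain n where n: "winding_number e 0 = of_int n" by (auto elim: Ints_cases)
  have "(THE m. of_int m = (2 * winding_number e 0 :: complex)) = 2 * n"
  proof (rule the_equality)
    show "of_int (2 * n) = 2 * winding_number e 0" by (simp add: n)
    show "m = 2 * n" if "of_int m = 2 * winding_number e 0" for m
    proof -
      have "(of_int m :: complex) = of_int (2 * n)" using that by (simp add: n)
      then show ?thesis by (simp only: of_int_eq_iff)
    qed
  qed
  then show "of_int (maslov_index L u) = 2 * winding_number e 0" unfolding maslov_index_def wn by (simp add: n)
qed

lemma monotone_lagrangian_L: "monotone_lagrangian L"
  unfolding monotone_lagrangian_def
proof (intro conjI lagrangian_submanifold_L exI[of _ "pi * \<epsilon>\<^sup>2 / 2"] allI impI)
  show "0 < pi * \<epsilon>\<^sup>2 / 2" using eps by simp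
  fix u assume u: "disc_with_boundary_on L u"
  note m = monotone_boundary_loop[OF u]
  have "of_int (maslov_index L u) = Re (of_int (maslov_index L u))" by simp
  then have "of_int (maslov_index L u) = 2 * Re (winding_number (\<lambda>t. fst (finv (u (cis (2 * pi * t))))) 0)" unfolding m(2) by simp
  then show "symplectic_area u = pi * \<epsilon>\<^sup>2 / 2 * of_int (maslov_index L u)" unfolding m(1) by simp
qed

end


section \<open>Choice of the parameters\<close>

lemma smooth_on_UNIV_mult_regular:
  fixes P Q :: "complex \<Rightarrow> real"
  assumes P: "smooth_on UNIV P" and Q: "smooth_on UNIV Q" and z: "P z = 0" "Q z \<noteq> 0"
    and v: "frechet_derivative P (at z) v \<noteq> 0"
  shows "frechet_derivative (\<lambda>z. P z * Q z) (at z) v \<noteq> 0"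
proof -
  have "((\<lambda>z. P z * Q z) has_derivative (\<lambda>h. P z * frechet_derivative Q (at z) h + frechet_derivative P (at z) h * Q z)) (at z)"
    by (rule has_derivative_mult; rule smooth_onD[OF P UNIV_I] smooth_onD[OF Q UNIV_I])
  from frechet_derivative_at[OF this, symmetric] show ?thesis using z v by simp
qed

lemma smooth_on_norm_square:
  fixes c :: complex
  shows "smooth_on UNIV (\<lambda>z. (norm (z - c))\<^sup>2)"
  unfolding cmod_power2 by (rule smooth_map_on_open[OF open_UNIV]) (intro smooth_intros)

lemma frechet_derivative_norm_square:
  fixes c :: complex
  shows "frechet_derivative (\<lambda>z. a * (norm (z - c))\<^sup>2 + b) (at z) (z - c) = 2 * a * (norm (z - c))\<^sup>2"
proof -
  have "((\<lambda>z. a * ((z - c) \<bullet> (z - c)) + b) has_derivative (\<lambda>v. a * ((z - c) \<bullet> v + v \<bullet> (z - c)))) (at z)"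
    by (auto intro!: derivative_eq_intros)
  from frechet_derivative_at[OF this, symmetric] show ?thesis by (simp add: power2_norm_eq_inner)
qed

lemma smooth_planar_poly: "smooth_on UNIV (planar_poly g)"
proof -
  have "smooth_map_on UNIV (\<lambda>z::complex. (norm (z - c))\<^sup>2)" for c
    using smooth_on_imp_smooth_map_on[OF open_UNIV smooth_on_norm_square] by auto
  from this this[of 0] show ?thesis
    unfolding planar_poly_def[abs_def]
    by (intro smooth_map_on_open open_UNIV smooth_map_on_mult smooth_map_on_diff smooth_map_on_prod smooth_map_on_const) simp_all
qed

text \<open>The boundary circles are pairwise disjoint, so on each of them exactly one factor of the
  polynomial vanishes. That factor has nonzero derivative in the radial direction, and the remaining
  product is nonzero there.\<close>

lemma planar_poly_regular:
  assumes "planar_poly g z = 0"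
  shows "\<exists>v. frechet_derivative (planar_poly g) (at z) v \<noteq> 0"
proof -
  have sm: "smooth_map_on UNIV (\<lambda>z::complex. (norm (z - c))\<^sup>2)" for c
    using smooth_on_imp_smooth_map_on[OF open_UNIV smooth_on_norm_square] by auto
  have sm0: "smooth_map_on UNIV (\<lambda>z::complex. (norm z)\<^sup>2)" using sm[of 0] by simp
  show ?thesis
  proof (cases "\<exists>i<g. norm (z - hole_center i) = 1")
    case True
    then obtain i where i: "i < g" "norm (z - hole_center i) = 1" by blast
    let ?P = "\<lambda>z. 1 * (norm (z - hole_center i))\<^sup>2 + (- 1)"
    let ?Q = "\<lambda>z. ((4 * real g + 4)\<^sup>2 - (norm z)\<^sup>2) * (\<Prod>j\<in>{..<g} - {i}. (norm (z - hole_center j))\<^sup>2 - 1)"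
    have e: "planar_poly g = (\<lambda>z. ?P z * ?Q z)"
      using i(1) by (auto simp: fun_eq_iff planar_poly_def prod.remove[of "{..<g}" i] algebra_simps)
    have "smooth_on UNIV ?P" "smooth_on UNIV ?Q"
      by (rule smooth_map_on_open[OF open_UNIV]; intro smooth_map_on_mult smooth_map_on_add smooth_map_on_diff smooth_map_on_prod smooth_map_on_const sm sm0)+
    moreover have "?P z = 0" using i(2) by simp
    moreover have "?Q z \<noteq> 0"
    proof -
      have n: "norm (z - hole_center i) < 3/2" using i(2) by simp
      have "norm z < 4 * real g + 3" by (rule near_hole(1)[OF i(1) n])
      then have "(norm z)\<^sup>2 < (4 * real g + 4)\<^sup>2" by (intro power_strict_mono) auto
      moreover have "(norm (z - hole_center j))\<^sup>2 - 1 \<noteq> 0" if "j \<noteq> i" for j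
      proof -
        have "1 < norm (z - hole_center j)" using near_hole(2)[OF i(1) n that] by simp
        from one_less_power[OF this, of 2] show ?thesis by simp
      qed
      ultimately show ?thesis by (auto simp: prod_zero_iff)
    qed
    moreover have "frechet_derivative ?P (at z) (z - hole_center i) \<noteq> 0"
      unfolding frechet_derivative_norm_square using i(2) by simp
    ultimately show ?thesis unfolding e using smooth_on_UNIV_mult_regular by blast
  next
    case False
    then have n: "norm z = 4 * real g + 4" using assms planar_poly_eq_0 by blast
    let ?P = "\<lambda>z::complex. (-1) * (norm (z - 0))\<^sup>2 + (4 * real g + 4)\<^sup>2"
    let ?Q = "\<lambda>z. \<Prod>j<g. (norm (z - hole_center j))\<^sup>2 - 1"
    have e: "planar_poly g = (\<lambda>z. ?P z * ?Q z)"
      by (auto simp: fun_eq_iff planar_poly_def)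
    have "smooth_on UNIV ?P" "smooth_on UNIV ?Q"
      by (rule smooth_map_on_open[OF open_UNIV]; intro smooth_map_on_mult smooth_map_on_add smooth_map_on_diff smooth_map_on_prod smooth_map_on_const sm)+
    moreover have "?P z = 0" using n by simp
    moreover have "?Q z \<noteq> 0"
    proof -
      have "(norm (z - hole_center j))\<^sup>2 \<noteq> 1" if "j < g" for j
        using False that by (auto simp: power2_eq_1_iff) (metis norm_ge_zero not_one_le_zero le_minus_one_simps(3))
      then show ?thesis by (auto simp: prod_zero_iff)
    qed
    moreover have "frechet_derivative ?P (at z) (z - 0) \<noteq> 0"
    proof -
      have "norm z \<noteq> 0" using n by linarith
      then show ?thesis unfolding frechet_derivative_norm_square by simp
    qed
    ultimately show ?thesis unfolding e using smooth_on_UNIV_mult_regular by blast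
  qed
qed

lemma suspension_planar_poly: "suspension (planar_poly g)"
  by unfold_locales (rule smooth_planar_poly compact_double_graph_planar_poly, (erule planar_poly_regular)?)+

section \<open>Admissible values of \<open>k\<close> and \<epsilon>\<close>

context suspension
begin

text \<open>The real part is \<open>w\<close> times a quantity \<open>?B\<close> that equals 2 up to
  terms of order \<open>k\<^sup>2\<close>. For the chosen \<open>k\<close> it is positive, so the
  real part vanishes only at the fold, where the imaginary part is
  \<open>- \<tau> * k * grad2\<close> and regularity of \<psi> makes it negative.\<close>

lemma phase_factor_slit:
  assumes e: "norm e = 1" and q: "q \<in> \<Sigma>" and \<epsilon>: "0 < \<epsilon>" "\<epsilon> \<le> 1/2"
    and N: "1 \<le> N" "\<bar>q $ 3\<bar> \<le> N" "\<bar>grad2 (shadow q)\<bar> \<le> N" "\<bar>hess_adj (shadow q)\<bar> \<le> N" "\<bar>hess_det (shadow q)\<bar> \<le> N"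
    and k: "k = 1 / (4 * N\<^sup>2)" and R: "Re (phase_factor e q) = 0"
  shows "Im (phase_factor e q) < 0"
proof -
  define w G A D c s \<tau> where "w = q $ 3" and "G = grad2 (shadow q)" and "A = hess_adj (shadow q)" and "D = hess_det (shadow q)"
    and "c = Re e" and "s = Im e" and "\<tau> = 1 + \<epsilon> * Im e"
  have cs: "\<bar>c\<bar> \<le> 1" "\<bar>s\<bar> \<le> 1" using abs_Re_le_cmod[of e] abs_Im_le_cmod[of e] e by (auto simp: c_def s_def)
  have "\<bar>\<epsilon> * s\<bar> \<le> 1/2 * 1" unfolding abs_mult using \<epsilon> cs by (intro mult_mono) auto
  then have \<tau>: "1/2 \<le> \<tau>" "\<tau> \<le> 3/2" unfolding \<tau>_def s_def by linarith+
  have "1 \<le> N\<^sup>2" using N(1) by (rule one_le_power)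
  then have k0: "0 < k" "k \<le> 1" unfolding k by (auto simp: divide_simps)
  have kN: "k * N\<^sup>2 = 1/4" using N(1) by (simp add: k)
  have bN: "\<bar>w\<bar> \<le> N" "\<bar>G\<bar> \<le> N" "\<bar>A\<bar> \<le> N" "\<bar>D\<bar> \<le> N" using N by (auto simp: w_def G_def A_def D_def)
  let ?B = "2 - \<tau>\<^sup>2 * k\<^sup>2 * (A + 2 * w\<^sup>2 * D) + 2 * k\<^sup>2 * w\<^sup>2 * c * (c * G - s * \<tau> * k * w * A)"
  have "Re (phase_factor e q) = w * ?B"
    unfolding phase_factor_def Let_def by (simp add: w_def G_def A_def D_def c_def s_def \<tau>_def algebra_simps power2_eq_square power3_eq_cube)
  \<comment> \<open>Each error term is bounded by a multiple of \<open>k\<^sup>2 * N ^ 4\<close>,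
    lower powers of \<open>N\<close> being raised by means of \<open>1 \<le> N\<close>. As
    \<open>k * N\<^sup>2 = 1/4\<close>, the bounds are \<open>27/64\<close> and \<open>5/16\<close>,
    together less than 2.\<close>
  moreover have "?B > 0"
  proof -
    have NN: "N \<le> N\<^sup>2" using N(1) by (intro self_le_power) auto
    then have N2: "N\<^sup>2 * N \<le> N\<^sup>2 * N\<^sup>2" by (intro mult_left_mono) auto
    moreover have "1 * N \<le> N\<^sup>2 * N" using N(1) \<open>1 \<le> N\<^sup>2\<close> by (intro mult_right_mono) auto
    ultimately have N3: "N \<le> N\<^sup>2 * N\<^sup>2" by linarith
    have w2: "w\<^sup>2 \<le> N\<^sup>2" using power_mono[OF bN(1), of 2] by simp
    have "\<bar>A + 2 * w\<^sup>2 * D\<bar> \<le> N + 2 * N\<^sup>2 * N"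
    proof -
      have "\<bar>2 * w\<^sup>2 * D\<bar> \<le> 2 * N\<^sup>2 * N" unfolding abs_mult using w2 bN(4) by (intro mult_mono) auto
      then show ?thesis using bN(3) by linarith
    qed
    also have "\<dots> \<le> 3 * (N\<^sup>2 * N\<^sup>2)" using N2 N3 by linarith
    finally have 1: "\<bar>A + 2 * w\<^sup>2 * D\<bar> \<le> 3 * (N\<^sup>2 * N\<^sup>2)" .
    have "\<tau>\<^sup>2 \<le> (3/2)\<^sup>2" using \<tau> by (intro power_mono) auto
    then have "\<bar>\<tau>\<^sup>2 * k\<^sup>2 * (A + 2 * w\<^sup>2 * D)\<bar> \<le> (3/2)\<^sup>2 * k\<^sup>2 * (3 * (N\<^sup>2 * N\<^sup>2))"
      unfolding abs_mult using 1 by (intro mult_mono) auto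
    also have "\<dots> = 27/4 * (k * N\<^sup>2)\<^sup>2" by (simp add: power2_eq_square)
    finally have t1: "\<bar>\<tau>\<^sup>2 * k\<^sup>2 * (A + 2 * w\<^sup>2 * D)\<bar> \<le> 27/64" unfolding kN by (simp add: power2_eq_square)
    have "\<bar>c * G\<bar> \<le> 1 * N" unfolding abs_mult using cs bN by (intro mult_mono) auto
    moreover have "\<bar>s * \<tau> * k * w * A\<bar> \<le> 1 * (3/2) * 1 * N * N" 
      unfolding abs_mult using cs bN \<tau> k0 N(1) by (intro mult_mono) auto
    ultimately have "\<bar>c * G - s * \<tau> * k * w * A\<bar> \<le> N + 3/2 * N\<^sup>2" by (simp add: power2_eq_square)
    also have "\<dots> \<le> 5/2 * N\<^sup>2" using N(1) by (simp add: power2_eq_square)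
    finally have 2: "\<bar>c * G - s * \<tau> * k * w * A\<bar> \<le> 5/2 * N\<^sup>2" .
    have "\<bar>2 * k\<^sup>2 * w\<^sup>2 * c * (c * G - s * \<tau> * k * w * A)\<bar> \<le> 2 * k\<^sup>2 * N\<^sup>2 * 1 * (5/2 * N\<^sup>2)"
      unfolding abs_mult using 2 w2 cs by (intro mult_mono) (auto intro!: mult_nonneg_nonneg)
    also have "\<dots> = 5 * (k * N\<^sup>2)\<^sup>2" by (simp add: power2_eq_square)
    finally have "\<bar>2 * k\<^sup>2 * w\<^sup>2 * c * (c * G - s * \<tau> * k * w * A)\<bar> \<le> 5/16" unfolding kN by (simp add: power2_eq_square)
    with t1 show ?thesis by linarith
  qed
  ultimately have w0: "q $ 3 = 0" using R by (simp add: w_def)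
  then have "G > 0" using grad_nonzero[of "shadow q"] q by (auto simp: G_def grad2_def double_graph_def)
  moreover have "Im (phase_factor e q) = - (\<tau> * k * G)"
    unfolding phase_factor_def Let_def by (simp add: w0 G_def \<tau>_def)
  ultimately show ?thesis using \<tau> k0 by simp
qed

text \<open>Points of the surface over critical points of \<psi> form a compact set, and none of
  them has height 0, as the zero level is regular. The cubed height therefore attains a positive
  minimum.\<close>

lemma exists_height_gap:
  assumes "k > 0"
  shows "\<exists>\<epsilon>>0. \<epsilon> \<le> 1/2 \<and> (\<forall>q\<in>\<Sigma>. grad2 (shadow q) = 0 \<longrightarrow> 2 * \<epsilon> < 4/3 * k * \<bar>q $ 3\<bar> ^ 3)"
proof -
  let ?C = "{q \<in> \<Sigma>. grad2 (shadow q) = 0}"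
  have "continuous_on \<Sigma> (\<lambda>q. grad2 (shadow q))"
    unfolding grad2_def by (intro continuous_intros smooth_on_comp_shadow_cont smooth_\<psi>x smooth_\<psi>y)
  then have C: "compact ?C"
    using compact_\<Sigma> continuous_closedin_preimage_constant closedin_compact by blast
  have pos: "\<bar>q $ 3\<bar> ^ 3 > 0" if "q \<in> ?C" for q
    using that grad_nonzero[of "shadow q"] by (auto simp: grad2_def double_graph_def)
  show ?thesis
  proof (cases "?C = {}")
    case True
    then show ?thesis by (intro exI[of _ "1/2"]) auto
  next
    case False
    have "continuous_on ?C (\<lambda>q. \<bar>q $ 3\<bar> ^ 3)" by (intro continuous_intros)
    from continuous_attains_inf[OF C False this]
    obtain q0 where q0: "q0 \<in> ?C" "\<And>q. q \<in> ?C \<Longrightarrow> \<bar>q0 $ 3\<bar> ^ 3 \<le> \<bar>q $ 3\<bar> ^ 3" by blast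
    \<comment> \<open>With \<epsilon> at most \<open>?m / 3\<close> the diameter of the circle is at
      most \<open>2/3 * ?m\<close>, below the gap \<open>4/3 * ?m\<close>.\<close>
    let ?m = "k * \<bar>q0 $ 3\<bar> ^ 3"
    have m: "?m > 0" using pos[OF q0(1)] assms by simp
    have "2 * min (1/2) (?m / 3) < 4/3 * k * \<bar>q $ 3\<bar> ^ 3" if "q \<in> ?C" for q
    proof -
      have "?m \<le> k * \<bar>q $ 3\<bar> ^ 3" using q0(2)[OF that] assms by simp
      then show ?thesis using m by (auto simp: min_def mult.assoc)
    qed
    then show ?thesis using m by (intro exI[of _ "min (1/2) (?m / 3)"]) auto
  qed
qed

end

text \<open>The surface and the derivatives of \<psi> that enter the bounds do not depend on
  \<open>k\<close> and \<epsilon>. So the bounds come first and give \<open>N\<close>; then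
  \<open>k\<close> is determined by \<open>N\<close>, and finally \<epsilon> by the gap belonging to
  that \<open>k\<close>.\<close>

lemma exists_good_suspension:
  assumes "suspension \<psi>"
  shows "\<exists>k \<epsilon>. good_suspension \<psi> k \<epsilon>"
proof -
  \<comment> \<open>The values 1 are placeholders that give access to the derivatives of \<psi>
    before the constants exist.\<close>
  interpret suspension \<psi> 1 1 by (rule assms)
  have "\<exists>B. \<forall>q\<in>\<Sigma>. \<bar>h q\<bar> \<le> B" if "continuous_on \<Sigma> h" for h :: "real^3 \<Rightarrow> real"
  proof -
    have "bounded (h ` \<Sigma>)" by (rule compact_imp_bounded[OF compact_continuous_image[OF that compact_\<Sigma>]])
    then show ?thesis by (auto simp: bounded_iff)
  qed
  note bd = this
  note sc = smooth_on_comp_shadow_cont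
  obtain B1 where B1: "\<And>q. q \<in> \<Sigma> \<Longrightarrow> \<bar>q $ 3\<bar> \<le> B1"
  proof -
    have "continuous_on \<Sigma> (\<lambda>q. q $ 3)" by (intro continuous_intros)
    from bd[OF this] show thesis using that by blast
  qed
  obtain B2 where B2: "\<And>q. q \<in> \<Sigma> \<Longrightarrow> \<bar>grad2 (shadow q)\<bar> \<le> B2"
  proof -
    have "continuous_on \<Sigma> (\<lambda>q. grad2 (shadow q))"
      unfolding grad2_def by (intro continuous_intros sc smooth_\<psi>x smooth_\<psi>y)
    from bd[OF this] show thesis using that by blast
  qed
  obtain B3 where B3: "\<And>q. q \<in> \<Sigma> \<Longrightarrow> \<bar>hess_adj (shadow q)\<bar> \<le> B3"
  proof -
    have "continuous_on \<Sigma> (\<lambda>q. hess_adj (shadow q))"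
      unfolding hess_adj_def by (intro continuous_intros sc smooth_\<psi>x smooth_\<psi>y smooth_second)
    from bd[OF this] show thesis using that by blast
  qed
  obtain B4 where B4: "\<And>q. q \<in> \<Sigma> \<Longrightarrow> \<bar>hess_det (shadow q)\<bar> \<le> B4"
  proof -
    have "continuous_on \<Sigma> (\<lambda>q. hess_det (shadow q))"
      unfolding hess_det_def by (intro continuous_intros sc smooth_second)
    from bd[OF this] show thesis using that by blast
  qed
  define N where "N = Max {1, B1, B2, B3, B4}"
  have N: "1 \<le> N" "B1 \<le> N" "B2 \<le> N" "B3 \<le> N" "B4 \<le> N" unfolding N_def by (intro Max_ge; simp)+
  define k where "k = 1 / (4 * N\<^sup>2)"
  have k: "k > 0" using N(1) by (simp add: k_def)
  obtain \<epsilon> where \<epsilon>: "0 < \<epsilon>" "\<epsilon> \<le> 1/2" "\<And>q. q \<in> \<Sigma> \<Longrightarrow> grad2 (shadow q) = 0 \<Longrightarrow> 2 * \<epsilon> < 4/3 * k * \<bar>q $ 3\<bar> ^ 3"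
  proof -
    interpret K: suspension \<psi> k 1 by (rule assms)
    show thesis using K.exists_height_gap[OF k] that by blast
  qed
  interpret E: suspension \<psi> k \<epsilon> by (rule assms)
  have "good_suspension \<psi> k \<epsilon>"
  proof unfold_locales
    fix e :: complex and q :: "real^3"
    assume *: "norm e = 1" "q \<in> \<Sigma>" "Re (E.phase_factor e q) = 0"
    show "Im (E.phase_factor e q) < 0"
      by (rule E.phase_factor_slit[OF *(1,2) \<epsilon>(1,2) N(1) _ _ _ _ k_def *(3)])
         (use B1 B2 B3 B4 N *(2) in \<open>force+\<close>)
  qed (use k \<epsilon> in auto)
  then show ?thesis by blast
qed

theorem mainTheorem4:
  fixes g :: nat
  shows "\<exists>\<Sigma> :: (real^3) set. closed_orientable_surface_of_genus g \<Sigma> \<and>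
    (\<exists>f :: complex \<times> (real^3) \<Rightarrow> complex^3.
       monotone_lagrangian_embedding (sphere 0 1 \<times> \<Sigma>) f)"
proof -
  let ?\<Sigma> = "double_graph (planar_poly g)"
  obtain k \<epsilon> where "good_suspension (planar_poly g) k \<epsilon>"
    using exists_good_suspension[OF suspension_planar_poly] by blast
  then interpret good_suspension "planar_poly g" k \<epsilon> .
  have "norm (complex_of_real (4 * real g + 4)) = 4 * real g + 4" unfolding norm_of_real by simp
  then have "vec3 (4 * real g + 4) 0 0 \<in> ?\<Sigma>"
    by (simp add: double_graph_def shadow_def planar_poly_eq_0 complex_of_real_def del: of_real_add of_real_mult)
  then have "closed_orientable_surface_of_genus g ?\<Sigma>"
    unfolding closed_orientable_surface_of_genus_def
    using orientable_\<Sigma> compact_\<Sigma> connected_double_graph_planar_poly homology_group_1_double_graph by blast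
  moreover have "monotone_lagrangian_embedding (sphere 0 1 \<times> ?\<Sigma>) f"
    unfolding monotone_lagrangian_embedding_def using lagrangian_embedding_f monotone_lagrangian_L by blast
  ultimately show ?thesis by blast
qed

end
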